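(* Let $G$ be a Lie group with Lie algebra $\mathfrak g$. Consider the action of the Abelian group $\mathfrak g_2=\mathfrak g$ on Tulczyjew's symplectic space ${}^{1}TT^*G=(G\circledS\mathfrak g_1^* )\circledS(\mathfrak g_2\circledS\mathfrak g_3^* )$ given by $(\eta;(g,\mu,\xi,\nu))\mapsto(g,\mu,\xi+\eta,\nu)$, with momentum mapping $\mathbf J:(g,\mu,\xi,\nu)\mapsto\mu\in\mathfrak g^*$. The symplectic reduction of ${}^{1}TT^*G$ under this action gives, at $\mu\in\mathfrak g^*$, the reduced space $$\mathbf J^{-1}(\mu)/\mathfrak g_2\simeq G\circledS\mathfrak g_3^*$$ with the canonical symplectic two-form $\Omega_{G\circledS\mathfrak g_3^*}$.
   Context: Conventions. $G$ is a (finite-dimensional) Lie group with identity $e$, $\mathfrak g=T_eG$, $\mathfrak g^*$ its dual. $R_g$ is right translation. $Ad_g$ is the tangent map at $e$ of $h\mapsto g^{-1}hg$; the Lie bracket is $[\xi,\eta]=ad_\xi\eta=\frac{d}{dt}|_{t=0}Ad_{\exp(t\xi)}\eta$ (the bracket of right invariant vector fields). $\langle ad^*_\xi\mu,\eta\rangle=\langle\mu,[\xi,\eta]\rangle$. Hamiltonian convention: $i_{X_E}\Omega=-dE$. Subscripts on copies of $\mathfrak g,\mathfrak g^*$ are only labels. As a manifold ${}^{1}TT^*G=G\times\mathfrak g^*\times\mathfrak g\times\mathfrak g^*\ni(g,\mu,\xi,\nu)$. For $(\xi_2,\nu_2,\xi_3,\nu_3)\in\mathfrak g\times\mathfrak g^*\times\mathfrak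 g\times\mathfrak g^*$ let $$X_{(\xi_2,\nu_2,\xi_3,\nu_3)}(g,\mu,\xi,\nu)=(T_eR_g\xi_2,\ \nu_2+ad^*_{\xi_2}\mu,\ \xi_3+[\xi,\xi_2],\ \nu_3+ad^*_{\xi_2}\nu-ad^*_\xi\nu_2).$$ The symplectic form is determined by $$\Omega(X_{(\xi_2,\nu_2,\xi_3,\nu_3)},X_{(\bar\xi_2,\bar\nu_2,\bar\xi_3,\bar\nu_3)})=\langle\nu_3,\bar\xi_2\rangle+\langle\nu_2,\bar\xi_3\rangle-\langle\bar\nu_2,\xi_3\rangle-\langle\bar\nu_3,\xi_2\rangle+\langle\nu,[\xi_2,\bar\xi_2]\rangle+\langle\mu,[\xi_3,\bar\xi_2]+[\xi_2,\bar\xi_3]+[\xi,[\xi_2,\bar\xi_2]]\rangle.$$ $G\circledS\mathfrak g^*$ is $G\times\mathfrak g^*$ as a manifold; with $X_{(\xi,\nu)}(g,\mu)=(T_eR_g\xi,\nu+ad^*_\xi\mu)$, its canonical symplectic form is determined by $$\Omega_{G\circledS\mathfrak g^*}(X_{(\xi,\nu)},X_{(\eta,\lambda)})(g,\mu)=\langle\nu,\eta\rangle-\langle\lambda,\xi\rangle+\langle\mu,[\xi,\eta]\rangle.$$ *)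

theory Defs
  imports "HOL-Analysis.Analysis" "HOL-Algebra.Group_Action"
begin

section \<open>Smooth maps between finite-dimensional normed spaces\<close>

text \<open>
  C^k on an open set, by iterated directional derivatives.  On a finite-dimensional domain this
  is the usual notion; manifolds below are always modelled on finite-dimensional spaces.
\<close>

primrec kdiff_on ::
  "nat \<Rightarrow> ('a::real_normed_vector \<Rightarrow> 'b::real_normed_vector) \<Rightarrow> 'a set \<Rightarrow> bool" where
  "kdiff_on 0 f S \<longleftrightarrow> continuous_on S f"
| "kdiff_on (Suc k) f S \<longleftrightarrow>
     (\<forall>x\<in>S. f differentiable (at x)) \<and>
     (\<forall>v. kdiff_on k (\<lambda>x. frechet_derivative f (at x) v) S)"

definition smooth_on ::
  "('a::real_normed_vector) set \<Rightarrow> ('a \<Rightarrow> 'b::real_normed_vector) \<Rightarrow> bool" where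
  "smooth_on S f \<longleftrightarrow> (\<forall>k. kdiff_on k f S)"


section \<open>Manifolds\<close>

text \<open>
  A manifold is a topology with an atlas indexed by points: \<open>chart M p\<close>, defined on
  \<open>chart_dom M p\<close>, is a chosen chart around \<open>p\<close>.  Every smooth structure arises from such a
  family.  The tangent space at \<open>p\<close> is the whole model space \<open>'e\<close>, a tangent vector being
  represented by its coordinates in the chart chosen at \<open>p\<close>.
\<close>

record ('a, 'e) manifold =
  mtop :: "'a topology"
  chart_dom :: "'a \<Rightarrow> 'a set"
  chart :: "'a \<Rightarrow> 'a \<Rightarrow> 'e"

definition points :: "('a, 'e, 'm) manifold_scheme \<Rightarrow> 'a set" where
  "points M = topspace (mtop M)"

definition chart_image :: "('a, 'e, 'm) manifold_scheme \<Rightarrow> 'a \<Rightarrow> 'e set" where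
  "chart_image M p = chart M p ` chart_dom M p"

definition chart_inv :: "('a, 'e, 'm) manifold_scheme \<Rightarrow> 'a \<Rightarrow> 'e \<Rightarrow> 'a" where
  "chart_inv M p = the_inv_into (chart_dom M p) (chart M p)"

definition smooth_manifold :: "('a, 'e::real_normed_vector) manifold \<Rightarrow> bool" where
  "smooth_manifold M \<longleftrightarrow>
     (\<exists>B::'e set. finite B \<and> span B = UNIV) \<and>
     Hausdorff_space (mtop M) \<and> second_countable (mtop M) \<and>
     (\<forall>p\<in>points M. p \<in> chart_dom M p \<and> openin (mtop M) (chart_dom M p) \<and>
        open (chart_image M p) \<and>
        homeomorphic_map (subtopology (mtop M) (chart_dom M p))
          (top_of_set (chart_image M p)) (chart M p)) \<and>
     (\<forall>p\<in>points M. \<forall>q\<in>points M.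
        smooth_on (chart M p ` (chart_dom M p \<inter> chart_dom M q)) (chart M q \<circ> chart_inv M p))"

definition smooth_map ::
  "('a, 'e::real_normed_vector) manifold \<Rightarrow> ('b, 'f::real_normed_vector) manifold
    \<Rightarrow> ('a \<Rightarrow> 'b) \<Rightarrow> bool" where
  "smooth_map M N f \<longleftrightarrow>
     continuous_map (mtop M) (mtop N) f \<and>
     (\<forall>p\<in>points M. \<forall>q\<in>points N.
        smooth_on (chart M p ` {x \<in> chart_dom M p. f x \<in> chart_dom N q})
          (chart N q \<circ> f \<circ> chart_inv M p))"

definition tangent_map ::
  "('a, 'e::real_normed_vector) manifold \<Rightarrow> ('b, 'f::real_normed_vector) manifold
    \<Rightarrow> ('a \<Rightarrow> 'b) \<Rightarrow> 'a \<Rightarrow> 'e \<Rightarrow> 'f" where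
  "tangent_map M N f p =
     frechet_derivative (chart N (f p) \<circ> f \<circ> chart_inv M p) (at (chart M p p))"

definition diffeomorphism ::
  "('a, 'e::real_normed_vector) manifold \<Rightarrow> ('b, 'f::real_normed_vector) manifold
    \<Rightarrow> ('a \<Rightarrow> 'b) \<Rightarrow> bool" where
  "diffeomorphism M N f \<longleftrightarrow>
     bij_betw f (points M) (points N) \<and> smooth_map M N f \<and>
     smooth_map N M (the_inv_into (points M) f)"

definition submersion ::
  "('a, 'e::real_normed_vector) manifold \<Rightarrow> ('b, 'f::real_normed_vector) manifold
    \<Rightarrow> ('a \<Rightarrow> 'b) \<Rightarrow> bool" where
  "submersion M N f \<longleftrightarrow> smooth_map M N f \<and> (\<forall>p\<in>points M. surj (tangent_map M N f p))"

definition embedded_submanifold ::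
  "('a, 'e::real_normed_vector) manifold \<Rightarrow> ('a, 'f::real_normed_vector) manifold \<Rightarrow> bool" where
  "embedded_submanifold Z M \<longleftrightarrow>
     smooth_manifold Z \<and> smooth_manifold M \<and> points Z \<subseteq> points M \<and>
     mtop Z = subtopology (mtop M) (points Z) \<and>
     smooth_map Z M (\<lambda>p. p) \<and> (\<forall>p\<in>points Z. inj (tangent_map Z M (\<lambda>p. p) p))"

definition vec_manifold :: "('e::real_normed_vector, 'e) manifold" where
  "vec_manifold = \<lparr>mtop = euclidean, chart_dom = (\<lambda>_. UNIV), chart = (\<lambda>_ x. x)\<rparr>"

definition prod_manifold ::
  "('a, 'e::real_normed_vector) manifold \<Rightarrow> ('b, 'f::real_normed_vector) manifold
    \<Rightarrow> ('a \<times> 'b, 'e \<times> 'f) manifold" where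
  "prod_manifold M N =
     \<lparr>mtop = prod_topology (mtop M) (mtop N),
      chart_dom = (\<lambda>p. chart_dom M (fst p) \<times> chart_dom N (snd p)),
      chart = (\<lambda>p x. (chart M (fst p) (fst x), chart N (snd p) (snd x)))\<rparr>"


section \<open>Vector fields and two-forms\<close>

text \<open>A vector field \<open>X\<close> in the coordinates of the chart chosen at \<open>p\<close>.\<close>

definition field_rep ::
  "('a, 'e::real_normed_vector) manifold \<Rightarrow> 'a \<Rightarrow> ('a \<Rightarrow> 'e) \<Rightarrow> 'e \<Rightarrow> 'e" where
  "field_rep M p X x =
     (let y = chart_inv M p x in tangent_map M vec_manifold (chart M p) y (X y))"

text \<open>
  The bracket of vector fields (acting on functions as XY - YX), in coordinates DY(X) - DX(Y).
\<close>

definition field_bracket ::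
  "('a, 'e::real_normed_vector) manifold \<Rightarrow> ('a \<Rightarrow> 'e) \<Rightarrow> ('a \<Rightarrow> 'e) \<Rightarrow> 'a \<Rightarrow> 'e" where
  "field_bracket M X Y p =
     (let x = chart M p p; X' = field_rep M p X; Y' = field_rep M p Y in
        frechet_derivative Y' (at x) (X' x) - frechet_derivative X' (at x) (Y' x))"

text \<open>A two-form assigns to each point a function of two tangent vectors at that point.\<close>

type_synonym ('a, 'e) two_form = "'a \<Rightarrow> 'e \<Rightarrow> 'e \<Rightarrow> real"

definition pullback ::
  "('a, 'e::real_normed_vector) manifold \<Rightarrow> ('b, 'f::real_normed_vector) manifold
    \<Rightarrow> ('a \<Rightarrow> 'b) \<Rightarrow> ('b, 'f) two_form \<Rightarrow> ('a, 'e) two_form" where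
  "pullback M N f \<omega> p v w = \<omega> (f p) (tangent_map M N f p v) (tangent_map M N f p w)"

definition form_rep ::
  "('a, 'e::real_normed_vector) manifold \<Rightarrow> 'a \<Rightarrow> ('a, 'e) two_form \<Rightarrow> ('e, 'e) two_form" where
  "form_rep M p \<omega> = pullback vec_manifold M (chart_inv M p) \<omega>"

definition symplectic_form ::
  "('a, 'e::real_normed_vector) manifold \<Rightarrow> ('a, 'e) two_form \<Rightarrow> bool" where
  "symplectic_form M \<omega> \<longleftrightarrow>
     (\<forall>p\<in>points M. bilinear (\<omega> p) \<and> (\<forall>v w. \<omega> p v w = - \<omega> p w v) \<and>
        (\<forall>v. (\<forall>w. \<omega> p v w = 0) \<longrightarrow> v = 0)) \<and>
     (\<forall>p\<in>points M. \<forall>v w. smooth_on (chart_image M p) (\<lambda>x. form_rep M p \<omega> x v w)) \<and>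
     (\<forall>p\<in>points M. \<forall>x\<in>chart_image M p. \<forall>u v w.
        frechet_derivative (\<lambda>x. form_rep M p \<omega> x v w) (at x) u +
        frechet_derivative (\<lambda>x. form_rep M p \<omega> x w u) (at x) v +
        frechet_derivative (\<lambda>x. form_rep M p \<omega> x u v) (at x) w = 0)"

definition symplectomorphism ::
  "('a, 'e::real_normed_vector) manifold \<Rightarrow> ('a, 'e) two_form \<Rightarrow>
   ('b, 'f::real_normed_vector) manifold \<Rightarrow> ('b, 'f) two_form \<Rightarrow> ('a \<Rightarrow> 'b) \<Rightarrow> bool" where
  "symplectomorphism M \<omega> N \<sigma> f \<longleftrightarrow>
     diffeomorphism M N f \<and> (\<forall>p\<in>points M. \<forall>v w. pullback M N f \<sigma> p v w = \<omega> p v w)"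


section \<open>Lie groups\<close>

record ('g, 'e) lie_structure = "'g monoid" +
  man :: "('g, 'e) manifold"

definition lie_group :: "('g, 'e::real_normed_vector) lie_structure \<Rightarrow> bool" where
  "lie_group G \<longleftrightarrow>
     group G \<and> smooth_manifold (man G) \<and> carrier G = points (man G) \<and>
     smooth_map (prod_manifold (man G) (man G)) (man G) (\<lambda>(g, h). g \<otimes>\<^bsub>G\<^esub> h) \<and>
     smooth_map (man G) (man G) (\<lambda>g. inv\<^bsub>G\<^esub> g)"

text \<open>
  The Lie algebra, as a vector space, is the tangent space \<open>'e\<close> at the identity, and \<open>'e dual\<close>
  is its dual (all linear forms are bounded, \<open>'e\<close> being finite-dimensional).
\<close>

type_synonym 'e dual = "'e \<Rightarrow>\<^sub>L real"

definition right_inv_field ::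
  "('g, 'e::real_normed_vector) lie_structure \<Rightarrow> 'e \<Rightarrow> 'g \<Rightarrow> 'e" where
  "right_inv_field G \<xi> g = tangent_map (man G) (man G) (\<lambda>h. h \<otimes>\<^bsub>G\<^esub> g) \<one>\<^bsub>G\<^esub> \<xi>"

text \<open>
  The bracket is that of right invariant vector fields.  For matrix groups it is the negative of
  the commutator, in accordance with Ad being the tangent map of the conjugation sending h to
  \<open>g\<^sup>-\<^sup>1 h g\<close>.
\<close>

definition lie_bracket ::
  "('g, 'e::real_normed_vector) lie_structure \<Rightarrow> 'e \<Rightarrow> 'e \<Rightarrow> 'e" where
  "lie_bracket G \<xi> \<eta> =
     field_bracket (man G) (right_inv_field G \<xi>) (right_inv_field G \<eta>) \<one>\<^bsub>G\<^esub>"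

definition ad_star ::
  "('g, 'e::real_normed_vector) lie_structure \<Rightarrow> 'e \<Rightarrow> 'e dual \<Rightarrow> 'e dual" where
  "ad_star G \<xi> \<mu> = Blinfun (\<lambda>\<eta>. blinfun_apply \<mu> (lie_bracket G \<xi> \<eta>))"

definition vec_group :: "('e::real_normed_vector, 'e) lie_structure" where
  "vec_group = \<lparr>carrier = UNIV, mult = (+), one = 0, man = vec_manifold\<rparr>"


section \<open>Symplectic reduction by an Abelian group\<close>

definition smooth_action ::
  "('h, 'b::real_normed_vector) lie_structure \<Rightarrow> ('a, 'e::real_normed_vector) manifold
    \<Rightarrow> ('h \<Rightarrow> 'a \<Rightarrow> 'a) \<Rightarrow> bool" where
  "smooth_action A M \<Phi> \<longleftrightarrow>
     group_action A (points M) \<Phi> \<and> smooth_map (prod_manifold (man A) M) M (\<lambda>(a, p). \<Phi> a p)"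

definition generator ::
  "('h, 'b::real_normed_vector) lie_structure \<Rightarrow> ('a, 'e::real_normed_vector) manifold
    \<Rightarrow> ('h \<Rightarrow> 'a \<Rightarrow> 'a) \<Rightarrow> 'b \<Rightarrow> 'a \<Rightarrow> 'e" where
  "generator A M \<Phi> \<eta> p = tangent_map (man A) M (\<lambda>a. \<Phi> a p) \<one>\<^bsub>A\<^esub> \<eta>"

text \<open>
  The generator of \<open>\<eta>\<close> is the Hamiltonian vector field of \<open>\<langle>J, \<eta>\<rangle>\<close>, for the sign convention
  \<open>i_X \<omega> = - dE\<close>.
\<close>

definition momentum_map ::
  "('h, 'b::real_normed_vector) lie_structure \<Rightarrow> ('a, 'e::real_normed_vector) manifold
    \<Rightarrow> ('a, 'e) two_form \<Rightarrow> ('h \<Rightarrow> 'a \<Rightarrow> 'a) \<Rightarrow> ('a \<Rightarrow> 'b dual) \<Rightarrow> bool" where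
  "momentum_map A M \<omega> \<Phi> J \<longleftrightarrow>
     smooth_map M vec_manifold J \<and>
     (\<forall>p\<in>points M. \<forall>\<eta> v.
        \<omega> p (generator A M \<Phi> \<eta> p) v =
          - tangent_map M vec_manifold (\<lambda>q. blinfun_apply (J q) \<eta>) p v)"

definition level_set :: "('a, 'e) manifold \<Rightarrow> ('a \<Rightarrow> 'c) \<Rightarrow> 'c \<Rightarrow> 'a set" where
  "level_set M J \<mu> = {p \<in> points M. J p = \<mu>}"

text \<open>
  \<open>(N, \<sigma>)\<close> is the Marsden--Weinstein reduced space at \<open>\<mu>\<close>, where \<open>Z\<close> is the momentum level:
  \<open>N\<close> is the orbit space of \<open>Z\<close>, with the manifold structure making the projection a
  submersion, and \<open>\<sigma>\<close> pulls back to the restriction of \<open>\<omega>\<close>.  As the group is Abelian,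
  equivariance of the momentum map is invariance, and the whole group is the isotropy group
  of \<open>\<mu>\<close>.
\<close>

definition abelian_symplectic_reduction ::
  "('h, 'b::real_normed_vector) lie_structure \<Rightarrow> ('a, 'e::real_normed_vector) manifold
    \<Rightarrow> ('a, 'e) two_form \<Rightarrow> ('h \<Rightarrow> 'a \<Rightarrow> 'a) \<Rightarrow> ('a \<Rightarrow> 'b dual) \<Rightarrow> 'b dual
    \<Rightarrow> ('a, 'z::real_normed_vector) manifold
    \<Rightarrow> ('a set, 'n::real_normed_vector) manifold \<Rightarrow> ('a set, 'n) two_form \<Rightarrow> bool" where
  "abelian_symplectic_reduction A M \<omega> \<Phi> J \<mu> Z N \<sigma> \<longleftrightarrow>
     lie_group A \<and> comm_group A \<and>
     smooth_manifold M \<and> symplectic_form M \<omega> \<and>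
     smooth_action A M \<Phi> \<and>
     (\<forall>a\<in>carrier A. symplectomorphism M \<omega> M \<omega> (\<Phi> a)) \<and>
     momentum_map A M \<omega> \<Phi> J \<and> (\<forall>a\<in>carrier A. \<forall>p\<in>points M. J (\<Phi> a p) = J p) \<and>
     (\<forall>p\<in>level_set M J \<mu>. surj (tangent_map M vec_manifold J p)) \<and>
     embedded_submanifold Z M \<and> points Z = level_set M J \<mu> \<and>
     smooth_manifold N \<and> points N = orbits A (level_set M J \<mu>) \<Phi> \<and>
     submersion Z N (orbit A \<Phi>) \<and>
     symplectic_form N \<sigma> \<and>
     (\<forall>p\<in>points Z. \<forall>v w.
        pullback Z N (orbit A \<Phi>) \<sigma> p v w = pullback Z M (\<lambda>p. p) \<omega> p v w)"


section \<open>The trivialized spaces\<close>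

text \<open>
  With the charts of \<^const>\<open>prod_manifold\<close> and \<^const>\<open>vec_manifold\<close>, tangent vectors of the
  products below are literally tuples of tangent vectors of the factors.
\<close>

definition cotangent_manifold ::
  "('g, 'e::real_normed_vector) lie_structure \<Rightarrow> ('g \<times> 'e dual, 'e \<times> 'e dual) manifold" where
  "cotangent_manifold G = prod_manifold (man G) vec_manifold"

definition cotangent_frame ::
  "('g, 'e::real_normed_vector) lie_structure \<Rightarrow> 'g \<times> 'e dual \<Rightarrow> 'e \<times> 'e dual
    \<Rightarrow> 'e \<times> 'e dual" where
  "cotangent_frame G = (\<lambda>(g, \<mu>) (\<xi>, \<nu>). (right_inv_field G \<xi> g, \<nu> + ad_star G \<xi> \<mu>))"

text \<open>
  At each point the frame is a linear isomorphism, so its inverse expresses an arbitrary pair of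
  tangent vectors through the frame, where the form is prescribed.
\<close>

definition cotangent_form ::
  "('g, 'e::real_normed_vector) lie_structure \<Rightarrow> ('g \<times> 'e dual, 'e \<times> 'e dual) two_form" where
  "cotangent_form G p v w =
     (case p of (g, \<mu>) \<Rightarrow>
      case the_inv_into UNIV (cotangent_frame G p) v of (\<xi>, \<nu>) \<Rightarrow>
      case the_inv_into UNIV (cotangent_frame G p) w of (\<eta>, l) \<Rightarrow>
        blinfun_apply \<nu> \<eta> - blinfun_apply l \<xi> + blinfun_apply \<mu> (lie_bracket G \<xi> \<eta>))"

type_synonym ('g, 'e) tulczyjew = "'g \<times> 'e dual \<times> 'e \<times> 'e dual"

definition tulczyjew_manifold ::
  "('g, 'e::real_normed_vector) lie_structure
    \<Rightarrow> (('g, 'e) tulczyjew, 'e \<times> 'e dual \<times> 'e \<times> 'e dual) manifold" where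
  "tulczyjew_manifold G =
     prod_manifold (man G) (prod_manifold vec_manifold (prod_manifold vec_manifold vec_manifold))"

definition tulczyjew_frame ::
  "('g, 'e::real_normed_vector) lie_structure \<Rightarrow> ('g, 'e) tulczyjew
    \<Rightarrow> 'e \<times> 'e dual \<times> 'e \<times> 'e dual \<Rightarrow> 'e \<times> 'e dual \<times> 'e \<times> 'e dual" where
  "tulczyjew_frame G = (\<lambda>(g, \<mu>, \<xi>, \<nu>) (\<xi>2, \<nu>2, \<xi>3, \<nu>3).
     (right_inv_field G \<xi>2 g,
      \<nu>2 + ad_star G \<xi>2 \<mu>,
      \<xi>3 + lie_bracket G \<xi> \<xi>2,
      \<nu>3 + ad_star G \<xi>2 \<nu> - ad_star G \<xi> \<nu>2))"

definition tulczyjew_form ::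
  "('g, 'e::real_normed_vector) lie_structure
    \<Rightarrow> (('g, 'e) tulczyjew, 'e \<times> 'e dual \<times> 'e \<times> 'e dual) two_form" where
  "tulczyjew_form G p v w =
     (case p of (g, \<mu>, \<xi>, \<nu>) \<Rightarrow>
      case the_inv_into UNIV (tulczyjew_frame G p) v of (\<xi>2, \<nu>2, \<xi>3, \<nu>3) \<Rightarrow>
      case the_inv_into UNIV (tulczyjew_frame G p) w of (\<eta>2, l2, \<eta>3, l3) \<Rightarrow>
        blinfun_apply \<nu>3 \<eta>2 + blinfun_apply \<nu>2 \<eta>3 - blinfun_apply l2 \<xi>3 - blinfun_apply l3 \<xi>2
        + blinfun_apply \<nu> (lie_bracket G \<xi>2 \<eta>2)
        + blinfun_apply \<mu> (lie_bracket G \<xi>3 \<eta>2 + lie_bracket G \<xi>2 \<eta>3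
            + lie_bracket G \<xi> (lie_bracket G \<xi>2 \<eta>2)))"

text \<open>
  The restriction to the points of the manifold (extensionality) is required by the library's
  \<^const>\<open>group_action\<close>.
\<close>

definition shift_action ::
  "('g, 'e::real_normed_vector) lie_structure
    \<Rightarrow> 'e \<Rightarrow> ('g, 'e) tulczyjew \<Rightarrow> ('g, 'e) tulczyjew" where
  "shift_action G \<eta> =
     restrict (\<lambda>(g, \<mu>, \<xi>, \<nu>). (g, \<mu>, \<xi> + \<eta>, \<nu>)) (points (tulczyjew_manifold G))"

definition tulczyjew_momentum ::
  "('g, 'e::real_normed_vector) tulczyjew \<Rightarrow> 'e dual" where
  "tulczyjew_momentum = (\<lambda>(g, \<mu>, \<xi>, \<nu>). \<mu>)"

end

theory Submission
  imports Defs
begin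

text \<open>
  Expressed through the components of the tangent vectors instead of the frame, the terms of
  Tulczyjew's form with two brackets cancel by the Jacobi identity, and what remains is the
  canonical form of \<open>(g, \<nu>)\<close> plus the canonical form of \<open>(\<mu>, \<xi>)\<close>.  Hence translations in \<open>\<xi>\<close> are
  Hamiltonian with momentum \<open>\<mu>\<close>, and fixing \<open>\<mu>\<close> and forgetting \<open>\<xi>\<close> leaves the canonical form of
  \<open>(g, \<nu>)\<close>.  Both forms are exact: with the right Maurer--Cartan form \<open>\<theta>\<close> they are the exterior
  derivatives of \<open>\<nu>(\<theta>)\<close> and \<open>\<nu>(\<theta>) + \<mu>(d\<xi>)\<close>, by the structure equation \<open>d\<theta> = - [\<theta>, \<theta>]\<close>.
\<close>

section \<open>Finite-dimensional normed spaces\<close>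

text \<open>The model space \<open>'e\<close> is an abstract normed space with a finite spanning
  set, and smoothness is tested one direction at a time. The analysis therefore rests on bounded
  coordinate functionals: they reduce a family of linear maps known vector by vector to a finite sum
  of products, which gives the chain rule for \<open>kdiff_on\<close>. The bracket is defined at the
  identity only, from first derivatives of right-invariant fields. Jacobi and the structure equation
  become available once brackets of right-invariant fields are known to be right-invariant in every
  chart (\<open>vbracket_X\<close>), through naturality of brackets under right translation. The
  level set and the orbit space are obtained by transporting product manifolds along explicit
  bijections. Since each tangent space is read in the chart chosen at its point and transport keeps
  the charts, the tangent maps of the reduction come out as coordinate inclusions and projections;
  the subspace topology of the level and the submersion property are then checked against this
  structure.\<close>

definition finite_dim :: "'a::real_vector itself \<Rightarrow> bool" where
  "finite_dim _ \<longleftrightarrow> (\<exists>B::'a set. finite B \<and> span B = UNIV)"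

text \<open>The norm is minimised over the coefficient vectors whose largest entry has absolute
  value 1: this set is compact, and independence makes the norm positive there. Homogeneity carries
  the bound to all coefficients.\<close>

lemma independent_norm_bound:
  fixes B :: "'a::real_normed_vector set"
  assumes "finite B" "independent B"
  obtains m where "m > 0" "\<And>a b. b \<in> B \<Longrightarrow> m * \<bar>a b\<bar> \<le> norm (\<Sum>b\<in>B. a b *\<^sub>R b)"
proof -
  \<comment> \<open>Coefficients off \<open>B\<close> are pinned to 0, so that \<open>K\<close> is a
    product of compact sets over the whole index type and Tychonoff applies.\<close>
  define K :: "('a \<Rightarrow> real) set" where "K = PiE UNIV (\<lambda>i. if i \<in> B then {-1..1} else {0})"
  define S where "S = (\<Union>b\<in>B. K \<inter> {a. \<bar>a b\<bar> = 1})"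
  define f where "f = (\<lambda>a. norm (\<Sum>b\<in>B. a b *\<^sub>R b))"
  have "compactin (product_topology (\<lambda>_. euclidean) UNIV) K"
    unfolding K_def by (subst compactin_PiE) auto
  then have "compact K"
    by (simp add: euclidean_product_topology)
  have coord: "continuous_on A (\<lambda>a :: 'a \<Rightarrow> real. a b)" for A b
    by (rule continuous_on_subset[OF continuous_on_product_coordinates subset_UNIV])
  have "closed {a :: 'a \<Rightarrow> real. \<bar>a b\<bar> = 1}" for b
    by (intro closed_Collect_eq continuous_intros coord)
  then have "compact S"
    unfolding S_def using \<open>compact K\<close> \<open>finite B\<close> by (blast intro: compact_UN compact_Int_closed)
  have cont: "continuous_on S f"
    unfolding f_def by (intro continuous_intros coord)
  have pos: "f a > 0" if "a \<in> S" for a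
  proof -
    obtain b where b: "b \<in> B" "\<bar>a b\<bar> = 1" using \<open>a \<in> S\<close> by (auto simp: S_def)
    have "(\<Sum>b\<in>B. a b *\<^sub>R b) \<noteq> 0"
      using assms b independentD[of B B a b] by auto
    then show ?thesis by (simp add: f_def)
  qed
  obtain m where m: "m > 0" "\<And>a. a \<in> S \<Longrightarrow> m \<le> f a"
  proof (cases "S = {}")
    case True
    then show ?thesis using that[of 1] by auto
  next
    case False
    from continuous_attains_inf[OF \<open>compact S\<close> False cont] pos that show ?thesis by metis
  qed
  show ?thesis
  proof (rule that[OF m(1)])
    fix a :: "'a \<Rightarrow> real" and b assume b: "b \<in> B"
    define M where "M = Max ((\<lambda>b. \<bar>a b\<bar>) ` B)"
    have le: "\<bar>a c\<bar> \<le> M" if "c \<in> B" for c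
      using that \<open>finite B\<close> by (simp add: M_def)
    have "M \<in> (\<lambda>b. \<bar>a b\<bar>) ` B"
      unfolding M_def using b \<open>finite B\<close> by (intro Max_in) auto
    then obtain c where c: "c \<in> B" "M = \<bar>a c\<bar>" by auto
    show "m * \<bar>a b\<bar> \<le> norm (\<Sum>b\<in>B. a b *\<^sub>R b)"
    proof (cases "M = 0")
      case True
      then have "a b = 0" using le[OF b] by simp
      then show ?thesis by simp
    next
      case False
      then have M: "M > 0" using c(2) by simp
      \<comment> \<open>Rescaling by the largest absolute coefficient moves the coefficients onto
        the compact set; the index \<open>c\<close> attains absolute value 1.\<close>
      define a' where "a' = (\<lambda>i. if i \<in> B then a i / M else 0)"
      have "a i / M \<in> {-1..1}" if "i \<in> B" for i
        using le[OF that] M by (auto simp: abs_le_iff field_simps)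
      then have "a' i \<in> (if i \<in> B then {-1..1} else {0})" for i
        by (simp add: a'_def)
      then have "a' \<in> K" by (auto simp: K_def)
      moreover have "\<bar>a' c\<bar> = 1"
        using c False M by (simp add: a'_def)
      ultimately have "a' \<in> S" using c by (auto simp: S_def)
      then have "m \<le> f a'" by (rule m)
      also have "f a' = norm ((1 / M) *\<^sub>R (\<Sum>b\<in>B. a b *\<^sub>R b))"
        unfolding f_def a'_def by (intro arg_cong[where f = norm]) (simp add: scaleR_sum_right)
      also have "\<dots> = norm (\<Sum>b\<in>B. a b *\<^sub>R b) / M"
        using M by simp
      finally have "m * M \<le> norm (\<Sum>b\<in>B. a b *\<^sub>R b)"
        using M by (simp add: field_simps)
      moreover have "m * \<bar>a b\<bar> \<le> m * M" using le[OF b] m(1) by simp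
      ultimately show ?thesis by linarith
    qed
  qed
qed

text \<open>The spanning set is thinned to a basis, and \<open>independent_norm_bound\<close> bounds
  each coordinate functional by \<open>1 / m\<close>. Indices outside the basis give the zero
  functional, so boundedness holds for every \<open>b\<close>.\<close>

lemma finite_dim_coordinates:
  assumes "finite_dim TYPE('a::real_normed_vector)"
  obtains B :: "('a::real_normed_vector) set" and c :: "'a \<Rightarrow> 'a \<Rightarrow> real" where "finite B" "\<And>b.
      bounded_linear (c b)"
    "\<And>v. v = (\<Sum>b\<in>B. c b v *\<^sub>R b)"
proof -
  obtain B0 :: "'a set" where B0: "finite B0" "span B0 = UNIV"
    using assms by (auto simp: finite_dim_def)
  obtain B where B: "B \<subseteq> B0" "independent B" "B0 \<subseteq> span B"
    using maximal_independent_subset[of B0] by metis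
  have fin: "finite B" using B(1) B0(1) by (rule finite_subset)
  have sp: "span B = UNIV" using B B0 by (metis span_mono span_span top.extremum_unique)
  obtain m where m: "m > 0" "\<And>a b. b \<in> B \<Longrightarrow> m * \<bar>a b\<bar> \<le> norm (\<Sum>b\<in>B. a b *\<^sub>R b)"
    using independent_norm_bound[OF fin B(2)] by metis
  have sum: "(\<Sum>b\<in>B. representation B v b *\<^sub>R b) = v" for v
    using sum_representation_eq[OF B(2) _ fin order_refl, of v] sp by simp
  have "bounded_linear (\<lambda>v. representation B v b)" for b
  proof (rule bounded_linear_intro)
    fix v
    have "m * \<bar>representation B v b\<bar> \<le> norm v"
    proof (cases "b \<in> B")
      case True
      then show ?thesis using m(2)[of b "representation B v"] by (simp add: sum)
    next
      case False
      then have "representation B v b = 0" using representation_ne_zero by blast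
      then show ?thesis by simp
    qed
    then show "norm (representation B v b) \<le> norm v * (1 / m)"
      using m(1) by (simp add: field_simps)
  qed (use B(2) sp in \<open>auto simp: representation_add representation_scale\<close>)
  then show ?thesis by (intro that[of B "\<lambda>b v. representation B v b"]) (use fin sum in auto)
qed

lemma finite_dim_linear_bounded:
  fixes f :: "'a::real_normed_vector \<Rightarrow> 'b::real_normed_vector"
  assumes "finite_dim TYPE('a)" "linear f"
  shows "bounded_linear f"
proof -
  obtain B :: "'a set" and c where B: "finite B" "\<And>b. bounded_linear (c b)"
    "\<And>v. v = (\<Sum>b\<in>B. c b v *\<^sub>R b)"
    using finite_dim_coordinates[OF assms(1)] by metis
  have "f = (\<lambda>v. \<Sum>b\<in>B. c b v *\<^sub>R f b)"
  proof
    fix v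
    show "f v = (\<Sum>b\<in>B. c b v *\<^sub>R f b)"
      by (subst B(3)) (simp add: linear_sum[OF assms(2)] linear_scale[OF assms(2)])
  qed
  moreover have "bounded_linear (\<lambda>v. \<Sum>b\<in>B. c b v *\<^sub>R f b)"
    by (intro bounded_linear_sum bounded_linear_compose[OF bounded_linear_scaleR_left] B(2))
  ultimately show ?thesis by simp
qed

text \<open>A vector is a combination of basis vectors whose coefficients are themselves continuous
  functionals. This turns vector identities into real ones and serves for the nondegeneracy of
  pairings with the dual.\<close>

lemma finite_dim_functional_separates:
  fixes v :: "'a::real_normed_vector"
  assumes "finite_dim TYPE('a)" "\<And>l :: 'a \<Rightarrow>\<^sub>L real. blinfun_apply l v = 0"
  shows "v = 0"
proof -
  obtain B :: "'a set" and c where B: "finite B" "\<And>b. bounded_linear (c b)"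
    "\<And>v. v = (\<Sum>b\<in>B. c b v *\<^sub>R b)"
    using finite_dim_coordinates[OF assms(1)] by metis
  have "c b v = 0" for b
    using assms(2)[of "Blinfun (c b)"] B(2) by (simp add: bounded_linear_Blinfun_apply)
  then show ?thesis by (subst B(3)) simp
qed

lemma finite_dim_prod:
  assumes "finite_dim TYPE('a::real_vector)" "finite_dim TYPE('b::real_vector)"
  shows "finite_dim TYPE('a \<times> 'b)"
proof -
  obtain A :: "'a set" and B :: "'b set" where AB: "finite A" "span A = UNIV" "finite B" "span B =
      UNIV"
    using assms by (auto simp: finite_dim_def)
  let ?C = "(\<lambda>a. (a, 0)) ` A \<union> (\<lambda>b. (0, b)) ` B"
  have "(x, y) \<in> span ?C" for x y
  proof -
    have 1: "linear (\<lambda>a::'a. (a, 0::'b))" "linear (\<lambda>b::'b. (0::'a, b))"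
      by (auto intro!: linearI)
    have "(x, 0) \<in> span ((\<lambda>a. (a, 0::'b)) ` A)" "(0, y) \<in> span ((\<lambda>b. (0::'a, b)) ` B)"
      using linear_span_image[OF 1(1), of A] linear_span_image[OF 1(2), of B] AB by auto
    then have "(x, 0) + (0, y) \<in> span ?C"
      by (intro span_add) (meson UnCI in_mono span_mono subsetI)+
    then show ?thesis by simp
  qed
  then have "span ?C = UNIV" by auto
  then show ?thesis using AB unfolding finite_dim_def by (intro exI[of _ ?C]) auto
qed

text \<open>The coordinate functionals of a basis span the dual: the coefficients of
  \<open>l\<close> are its values on the basis.\<close>

lemma finite_dim_dual:
  assumes "finite_dim TYPE('a::real_normed_vector)"
  shows "finite_dim TYPE('a dual)"
proof -
  obtain B :: "'a set" and c where B: "finite B" "\<And>b. bounded_linear (c b)"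
    "\<And>v. v = (\<Sum>b\<in>B. c b v *\<^sub>R b)"
    using finite_dim_coordinates[OF assms(1)] by metis
  have "l \<in> span ((\<lambda>b. Blinfun (c b)) ` B)" for l :: "'a dual"
  proof -
    have "l = (\<Sum>b\<in>B. blinfun_apply l b *\<^sub>R Blinfun (c b))"
    proof (rule blinfun_eqI)
      fix v
      have "blinfun_apply l v = blinfun_apply l (\<Sum>b\<in>B. c b v *\<^sub>R b)" using B(3) by metis
      then show "blinfun_apply l v = blinfun_apply (\<Sum>b\<in>B. blinfun_apply l b *\<^sub>R Blinfun (c b)) v"
        by (simp add: blinfun.sum_right blinfun.scaleR_right blinfun.sum_left blinfun.scaleR_left
            bounded_linear_Blinfun_apply[OF B(2)] mult.commute)
    qed
    moreover have "\<dots> \<in> span ((\<lambda>b. Blinfun (c b)) ` B)"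
      by (intro span_sum span_scale span_base) auto
    ultimately show ?thesis by simp
  qed
  then show ?thesis using B(1) unfolding finite_dim_def
    by (intro exI[of _ "(\<lambda>b. Blinfun (c b)) ` B"]) auto
qed

text \<open>The coordinate map embeds the space linearly and homeomorphically into
  \<open>nat \<Rightarrow> real\<close>, whose product topology has a countable basis.\<close>

lemma finite_dim_second_countable:
  assumes "finite_dim TYPE('a::real_normed_vector)"
  shows "second_countable (euclidean :: 'a topology)"
proof -
  obtain B :: "'a set" and c where B: "finite B" "\<And>b. bounded_linear (c b)"
    "\<And>v. v = (\<Sum>b\<in>B. c b v *\<^sub>R b)"
    using finite_dim_coordinates[OF assms(1)] by metis
  obtain e :: "nat \<Rightarrow> 'a" where e: "bij_betw e {..<card B} B"
    using ex_bij_betw_nat_finite[OF B(1)] by (auto simp: lessThan_atLeast0)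
  define f where "f v = (\<lambda>n. c (e n) v)" for v
  define g where "g a = (\<Sum>n<card B. a n *\<^sub>R e n)" for a :: "nat \<Rightarrow> real"
  have gf: "g (f v) = v" for v
    unfolding f_def g_def using B(3)[of v] sum.reindex_bij_betw[OF e, of "\<lambda>b. c b v *\<^sub>R b"] by simp
  have f: "continuous_on UNIV f"
    unfolding f_def
    by (intro continuous_on_coordinatewise_then_product bounded_linear.continuous_on[OF B(2)]
        continuous_on_id)
  have g: "continuous_on A g" for A
    unfolding g_def
    by (intro continuous_intros continuous_on_subset[OF continuous_on_product_coordinates
        subset_UNIV])
  have "homeomorphic_maps (euclidean :: 'a topology) (top_of_set (range f)) f g"
    unfolding homeomorphic_maps_def using f g gf by (auto simp: continuous_map_in_subtopology)
  then have "(euclidean :: 'a topology) homeomorphic_space (top_of_set (range f))"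
    by (auto simp: homeomorphic_space_def)
  moreover have "second_countable (euclidean :: (nat \<Rightarrow> real) topology)"
  proof -
    obtain \<B> :: "(nat \<Rightarrow> real) set set" where "countable \<B>" "topological_basis \<B>"
      using ex_countable_basis by blast
    then show ?thesis
      unfolding second_countable_def
      by (intro exI[of _ \<B>]) (metis open_openin topological_basisE topological_basis_open)
  qed
  ultimately show ?thesis
    using homeomorphic_space_second_countability second_countable_subtopology by blast
qed

section \<open>Differential calculus\<close>

abbreviation fder :: "('a::real_normed_vector \<Rightarrow> 'b::real_normed_vector) \<Rightarrow> 'a \<Rightarrow> 'a \<Rightarrow> 'b" where
  "fder f x \<equiv> frechet_derivative f (at x)"

lemma fder_eqI: "(f has_derivative f') (at x) \<Longrightarrow> fder f x = f'"
  by (simp add: frechet_derivative_at[symmetric])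

lemma fder_works: "f differentiable (at x) \<Longrightarrow> (f has_derivative fder f x) (at x)"
  by (rule frechet_derivative_works[THEN iffD1])

lemma has_derivative_cong_open:
  assumes "open S" "x \<in> S" "\<And>y. y \<in> S \<Longrightarrow> f y = g y"
  shows "(f has_derivative f') (at x) \<longleftrightarrow> (g has_derivative f') (at x)"
  using has_derivative_transform_within_open[of _ f' x UNIV S] assms by metis

lemma fder_cong:
  assumes "open S" "x \<in> S" "\<And>y. y \<in> S \<Longrightarrow> f y = g y"
  shows "fder f x = fder g x"
  unfolding frechet_derivative_def using has_derivative_cong_open[OF assms] by simp

lemma differentiable_cong_open:
  assumes "open S" "x \<in> S" "\<And>y. y \<in> S \<Longrightarrow> f y = g y"
  shows "f differentiable (at x) \<longleftrightarrow> g differentiable (at x)"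
  unfolding differentiable_def using has_derivative_cong_open[OF assms] by simp

section \<open>Closure properties of k-fold differentiability\<close>

lemma kdiff_on_cong:
  assumes "open S" "\<And>y. y \<in> S \<Longrightarrow> f y = g y" "kdiff_on k f S"
  shows "kdiff_on k g S"
  using assms
proof (induction k arbitrary: f g)
  case 0
  then show ?case by (simp cong: continuous_on_cong)
next
  case (Suc k)
  have "f differentiable at x \<longleftrightarrow> g differentiable at x" if "x \<in> S" for x
    using Suc.prems that by (intro differentiable_cong_open)
  moreover have "kdiff_on k (\<lambda>x. fder g x v) S" for v
  proof (rule Suc.IH)
    show "fder f x v = fder g x v" if "x \<in> S" for x
      using fder_cong[OF Suc.prems(1) that Suc.prems(2)] by simp
  qed (use Suc.prems in auto)
  ultimately show ?case using Suc.prems by simp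
qed

lemma kdiff_on_subset: "kdiff_on k f S \<Longrightarrow> T \<subseteq> S \<Longrightarrow> kdiff_on k f T"
  by (induction k arbitrary: f) (auto intro: continuous_on_subset)

lemma kdiff_on_UN:
  assumes "\<And>i. i \<in> I \<Longrightarrow> open (U i)" "\<And>i. i \<in> I \<Longrightarrow> kdiff_on k f (U i)"
  shows "kdiff_on k f (\<Union>i\<in>I. U i)"
  using assms by (induction k arbitrary: f) (auto intro: continuous_on_open_UN)

lemma kdiff_on_Suc_imp: "kdiff_on (Suc k) f S \<Longrightarrow> kdiff_on k f S"
proof (induction k arbitrary: f)
  case 0
  then show ?case
    by (auto intro!: continuous_at_imp_continuous_on differentiable_imp_continuous_within)
qed auto

lemma kdiff_on_const: "kdiff_on k (\<lambda>_. c) S"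
  by (induction k arbitrary: c) auto

lemma kdiff_on_add:
  assumes S: "open S"
  shows "kdiff_on k f S \<Longrightarrow> kdiff_on k g S \<Longrightarrow> kdiff_on k (\<lambda>x. f x + g x) S"
proof (induction k arbitrary: f g)
  case (Suc k)
  have der: "((\<lambda>x. f x + g x) has_derivative (\<lambda>h. fder f x h + fder g x h)) (at x)"
    if "x \<in> S" for x
    using Suc.prems that by (intro has_derivative_add fder_works) auto
  have "kdiff_on k (\<lambda>x. fder f x v + fder g x v) S" for v
    using Suc.prems by (intro Suc.IH) auto
  then have "kdiff_on k (\<lambda>x. fder (\<lambda>x. f x + g x) x v) S" for v
    by (rule kdiff_on_cong[OF S, rotated]) (simp add: fder_eqI[OF der])
  moreover have "(\<lambda>x. f x + g x) differentiable at x" if "x \<in> S" for x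
    using der[OF that] by (auto simp: differentiable_def)
  ultimately show ?case by simp
qed (auto intro: continuous_intros)

text \<open>The derivative is a sum of two terms of the same bilinear shape, in which one factor is
  differentiated and the other has regularity to spare (\<open>kdiff_on_Suc_imp\<close>).\<close>

lemma kdiff_on_bounded_bilinear:
  assumes B: "bounded_bilinear B" and S: "open S"
  shows "kdiff_on k f S \<Longrightarrow> kdiff_on k g S \<Longrightarrow> kdiff_on k (\<lambda>x. B (f x) (g x)) S"
proof (induction k arbitrary: f g)
  case 0
  then show ?case by (simp add: bounded_bilinear.continuous_on[OF B])
next
  case (Suc k)
  have der: "((\<lambda>x. B (f x) (g x)) has_derivative (\<lambda>h. B (f x) (fder g x h) + B (fder f x h) (g
      x))) (at x)"
    if "x \<in> S" for x
    using Suc.prems that by (intro bounded_bilinear.FDERIV[OF B] fder_works) auto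
  have "kdiff_on k (\<lambda>x. B (f x) (fder g x v) + B (fder f x v) (g x)) S" for v
    using Suc.prems kdiff_on_Suc_imp[OF Suc.prems(1)] kdiff_on_Suc_imp[OF Suc.prems(2)]
    by (intro kdiff_on_add S Suc.IH) auto
  then have "kdiff_on k (\<lambda>x. fder (\<lambda>x. B (f x) (g x)) x v) S" for v
    by (rule kdiff_on_cong[OF S, rotated]) (simp add: fder_eqI[OF der])
  moreover have "(\<lambda>x. B (f x) (g x)) differentiable at x" if "x \<in> S" for x
    using der[OF that] by (auto simp: differentiable_def)
  ultimately show ?case by simp
qed

lemma kdiff_on_bounded_linear:
  assumes L: "bounded_linear L" and S: "open S" and f: "kdiff_on k f S"
  shows "kdiff_on k (\<lambda>x. L (f x)) S"
proof -
  \<comment> \<open>A linear map is viewed as a bilinear one in a scalar and a vector; the scalar is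
    then set to 1.\<close>
  have "bounded_bilinear (\<lambda>(a::real) x. a *\<^sub>R L x)"
    using bounded_bilinear.comp[OF bounded_bilinear_scaleR bounded_linear_ident L] .
  from kdiff_on_bounded_bilinear[OF this S kdiff_on_const[of k 1 S] f] show ?thesis by simp
qed

lemma kdiff_on_id: "kdiff_on k (\<lambda>x. x) S"
  by (cases k) (auto simp: kdiff_on_const)

lemma kdiff_on_Pair:
  assumes S: "open S" and "kdiff_on k f S" "kdiff_on k g S"
  shows "kdiff_on k (\<lambda>x. (f x, g x)) S"
  using assms(2,3)
proof (induction k arbitrary: f g)
  case (Suc k)
  have der: "((\<lambda>x. (f x, g x)) has_derivative (\<lambda>h. (fder f x h, fder g x h))) (at x)"
    if "x \<in> S" for x
    using Suc.prems that by (intro has_derivative_Pair fder_works) auto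
  have "kdiff_on k (\<lambda>x. (fder f x v, fder g x v)) S" for v
    using Suc.prems by (intro Suc.IH) auto
  then have "kdiff_on k (\<lambda>x. fder (\<lambda>x. (f x, g x)) x v) S" for v
    by (rule kdiff_on_cong[OF S, rotated]) (simp add: fder_eqI[OF der])
  moreover have "(\<lambda>x. (f x, g x)) differentiable at x" if "x \<in> S" for x
    using der[OF that] by (auto simp: differentiable_def)
  ultimately show ?case by simp
qed (auto intro: continuous_intros)

lemma kdiff_on_sum:
  assumes "open S" "\<And>i. i \<in> I \<Longrightarrow> kdiff_on k (f i) S"
  shows "kdiff_on k (\<lambda>x. \<Sum>i\<in>I. f i x) S"
  using assms by (induction I rule: infinite_finite_induct) (auto intro: kdiff_on_const
      kdiff_on_add)

text \<open>\<open>L\<close> is known to be k times differentiable only vector by vector. Expanding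
  \<open>w x\<close> in coordinates gives a finite sum of scalar functions times
  \<open>L x b\<close> with \<open>b\<close> constant.\<close>

lemma kdiff_on_linear_family:
  assumes fin: "finite_dim TYPE('b::real_normed_vector)" and S: "open S"
    and lin: "\<And>x. x \<in> S \<Longrightarrow> linear (L x)" and L: "\<And>b :: 'b. kdiff_on k (\<lambda>x. L x b) S"
    and w: "kdiff_on k w S"
  shows "kdiff_on k (\<lambda>x. L x (w x)) S"
proof -
  obtain B :: "'b set" and c where B: "finite B" "\<And>b. bounded_linear (c b)"
    "\<And>v. v = (\<Sum>b\<in>B. c b v *\<^sub>R b)"
    using finite_dim_coordinates[OF fin] by metis
  have "L x (w x) = (\<Sum>b\<in>B. c b (w x) *\<^sub>R L x b)" if "x \<in> S" for x
    by (subst B(3)[of "w x"]) (simp add: linear_sum[OF lin[OF that]] linear_scale[OF lin[OF that]])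
  moreover have "kdiff_on k (\<lambda>x. \<Sum>b\<in>B. c b (w x) *\<^sub>R L x b) S"
    by (intro kdiff_on_sum kdiff_on_bounded_bilinear[OF bounded_bilinear_scaleR]
        kdiff_on_bounded_linear[OF B(2)] L w S)
  ultimately show ?thesis by (elim kdiff_on_cong[OF S, rotated]) auto
qed

text \<open>Product rule for evaluation, by the same expansion: in the first term \<open>w\<close>
  is frozen at \<open>x\<close>, in the second \<open>L\<close> is.\<close>

lemma has_derivative_linear_family:
  assumes fin: "finite_dim TYPE('b::real_normed_vector)" and S: "open S" "x \<in> S"
    and lin: "\<And>y. y \<in> S \<Longrightarrow> linear (L y)" and L: "\<And>b :: 'b. (\<lambda>y. L y b) differentiable (at x)"
    and w: "w differentiable (at x)"
  shows "((\<lambda>y. L y (w y)) has_derivative (\<lambda>u. fder (\<lambda>y. L y (w x)) x u + L x (fder w x u))) (at x)"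
proof -
  obtain B :: "'b set" and c where B: "finite B" "\<And>b. bounded_linear (c b)"
    "\<And>v. v = (\<Sum>b\<in>B. c b v *\<^sub>R b)"
    using finite_dim_coordinates[OF fin] by metis
  have exp: "L y a = (\<Sum>b\<in>B. c b a *\<^sub>R L y b)" if "y \<in> S" for y a
    by (subst B(3)[of a]) (simp add: linear_sum[OF lin[OF that]] linear_scale[OF lin[OF that]])
  have "((\<lambda>y. \<Sum>b\<in>B. c b (w x) *\<^sub>R L y b) has_derivative
      (\<lambda>u. \<Sum>b\<in>B. c b (w x) *\<^sub>R fder (\<lambda>y. L y b) x u)) (at x)"
    by (intro has_derivative_sum has_derivative_scaleR_right fder_works L)
  then have 1: "fder (\<lambda>y. L y (w x)) x = (\<lambda>u. \<Sum>b\<in>B. c b (w x) *\<^sub>R fder (\<lambda>y. L y b) x u)"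
    by (intro fder_eqI) (rule has_derivative_cong_open[OF S exp, THEN iffD2])
  have "((\<lambda>y. \<Sum>b\<in>B. c b (w y) *\<^sub>R L y b) has_derivative
      (\<lambda>u. \<Sum>b\<in>B. c b (w x) *\<^sub>R fder (\<lambda>y. L y b) x u + c b (fder w x u) *\<^sub>R L x b)) (at x)"
    by (intro has_derivative_sum has_derivative_scaleR bounded_linear.has_derivative[OF B(2)]
        fder_works L w)
  then have "((\<lambda>y. \<Sum>b\<in>B. c b (w y) *\<^sub>R L y b) has_derivative
      (\<lambda>u. fder (\<lambda>y. L y (w x)) x u + L x (fder w x u))) (at x)"
    unfolding 1 by (subst exp[OF S(2)]) (simp add: sum.distrib)
  then show ?thesis
    by (subst has_derivative_cong_open[OF S, of "\<lambda>y. L y (w y)"]) (rule exp)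
qed

text \<open>The derivative of the composite is the linear family \<open>fder g (f x)\<close> applied
  to \<open>fder f x v\<close>. The induction hypothesis, used for \<open>fder g\<close> in a fixed
  direction, makes this a family to which \<open>kdiff_on_linear_family\<close> applies.\<close>

lemma kdiff_on_compose:
  assumes fin: "finite_dim TYPE('b::real_normed_vector)" and S: "open S" and T: "open T"
    and g: "kdiff_on k (g :: 'b \<Rightarrow> _) T" and f: "kdiff_on k f S" and ST: "\<And>x. x \<in> S \<Longrightarrow> f x \<in> T"
  shows "kdiff_on k (\<lambda>x. g (f x)) S"
  using g f
proof (induction k arbitrary: g)
  case 0
  then show ?case using ST by (auto intro: continuous_on_compose2)
next
  case (Suc k)
  have der: "((\<lambda>x. g (f x)) has_derivative (\<lambda>h. fder g (f x) (fder f x h))) (at x)" if "x \<in> S" for x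
    using Suc.prems ST that
    by (intro has_derivative_compose[of f "fder f x" x UNIV g "fder g (f x)"] fder_works) auto
  have "kdiff_on k (\<lambda>x. fder g (f x) (fder f x v)) S" for v
  proof (rule kdiff_on_linear_family[OF fin S])
    show "linear (fder g (f x))" if "x \<in> S" for x
      using Suc.prems ST that by (intro linear_frechet_derivative) auto
    show "kdiff_on k (\<lambda>x. fder g (f x) b) S" for b
      using Suc.prems kdiff_on_Suc_imp[OF Suc.prems(2)] by (intro Suc.IH) auto
  qed (use Suc.prems in auto)
  then have "kdiff_on k (\<lambda>x. fder (\<lambda>x. g (f x)) x v) S" for v
    by (rule kdiff_on_cong[OF S, rotated]) (simp add: fder_eqI[OF der])
  moreover have "(\<lambda>x. g (f x)) differentiable at x" if "x \<in> S" for x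
    using der[OF that] by (auto simp: differentiable_def)
  ultimately show ?case by simp
qed

lemma smooth_on_cong:
  assumes "open S" "\<And>y. y \<in> S \<Longrightarrow> f y = g y"
  shows "smooth_on S f \<longleftrightarrow> smooth_on S g"
  unfolding smooth_on_def using kdiff_on_cong[OF assms(1)] assms(2) by metis

lemma smooth_on_subset: "smooth_on S f \<Longrightarrow> T \<subseteq> S \<Longrightarrow> smooth_on T f"
  unfolding smooth_on_def using kdiff_on_subset by blast

lemma smooth_on_local:
  assumes "\<And>x. x \<in> S \<Longrightarrow> \<exists>T. open T \<and> x \<in> T \<and> smooth_on T f"
  shows "smooth_on S f"
proof -
  obtain T where T: "\<And>x. x \<in> S \<Longrightarrow> open (T x) \<and> x \<in> T x \<and> smooth_on (T x) f"
    using assms by metis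
  then have "smooth_on (\<Union>x\<in>S. T x) f"
    unfolding smooth_on_def by (auto intro: kdiff_on_UN)
  then show ?thesis by (rule smooth_on_subset) (use T in auto)
qed

lemma smooth_on_const: "smooth_on S (\<lambda>_. c)"
  by (simp add: smooth_on_def kdiff_on_const)

lemma smooth_on_id: "smooth_on S (\<lambda>x. x)"
  by (simp add: smooth_on_def kdiff_on_id)

lemma smooth_on_bounded_linear:
  "bounded_linear L \<Longrightarrow> open S \<Longrightarrow> smooth_on S f \<Longrightarrow> smooth_on S (\<lambda>x. L (f x))"
  by (simp add: smooth_on_def kdiff_on_bounded_linear)

lemma smooth_on_bounded_bilinear:
  "bounded_bilinear B \<Longrightarrow> open S \<Longrightarrow> smooth_on S f \<Longrightarrow> smooth_on S g \<Longrightarrow> smooth_on S (\<lambda>x. B (f x) (g x))"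
  by (simp add: smooth_on_def kdiff_on_bounded_bilinear)

lemma smooth_on_Pair:
  "open S \<Longrightarrow> smooth_on S f \<Longrightarrow> smooth_on S g \<Longrightarrow> smooth_on S (\<lambda>x. (f x, g x))"
  by (simp add: smooth_on_def kdiff_on_Pair)

lemma smooth_on_add:
  "open S \<Longrightarrow> smooth_on S f \<Longrightarrow> smooth_on S g \<Longrightarrow> smooth_on S (\<lambda>x. f x + g x)"
  by (simp add: smooth_on_def kdiff_on_add)

lemma smooth_on_compose:
  assumes "finite_dim TYPE('b::real_normed_vector)" "open S" "open T"
    "smooth_on T (g :: 'b \<Rightarrow> _)" "smooth_on S f" "\<And>x. x \<in> S \<Longrightarrow> f x \<in> T"
  shows "smooth_on S (\<lambda>x. g (f x))"
  using assms(4,5) unfolding smooth_on_def by (auto intro: kdiff_on_compose[OF assms(1-3) _ _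
      assms(6)])

lemma smooth_on_differentiable: "smooth_on S f \<Longrightarrow> x \<in> S \<Longrightarrow> f differentiable (at x)"
  unfolding smooth_on_def by (drule spec[of _ "Suc 0"]) simp

lemma smooth_on_fder: "smooth_on S f \<Longrightarrow> smooth_on S (\<lambda>x. fder f x v)"
  unfolding smooth_on_def
proof
  fix k
  assume "\<forall>k. kdiff_on k f S"
  from spec[OF this, of "Suc k"] show "kdiff_on k (\<lambda>x. fder f x v) S" by simp
qed

lemma smooth_on_continuous: "smooth_on S f \<Longrightarrow> continuous_on S f"
  unfolding smooth_on_def by (drule spec[of _ 0]) simp

lemma smooth_on_has_derivative: "smooth_on S f \<Longrightarrow> x \<in> S \<Longrightarrow> (f has_derivative fder f x) (at x)"
  by (rule fder_works[OF smooth_on_differentiable])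

lemma smooth_on_linear: "smooth_on S f \<Longrightarrow> x \<in> S \<Longrightarrow> linear (fder f x)"
  by (rule linear_frechet_derivative[OF smooth_on_differentiable])

section \<open>Symmetry of second derivatives and closedness of exact two-forms\<close>

lemma second_difference_mvt:
  fixes f :: "'a::real_normed_vector \<Rightarrow> real"
  assumes f: "smooth_on S f" and r: "r > 0"
    and S: "\<And>s t. s \<in> {0..r} \<Longrightarrow> t \<in> {0..r} \<Longrightarrow> x + s *\<^sub>R u + t *\<^sub>R v \<in> S"
  obtains s t where "s \<in> {0..r}" "t \<in> {0..r}"
    "f (x + r *\<^sub>R u + r *\<^sub>R v) - f (x + r *\<^sub>R u) - f (x + r *\<^sub>R v) + f x =
      r * (r * fder (\<lambda>y. fder f y u) (x + s *\<^sub>R u + t *\<^sub>R v) v)"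
proof -
  have line: "((\<lambda>s. h (a + s *\<^sub>R w)) has_real_derivative fder h (a + s *\<^sub>R w) w) (at s)"
    if "smooth_on S h" "a + s *\<^sub>R w \<in> S" for h :: "'a \<Rightarrow> real" and a w s
  proof -
    note D = smooth_on_has_derivative[OF that]
    have "((\<lambda>s. h (a + s *\<^sub>R w)) has_derivative (\<lambda>k. fder h (a + s *\<^sub>R w) (k *\<^sub>R w))) (at s)"
      by (rule has_derivative_compose[of "\<lambda>s. a + s *\<^sub>R w" "\<lambda>k. k *\<^sub>R w" s UNIV h, OF _ D])
        (auto intro!: derivative_eq_intros)
    then show ?thesis
      by (simp add: has_field_derivative_def linear_scale[OF smooth_on_linear[OF that]]
          mult_commute_abs)
  qed
  \<comment> \<open>The mean value theorem along \<open>u\<close>, applied to the increment of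
    \<open>f\<close> by \<open>r *\<^sub>R v\<close>, leaves an increment along \<open>v\<close> of
    the derivative in direction \<open>u\<close>; a second mean value theorem resolves that
    one.\<close>
  define g where "g s = f ((x + r *\<^sub>R v) + s *\<^sub>R u) - f (x + s *\<^sub>R u)" for s
  have g: "DERIV g s :> fder f ((x + r *\<^sub>R v) + s *\<^sub>R u) u - fder f (x + s *\<^sub>R u) u"
    if "0 \<le> s" "s \<le> r" for s
    unfolding g_def using S[of s r] S[of s 0] that r
    by (intro derivative_intros line f) (auto simp: algebra_simps)
  obtain s where s: "0 < s" "s < r"
    "g r - g 0 = (r - 0) * (fder f ((x + r *\<^sub>R v) + s *\<^sub>R u) u - fder f (x + s *\<^sub>R u) u)"
    using MVT2[OF r g] by blast
  have k: "DERIV (\<lambda>t. fder f ((x + s *\<^sub>R u) + t *\<^sub>R v) u) t :>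
      fder (\<lambda>y. fder f y u) ((x + s *\<^sub>R u) + t *\<^sub>R v) v" if "0 \<le> t" "t \<le> r" for t
    using S[of s t] that s by (intro line smooth_on_fder f) auto
  obtain t where t: "0 < t" "t < r"
    "fder f ((x + s *\<^sub>R u) + r *\<^sub>R v) u - fder f ((x + s *\<^sub>R u) + 0 *\<^sub>R v) u =
      (r - 0) * fder (\<lambda>y. fder f y u) ((x + s *\<^sub>R u) + t *\<^sub>R v) v"
    using MVT2[OF r k] by blast
  show ?thesis
  proof (rule that[of s t])
    have e: "x + r *\<^sub>R v + s *\<^sub>R u = x + s *\<^sub>R u + r *\<^sub>R v" for s by simp
    have "f (x + r *\<^sub>R u + r *\<^sub>R v) - f (x + r *\<^sub>R u) - f (x + r *\<^sub>R v) + f x = g r - g 0"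
      by (simp add: g_def e)
    then show "f (x + r *\<^sub>R u + r *\<^sub>R v) - f (x + r *\<^sub>R u) - f (x + r *\<^sub>R v) + f x =
      r * (r * fder (\<lambda>y. fder f y u) (x + s *\<^sub>R u + t *\<^sub>R v) v)"
      using s(3) t(3) by (simp add: e)
  qed (use s t in auto)
qed

text \<open>Schwarz: the second difference over the parallelogram with sides
  \<open>r *\<^sub>R u\<close> and \<open>r *\<^sub>R v\<close> is symmetric in \<open>u\<close> and
  \<open>v\<close>, and it equals \<open>r * r\<close> times either mixed derivative at some point
  near \<open>x\<close>. Continuity of both derivatives then bounds their difference at
  \<open>x\<close> by any \<open>e\<close>.\<close>

lemma fder_fder_commute_real:
  fixes f :: "'a::real_normed_vector \<Rightarrow> real"
  assumes f: "smooth_on S f" and S: "open S" "x \<in> S"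
  shows "fder (\<lambda>y. fder f y u) x v = fder (\<lambda>y. fder f y v) x u"
proof (rule dense_eq0_I[of "_ - _", THEN eq_iff_diff_eq_0[THEN iffD2]])
  fix e :: real assume "0 < e"
  define H where "H u v y = fder (\<lambda>y. fder f y u) y v" for u v y
  have cont: "continuous (at x) (H u v)" for u v
    unfolding H_def using smooth_on_continuous[OF smooth_on_fder[OF smooth_on_fder[OF f]]] S
    by (simp add: continuous_on_eq_continuous_at)
  have ev: "eventually (\<lambda>y. \<bar>H u v y - H u v x\<bar> < e / 2) (nhds x)" for u v
    using cont[of u v, unfolded continuous_at_eps_delta] \<open>0 < e\<close>
    by (auto simp: eventually_nhds_metric dist_real_def dist_norm dest!: spec[of _ "e / 2"])
  have "eventually (\<lambda>y. y \<in> S \<and> \<bar>H u v y - H u v x\<bar> < e / 2 \<and> \<bar>H v u y - H v u x\<bar> < e / 2) (nhds x)"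
    by (intro eventually_conj ev eventually_nhds_in_open S)
  then obtain d where d: "d > 0"
    "\<And>y. dist y x < d \<Longrightarrow> y \<in> S \<and> \<bar>H u v y - H u v x\<bar> < e / 2 \<and> \<bar>H v u y - H v u x\<bar> < e / 2"
    by (auto simp: eventually_nhds_metric)
  \<comment> \<open>Chosen so that the whole parallelogram lies within distance \<open>d\<close> of
    \<open>x\<close>; the summand 1 keeps the denominator positive.\<close>
  define r where "r = d / (norm u + norm v + 1)"
  have r: "r > 0" using d by (auto simp: r_def intro!: divide_pos_pos add_nonneg_pos)
  have small: "dist (x + s *\<^sub>R u + t *\<^sub>R v) x < d" if "s \<in> {0..r}" "t \<in> {0..r}" for s t
  proof -
    have "norm (s *\<^sub>R u + t *\<^sub>R v) \<le> s * norm u + t * norm v"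
      using norm_triangle_ineq[of "s *\<^sub>R u" "t *\<^sub>R v"] that by simp
    also have "\<dots> \<le> r * norm u + r * norm v" using that by (intro add_mono mult_right_mono) auto
    also have "\<dots> < r * (norm u + norm v + 1)" using r by (simp add: algebra_simps)
    also have "\<dots> = d"
      unfolding r_def by (simp add: add_nonneg_pos less_imp_neq[OF add_nonneg_pos, symmetric])
    finally show ?thesis by (simp add: dist_norm algebra_simps)
  qed
  obtain s t where st: "s \<in> {0..r}" "t \<in> {0..r}"
    "f (x + r *\<^sub>R u + r *\<^sub>R v) - f (x + r *\<^sub>R u) - f (x + r *\<^sub>R v) + f x =
      r * (r * H u v (x + s *\<^sub>R u + t *\<^sub>R v))"
    using second_difference_mvt[OF f r, of x u v] small d(2) unfolding H_def by metis
  have small': "dist (x + s *\<^sub>R v + t *\<^sub>R u) x < d" if "s \<in> {0..r}" "t \<in> {0..r}" for s t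
    using small[OF that(2,1)] by (simp add: add.commute add.left_commute)
  obtain s' t' where st': "s' \<in> {0..r}" "t' \<in> {0..r}"
    "f (x + r *\<^sub>R v + r *\<^sub>R u) - f (x + r *\<^sub>R v) - f (x + r *\<^sub>R u) + f x =
      r * (r * H v u (x + s' *\<^sub>R v + t' *\<^sub>R u))"
    using second_difference_mvt[OF f r, of x v u] small' d(2) unfolding H_def by metis
  have swap: "x + r *\<^sub>R v + r *\<^sub>R u = x + r *\<^sub>R u + r *\<^sub>R v" by simp
  have "r * (r * H u v (x + s *\<^sub>R u + t *\<^sub>R v)) = r * (r * H v u (x + s' *\<^sub>R v + t' *\<^sub>R u))"
    using st(3) st'(3) unfolding swap by linarith
  then have "H u v (x + s *\<^sub>R u + t *\<^sub>R v) = H v u (x + s' *\<^sub>R v + t' *\<^sub>R u)"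
    using r by simp
  moreover have "\<bar>H u v (x + s *\<^sub>R u + t *\<^sub>R v) - H u v x\<bar> < e / 2"
    using d(2)[OF small[OF st(1,2)]] by auto
  moreover have "\<bar>H v u (x + s' *\<^sub>R v + t' *\<^sub>R u) - H v u x\<bar> < e / 2"
    using d(2)[OF small'[OF st'(1,2)]] by auto
  ultimately show "\<bar>fder (\<lambda>y. fder f y u) x v - fder (\<lambda>y. fder f y v) x u\<bar> \<le> e"
    unfolding H_def by linarith
qed

lemma fder_bounded_linear:
  "bounded_linear L \<Longrightarrow> f differentiable (at x) \<Longrightarrow> fder (\<lambda>y. L (f y)) x = (\<lambda>v. L (fder f x v))"
  by (rule fder_eqI[OF bounded_linear.has_derivative[OF _ fder_works]])

text \<open>Tested against all continuous functionals, which commute with derivatives, the claim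
  becomes the real-valued case.\<close>

lemma fder_fder_commute:
  fixes f :: "'a::real_normed_vector \<Rightarrow> 'b::real_normed_vector"
  assumes fin: "finite_dim TYPE('b)" and f: "smooth_on S f" and S: "open S" "x \<in> S"
  shows "fder (\<lambda>y. fder f y u) x v = fder (\<lambda>y. fder f y v) x u"
proof -
  have "blinfun_apply l (fder (\<lambda>y. fder f y u) x v - fder (\<lambda>y. fder f y v) x u) = 0"
    for l :: "'b dual"
  proof -
    have l: "bounded_linear (blinfun_apply l)" by (rule blinfun.bounded_linear_right)
    have D: "blinfun_apply l (fder (\<lambda>y. fder f y u) x v) =
        fder (\<lambda>y. fder (\<lambda>y. blinfun_apply l (f y)) y u) x v" for u v
    proof -
      have "blinfun_apply l (fder (\<lambda>y. fder f y u) x v) = fder (\<lambda>y. blinfun_apply l (fder f y u))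
          x v"
        using fder_bounded_linear[OF l smooth_on_differentiable[OF smooth_on_fder[OF f] S(2)]] by
            simp
      also have "fder (\<lambda>y. blinfun_apply l (fder f y u)) x =
          fder (\<lambda>y. fder (\<lambda>y. blinfun_apply l (f y)) y u) x"
        using fder_bounded_linear[OF l smooth_on_differentiable[OF f]] by (intro fder_cong[OF S])
            simp
      finally show ?thesis .
    qed
    show ?thesis
      unfolding blinfun.diff_right D
      using fder_fder_commute_real[OF smooth_on_bounded_linear[OF l S(1) f] S] by simp
  qed
  from finite_dim_functional_separates[OF fin this] show ?thesis by simp
qed

text \<open>\<open>\<Omega>\<close> is the exterior derivative of the one-form \<open>A\<close>; in
  the cyclic sum its six second derivatives cancel in pairs by symmetry.\<close>

lemma exact_imp_closed:
  fixes A :: "'a::real_normed_vector \<Rightarrow> 'a \<Rightarrow> real"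
  assumes A: "\<And>w. smooth_on S (\<lambda>x. A x w)" and S: "open S" "x \<in> S"
  defines "\<Omega> \<equiv> \<lambda>x v w. fder (\<lambda>x. A x w) x v - fder (\<lambda>x. A x v) x w"
  shows "fder (\<lambda>x. \<Omega> x v w) x u + fder (\<lambda>x. \<Omega> x w u) x v + fder (\<lambda>x. \<Omega> x u v) x w = 0"
proof -
  have "fder (\<lambda>x. \<Omega> x v w) x =
      (\<lambda>u. fder (\<lambda>y. fder (\<lambda>x. A x w) y v) x u - fder (\<lambda>y. fder (\<lambda>x. A x v) y w) x u)" for v w
    unfolding \<Omega>_def
    by (intro fder_eqI has_derivative_diff smooth_on_has_derivative[OF _ S(2)] smooth_on_fder A)
  then show ?thesis
    using fder_fder_commute_real[OF A S, of u v w] fder_fder_commute_real[OF A S, of v u w]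
      fder_fder_commute_real[OF A S] by (simp add: algebra_simps)
qed

section \<open>Smooth maps near a point\<close>

lemma smooth_manifold_finite_dim:
  "smooth_manifold (M :: ('a, 'e::real_normed_vector) manifold) \<Longrightarrow> finite_dim TYPE('e)"
  unfolding smooth_manifold_def finite_dim_def by blast

lemma chart_dom_props:
  assumes "smooth_manifold M" "p \<in> points M"
  shows "p \<in> chart_dom M p" "openin (mtop M) (chart_dom M p)" "chart_dom M p \<subseteq> points M"
    "inj_on (chart M p) (chart_dom M p)" "open (chart_image M p)"
    and homeomorphic_chart: "homeomorphic_map (subtopology (mtop M) (chart_dom M p))
      (top_of_set (chart_image M p)) (chart M p)"
proof -
  show 1: "p \<in> chart_dom M p" "openin (mtop M) (chart_dom M p)" "open (chart_image M p)"
    "homeomorphic_map (subtopology (mtop M) (chart_dom M p))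
      (top_of_set (chart_image M p)) (chart M p)"
    using assms unfolding smooth_manifold_def by blast+
  show sub: "chart_dom M p \<subseteq> points M"
    using 1(2) by (simp add: points_def openin_subset)
  then show "inj_on (chart M p) (chart_dom M p)"
    using homeomorphic_imp_injective_map[OF 1(4)] by (simp add: points_def Int_absorb1)
qed

context
  fixes M :: "('a, 'e::real_normed_vector) manifold" and p
  assumes M: "smooth_manifold M" "p \<in> points M"
begin

lemma chart_inv_chart: "x \<in> chart_dom M p \<Longrightarrow> chart_inv M p (chart M p x) = x"
  unfolding chart_inv_def using chart_dom_props(4)[OF M] by (rule the_inv_into_f_f)

lemma chart_chart_inv: "x \<in> chart_image M p \<Longrightarrow> chart M p (chart_inv M p x) = x"
  unfolding chart_inv_def chart_image_def using chart_dom_props(4)[OF M] by (rule f_the_inv_into_f)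

lemma chart_inv_in: "x \<in> chart_image M p \<Longrightarrow> chart_inv M p x \<in> chart_dom M p"
  unfolding chart_image_def using chart_inv_chart by auto

lemma chart_in_image: "x \<in> chart_dom M p \<Longrightarrow> chart M p x \<in> chart_image M p"
  unfolding chart_image_def by auto

lemma chart_image_openin:
  assumes "U \<subseteq> chart_dom M p"
  shows "open (chart M p ` U) \<longleftrightarrow> openin (mtop M) U"
proof -
  have "openin (top_of_set (chart_image M p)) (chart M p ` U) \<longleftrightarrow>
      openin (subtopology (mtop M) (chart_dom M p)) U"
    using assms chart_dom_props(3)[OF M]
    by (intro homeomorphic_map_openness[OF homeomorphic_chart[OF M]]) (auto simp: points_def)
  moreover have "chart M p ` U \<subseteq> chart_image M p"
    using assms by (auto simp: chart_image_def)
  ultimately show ?thesis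
    using assms chart_dom_props[OF M] by (simp add: openin_open_subtopology)
qed

lemma open_chart_preimage:
  assumes "openin (mtop M) V"
  shows "open {x \<in> chart_image M p. chart_inv M p x \<in> V}"
proof -
  have "{x \<in> chart_image M p. chart_inv M p x \<in> V} = chart M p ` (chart_dom M p \<inter> V)"
    using chart_inv_in chart_chart_inv chart_inv_chart chart_in_image by (force simp: image_iff)
  then show ?thesis
    using assms chart_dom_props(2)[OF M] chart_image_openin[of "chart_dom M p \<inter> V"] by auto
qed

lemma openin_chart_preimage:
  assumes "open W"
  shows "openin (mtop M) {x \<in> chart_dom M p. chart M p x \<in> W}"
proof -
  have "chart M p ` {x \<in> chart_dom M p. chart M p x \<in> W} = chart_image M p \<inter> W"
    by (auto simp: chart_image_def)
  then show ?thesis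
    using assms chart_dom_props(5)[OF M] chart_image_openin[of "{x \<in> chart_dom M p. chart M p x \<in>
        W}"]
    by auto
qed

end

lemma smooth_transition:
  assumes "smooth_manifold M" "p \<in> points M" "q \<in> points M"
  shows "smooth_on {x \<in> chart_image M p. chart_inv M p x \<in> chart_dom M q}
    (\<lambda>x. chart M q (chart_inv M p x))"
proof -
  have "{x \<in> chart_image M p. chart_inv M p x \<in> chart_dom M q} = chart M p ` (chart_dom M p \<inter>
      chart_dom M q)"
    using chart_inv_in[OF assms(1,2)] chart_chart_inv[OF assms(1,2)]
      chart_inv_chart[OF assms(1,2)] chart_in_image[OF assms(1,2)] by (force simp: image_iff)
  then show ?thesis
    using assms unfolding smooth_manifold_def by (simp add: o_def)
qed

text \<open>The charts \<open>p\<close> and \<open>q\<close> are kept apart from the point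
  \<open>y\<close>, so that charts can be changed. Asking for a whole neighbourhood mapped into the
  target chart makes continuity part of the notion.\<close>

definition smooth_in_charts ::
  "('a, 'e::real_normed_vector) manifold \<Rightarrow> ('b, 'f::real_normed_vector) manifold
    \<Rightarrow> ('a \<Rightarrow> 'b) \<Rightarrow> 'a \<Rightarrow> 'b \<Rightarrow> 'a \<Rightarrow> bool" where
  "smooth_in_charts M N f p q y \<longleftrightarrow>
     (\<exists>W. open W \<and> chart M p y \<in> W \<and> W \<subseteq> chart_image M p \<and>
        (\<forall>x\<in>W. f (chart_inv M p x) \<in> chart_dom N q) \<and>
        smooth_on W (\<lambda>x. chart N q (f (chart_inv M p x))))"

text \<open>Uses the charts indexed by \<open>p\<close> and \<open>f p\<close>, the same ones in
  which \<open>tangent_map\<close> reads tangent vectors.\<close>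

definition smooth_near ::
  "('a, 'e::real_normed_vector) manifold \<Rightarrow> ('b, 'f::real_normed_vector) manifold
    \<Rightarrow> ('a \<Rightarrow> 'b) \<Rightarrow> 'a \<Rightarrow> bool" where
  "smooth_near M N f p \<longleftrightarrow> p \<in> points M \<and> f p \<in> points N \<and> smooth_in_charts M N f p (f p) p"

text \<open>In the new charts the map is the old representative between two transition maps, on a
  neighbourhood small enough for all three to compose.\<close>

lemma smooth_in_charts_change:
  assumes M: "smooth_manifold M" and N: "smooth_manifold N"
    and pts: "p \<in> points M" "p' \<in> points M" "q \<in> points N" "q' \<in> points N"
    and y: "y \<in> chart_dom M p" "y \<in> chart_dom M p'" "f y \<in> chart_dom N q'"
    and sm: "smooth_in_charts M N f p q y"
  shows "smooth_in_charts M N f p' q' y"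
proof -
  obtain W where W: "open W" "chart M p y \<in> W" "W \<subseteq> chart_image M p"
    "\<And>x. x \<in> W \<Longrightarrow> f (chart_inv M p x) \<in> chart_dom N q"
    "smooth_on W (\<lambda>x. chart N q (f (chart_inv M p x)))"
    using sm unfolding smooth_in_charts_def by blast
  let ?F = "\<lambda>x. chart N q (f (chart_inv M p x))"
  let ?t = "\<lambda>x. chart M p (chart_inv M p' x)"
  let ?s = "\<lambda>x. chart N q' (chart_inv N q x)"
  define T where "T = {x \<in> chart_image M p'. chart_inv M p' x \<in> chart_dom M p}"
  define S where "S = {x \<in> chart_image N q. chart_inv N q x \<in> chart_dom N q'}"
  have T: "open T" "smooth_on T ?t" and S: "open S" "smooth_on S ?s"
    unfolding T_def S_def using M N pts
    by (auto intro!: open_chart_preimage smooth_transition chart_dom_props)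
  \<comment> \<open>\<open>W1\<close> keeps the points whose image lies in the overlap of the two
    target charts; \<open>W2\<close> pulls this back through the source transition.\<close>
  define W1 where "W1 = W \<inter> ?F -` S"
  have W1: "open W1" unfolding W1_def
    by (rule continuous_open_preimage[OF smooth_on_continuous[OF W(5)] W(1) S(1)])
  define W2 where "W2 = T \<inter> ?t -` W1"
  have W2: "open W2" unfolding W2_def
    by (rule continuous_open_preimage[OF smooth_on_continuous[OF T(2)] T(1) W1])
  note Mp = M pts(1) and Mp' = M pts(2) and Nq = N pts(3) and Nq' = N pts(4)
  have in_q: "f z \<in> chart_dom N q" if "z \<in> chart_dom M p" "chart M p z \<in> W" for z
    using W(4)[OF that(2)] that chart_inv_chart[OF Mp] by simp
  have eq: "?s (?F (?t x)) = chart N q' (f (chart_inv M p' x))" and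
    dom: "f (chart_inv M p' x) \<in> chart_dom N q'" if "x \<in> W2" for x
  proof -
    have x: "chart_inv M p' x \<in> chart_dom M p" "?t x \<in> W" "?F (?t x) \<in> S"
      using that by (auto simp: W2_def T_def W1_def)
    then have *: "chart_inv M p (?t x) = chart_inv M p' x" by (simp add: chart_inv_chart[OF Mp])
    have "chart_inv N q (?F (?t x)) = f (chart_inv M p' x)"
      using in_q[OF x(1,2)] by (simp add: * chart_inv_chart[OF Nq])
    then show "?s (?F (?t x)) = chart N q' (f (chart_inv M p' x))" "f (chart_inv M p' x) \<in>
        chart_dom N q'"
      using x(3) by (auto simp: S_def)
  qed
  have "smooth_on W2 (\<lambda>x. ?F (?t x))"
    by (rule smooth_on_compose[OF smooth_manifold_finite_dim[OF M] W2 W(1) W(5)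
        smooth_on_subset[OF T(2)]]) (auto simp: W2_def W1_def)
  then have "smooth_on W2 (\<lambda>x. ?s (?F (?t x)))"
    by (rule smooth_on_compose[OF smooth_manifold_finite_dim[OF N] W2 S]) (auto simp: W2_def W1_def)
  then have "smooth_on W2 (\<lambda>x. chart N q' (f (chart_inv M p' x)))"
    by (rule smooth_on_cong[OF W2, THEN iffD1, rotated]) (rule eq)
  moreover have "chart M p' y \<in> W2"
    using y W(2) in_q[OF y(1) W(2)] chart_inv_chart[OF Mp] chart_inv_chart[OF Mp']
      chart_in_image[OF Mp'] chart_inv_chart[OF Nq] chart_in_image[OF Nq]
    by (simp add: W2_def T_def W1_def S_def)
  ultimately show ?thesis
    unfolding smooth_in_charts_def using W2 dom
    by (intro exI[of _ W2]) (auto simp: W2_def T_def)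
qed

lemma smooth_nearI:
  assumes "smooth_manifold M" "smooth_manifold N" "p \<in> points M" "q \<in> points N"
    "y \<in> chart_dom M p" "f y \<in> chart_dom N q" "smooth_in_charts M N f p q y"
  shows "smooth_near M N f y"
proof -
  have y: "y \<in> points M" "f y \<in> points N"
    using chart_dom_props(3)[OF assms(1,3)] chart_dom_props(3)[OF assms(2,4)] assms(5,6) by auto
  then show ?thesis
    using smooth_in_charts_change[of M N p y q "f y" y f, OF assms(1-3) y(1) assms(4) y(2) assms(5)
        chart_dom_props(1)[OF assms(1) y(1)] chart_dom_props(1)[OF assms(2) y(2)] assms(7)]
    by (simp add: smooth_near_def)
qed

lemma smooth_near_in_charts:
  assumes "smooth_manifold M" "smooth_manifold N" "p \<in> points M" "q \<in> points N"
    "y \<in> chart_dom M p" "f y \<in> chart_dom N q" "smooth_near M N f y"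
  shows "smooth_in_charts M N f p q y"
proof -
  have y: "y \<in> points M" "f y \<in> points N" "smooth_in_charts M N f y (f y) y"
    using assms(7) by (auto simp: smooth_near_def)
  show ?thesis
    using smooth_in_charts_change[of M N y p "f y" q y f, OF assms(1,2) y(1) assms(3) y(2) assms(4)
        chart_dom_props(1)[OF assms(1) y(1)] assms(5,6) y(3)] .
qed

lemma smooth_near_cong:
  assumes M: "smooth_manifold M" and U: "openin (mtop M) U" "p \<in> U" and eq: "\<And>x. x \<in> U \<Longrightarrow> f x = g x"
    and f: "smooth_near M N f p"
  shows "smooth_near M N g p"
proof -
  have p: "p \<in> points M" using f by (simp add: smooth_near_def)
  obtain W where W: "open W" "chart M p p \<in> W" "W \<subseteq> chart_image M p"
    "\<And>x. x \<in> W \<Longrightarrow> f (chart_inv M p x) \<in> chart_dom N (f p)"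
    "smooth_on W (\<lambda>x. chart N (f p) (f (chart_inv M p x)))"
    using f unfolding smooth_in_charts_def smooth_near_def by blast
  define W1 where "W1 = W \<inter> {x \<in> chart_image M p. chart_inv M p x \<in> U}"
  have W1: "open W1" "chart M p p \<in> W1" "W1 \<subseteq> W" unfolding W1_def
    using W open_chart_preimage[OF M p U(1)] U(2) chart_inv_chart[OF M p] chart_dom_props(1)[OF M p]
    by auto
  have e: "f (chart_inv M p x) = g (chart_inv M p x)" if "x \<in> W1" for x
    using that eq by (auto simp: W1_def)
  have "smooth_on W1 (\<lambda>x. chart N (f p) (g (chart_inv M p x)))"
    by (intro smooth_on_cong[OF W1(1), THEN iffD1, OF _ smooth_on_subset[OF W(5) W1(3)]]) (simp
        add: e)
  then show ?thesis
    using f W W1 e unfolding smooth_near_def smooth_in_charts_def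
    by (intro conjI exI[of _ W1]) (auto simp: eq[OF U(2), symmetric], metis subsetD)
qed

text \<open>Agreement at \<open>p\<close> itself matters as well as nearby: it makes both tangent
  maps use the same target chart.\<close>

lemma tangent_map_cong:
  assumes M: "smooth_manifold M" and U: "openin (mtop M) U" "p \<in> U" and eq: "\<And>x. x \<in> U \<Longrightarrow> f x = g x"
  shows "tangent_map M N f p = tangent_map M N g p"
proof -
  have p: "p \<in> points M" using U by (auto simp: points_def dest: openin_subset)
  show ?thesis
    unfolding tangent_map_def
    by (rule fder_cong[OF open_chart_preimage[OF M p U(1)]])
      (use U eq chart_inv_chart[OF M p] chart_dom_props(1)[OF M p] chart_in_image[OF M p] in auto)
qed

lemma smooth_near_has_derivative:
  assumes "smooth_near M N f p"
  shows "((\<lambda>x. chart N (f p) (f (chart_inv M p x))) has_derivative tangent_map M N f p) (at (chart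
      M p p))"
  using assms smooth_on_has_derivative
  unfolding smooth_near_def smooth_in_charts_def tangent_map_def o_def by blast

lemma tangent_map_linear: "smooth_near M N f p \<Longrightarrow> linear (tangent_map M N f p)"
  by (rule has_derivative_linear[OF smooth_near_has_derivative])

lemma tangent_mapI:
  assumes "((\<lambda>x. chart N (f p) (f (chart_inv M p x))) has_derivative L) (at (chart M p p))"
  shows "tangent_map M N f p = L"
  unfolding tangent_map_def o_def using fder_eqI[OF assms] .

text \<open>The chart that ends \<open>f\<close> and the one that starts \<open>g\<close> are both
  the chart indexed by \<open>f p\<close>, so the chain rule holds without a transition
  factor.\<close>

lemma
  assumes M: "smooth_manifold M" and N: "smooth_manifold N" and P: "smooth_manifold P"
    and f: "smooth_near M N f p" and g: "smooth_near N P g (f p)"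
  shows smooth_near_compose: "smooth_near M P (\<lambda>x. g (f x)) p"
    and tangent_map_compose: "tangent_map M P (\<lambda>x. g (f x)) p =
      (\<lambda>v. tangent_map N P g (f p) (tangent_map M N f p v))"
proof -
  have p: "p \<in> points M" "f p \<in> points N" "g (f p) \<in> points P"
    using f g by (auto simp: smooth_near_def)
  let ?F = "\<lambda>x. chart N (f p) (f (chart_inv M p x))"
  let ?G = "\<lambda>x. chart P (g (f p)) (g (chart_inv N (f p) x))"
  obtain W where W: "open W" "chart M p p \<in> W" "W \<subseteq> chart_image M p"
    "\<And>x. x \<in> W \<Longrightarrow> f (chart_inv M p x) \<in> chart_dom N (f p)" "smooth_on W ?F"
    using f unfolding smooth_in_charts_def smooth_near_def by blast
  obtain V where V: "open V" "chart N (f p) (f p) \<in> V" "V \<subseteq> chart_image N (f p)"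
    "\<And>x. x \<in> V \<Longrightarrow> g (chart_inv N (f p) x) \<in> chart_dom P (g (f p))" "smooth_on V ?G"
    using g unfolding smooth_in_charts_def smooth_near_def by blast
  define W1 where "W1 = W \<inter> ?F -` V"
  have W1: "open W1" unfolding W1_def
    by (rule continuous_open_preimage[OF smooth_on_continuous[OF W(5)] W(1) V(1)])
  have pp: "chart_inv M p (chart M p p) = p"
    using chart_inv_chart[OF M p(1)] chart_dom_props(1)[OF M p(1)] by blast
  have p1: "chart M p p \<in> W1" using W V by (simp add: W1_def pp)
  have inv: "chart_inv N (f p) (?F x) = f (chart_inv M p x)" if "x \<in> W" for x
    using chart_inv_chart[OF N p(2)] W(4) that by blast
  have e: "?G (?F x) = chart P (g (f p)) (g (f (chart_inv M p x)))" if "x \<in> W1" for x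
    using that inv by (simp add: W1_def)
  have "smooth_on W1 (\<lambda>x. ?G (?F x))"
    by (rule smooth_on_compose[OF smooth_manifold_finite_dim[OF N] W1 V(1,5) smooth_on_subset[OF
        W(5)]])
      (auto simp: W1_def)
  then have "smooth_on W1 (\<lambda>x. chart P (g (f p)) (g (f (chart_inv M p x))))"
    by (rule smooth_on_cong[OF W1, THEN iffD1, rotated]) (rule e)
  then show "smooth_near M P (\<lambda>x. g (f x)) p"
    unfolding smooth_near_def smooth_in_charts_def using p p1 W1 W(3) V(4) inv
    by (intro conjI exI[of _ W1]) (auto simp: W1_def, metis)
  have "((\<lambda>x. ?G (?F x)) has_derivative (\<lambda>v. tangent_map N P g (f p) (tangent_map M N f p v)))
      (at (chart M p p))"
    by (rule has_derivative_compose[OF smooth_near_has_derivative[OF f]])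
      (use smooth_near_has_derivative[OF g] in \<open>simp add: pp\<close>)
  then show "tangent_map M P (\<lambda>x. g (f x)) p =
      (\<lambda>v. tangent_map N P g (f p) (tangent_map M N f p v))"
    by (intro tangent_mapI) (simp add: has_derivative_cong_open[OF W1 p1 e])
qed

lemma smooth_near_id:
  assumes M: "smooth_manifold M" and p: "p \<in> points M"
  shows "smooth_near M M (\<lambda>x. x) p" and "tangent_map M M (\<lambda>x. x) p = (\<lambda>v. v)"
proof -
  note q = chart_chart_inv[OF M p] chart_dom_props[OF M p] chart_in_image[OF M p]
  have "smooth_on (chart_image M p) (\<lambda>x. chart M p (chart_inv M p x))"
    by (rule smooth_on_cong[OF q(6), THEN iffD1, rotated, OF smooth_on_id]) (simp add: q(1))
  then show "smooth_near M M (\<lambda>x. x) p"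
    unfolding smooth_near_def smooth_in_charts_def using p q chart_inv_in[OF M p]
    by (intro conjI exI[of _ "chart_image M p"]) auto
  show "tangent_map M M (\<lambda>x. x) p = (\<lambda>v. v)"
    using has_derivative_cong_open[OF q(6), of "chart M p p" "\<lambda>x. chart M p (chart_inv M p x)"
        "\<lambda>x. x"]
    by (intro tangent_mapI) (simp add: q)
qed

lemma smooth_near_const:
  assumes M: "smooth_manifold M" and N: "smooth_manifold N" and p: "p \<in> points M" "q \<in> points N"
  shows "smooth_near M N (\<lambda>_. q) p" "tangent_map M N (\<lambda>_. q) p = (\<lambda>_. 0)"
proof -
  show "smooth_near M N (\<lambda>_. q) p"
    unfolding smooth_near_def smooth_in_charts_def
    using p chart_dom_props[OF M p(1)] chart_dom_props(1)[OF N p(2)] chart_in_image[OF M p(1)]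
    by (intro conjI exI[of _ "chart_image M p"]) (auto intro: smooth_on_const)
  show "tangent_map M N (\<lambda>_. q) p = (\<lambda>_. 0)"
    by (intro tangent_mapI) auto
qed

text \<open>Bridges the global definition, over all pairs of charts, and the pointwise one. In the
  converse direction continuity comes from the neighbourhoods in \<open>smooth_in_charts\<close>,
  and arbitrary charts are reached by \<open>smooth_near_in_charts\<close>.\<close>

lemma smooth_map_iff:
  assumes M: "smooth_manifold M" and N: "smooth_manifold N"
  shows "smooth_map M N f \<longleftrightarrow> (\<forall>p\<in>points M. smooth_near M N f p)"
proof
  assume f: "smooth_map M N f"
  show "\<forall>p\<in>points M. smooth_near M N f p"
  proof
    fix p assume p: "p \<in> points M"
    have cont: "continuous_map (mtop M) (mtop N) f" using f by (simp add: smooth_map_def)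
    then have fp: "f p \<in> points N" using p by (auto simp: points_def continuous_map_def)
    let ?U = "{x \<in> chart_dom M p. f x \<in> chart_dom N (f p)}"
    have "openin (mtop M) {x \<in> topspace (mtop M). f x \<in> chart_dom N (f p)}"
      using cont chart_dom_props(2)[OF N fp] by (rule openin_continuous_map_preimage)
    moreover have "?U = chart_dom M p \<inter> {x \<in> topspace (mtop M). f x \<in> chart_dom N (f p)}"
      using chart_dom_props(3)[OF M p] by (auto simp: points_def)
    ultimately have "open (chart M p ` ?U)"
      using chart_image_openin[OF M p, of ?U] chart_dom_props(2)[OF M p] by auto
    moreover have "smooth_on (chart M p ` ?U) (chart N (f p) \<circ> f \<circ> chart_inv M p)"
      using f p fp by (simp add: smooth_map_def)
    ultimately show "smooth_near M N f p"
      unfolding smooth_near_def smooth_in_charts_def using p fp chart_inv_chart[OF M p]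
      by (intro conjI exI[of _ "chart M p ` ?U"])
        (auto simp: o_def chart_dom_props(1)[OF M p] chart_dom_props(1)[OF N fp] chart_image_def)
  qed
next
  assume *: "\<forall>p\<in>points M. smooth_near M N f p"
  show "smooth_map M N f"
    unfolding smooth_map_def
  proof (intro conjI ballI)
    show "continuous_map (mtop M) (mtop N) f"
      unfolding continuous_map_def
    proof (intro conjI allI impI)
      show "f \<in> topspace (mtop M) \<rightarrow> topspace (mtop N)"
        using * by (auto simp: smooth_near_def points_def)
      fix V assume V: "openin (mtop N) V"
      show "openin (mtop M) {x \<in> topspace (mtop M). f x \<in> V}"
      proof (subst openin_subopen, safe)
        fix p assume p': "p \<in> topspace (mtop M)" "f p \<in> V"
        then have p: "p \<in> points M" "smooth_near M N f p" "f p \<in> points N"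
          using * by (auto simp: points_def smooth_near_def)
        obtain W where W: "open W" "chart M p p \<in> W" "W \<subseteq> chart_image M p"
          "\<And>x. x \<in> W \<Longrightarrow> f (chart_inv M p x) \<in> chart_dom N (f p)"
          "smooth_on W (\<lambda>x. chart N (f p) (f (chart_inv M p x)))" (is "smooth_on W ?F")
          using p(2) unfolding smooth_in_charts_def smooth_near_def by blast
        let ?V = "{x \<in> chart_image N (f p). chart_inv N (f p) x \<in> V}"
        have "open (W \<inter> ?F -` ?V)"
          by (intro continuous_open_preimage[OF smooth_on_continuous[OF W(5)] W(1)]
              open_chart_preimage[OF N p(3)] V)
        then have op: "openin (mtop M) {x \<in> chart_dom M p. chart M p x \<in> W \<inter> ?F -` ?V}" (is
            "openin _ ?T")
          by (rule openin_chart_preimage[OF M p(1)])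
        have "f x \<in> V" if "x \<in> ?T" for x
          using that W(4)[of "chart M p x"] chart_inv_chart[OF M p(1), of x]
            chart_inv_chart[OF N p(3), of "f x"] by auto
        moreover have "p \<in> ?T"
          using W p'(2) chart_dom_props(1)[OF M p(1)] chart_inv_chart[OF M p(1), of p]
            chart_inv_chart[OF N p(3), of "f p"] chart_dom_props(1)[OF N p(3)]
            chart_in_image[OF N p(3), of "f p"] by auto
        ultimately show "\<exists>T. openin (mtop M) T \<and> p \<in> T \<and> T \<subseteq> {x \<in> topspace (mtop M). f x \<in> V}"
          using op chart_dom_props(3)[OF M p(1)] by (intro exI[of _ ?T]) (auto simp: points_def)
      qed
    qed
    fix p q assume p: "p \<in> points M" "q \<in> points N"
    show "smooth_on (chart M p ` {x \<in> chart_dom M p. f x \<in> chart_dom N q}) (chart N q \<circ> f \<circ>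
        chart_inv M p)"
    proof (rule smooth_on_local)
      fix z assume "z \<in> chart M p ` {x \<in> chart_dom M p. f x \<in> chart_dom N q}"
      then obtain x where x: "x \<in> chart_dom M p" "f x \<in> chart_dom N q" "z = chart M p x" by auto
      then have "smooth_near M N f x" using * chart_dom_props(3)[OF M p(1)] by auto
      from smooth_near_in_charts[OF M N p x(1,2) this]
      show "\<exists>T. open T \<and> z \<in> T \<and> smooth_on T (chart N q \<circ> f \<circ> chart_inv M p)"
        unfolding smooth_in_charts_def o_def x(3) by blast
    qed
  qed
qed

section \<open>Vector spaces as manifolds, and charts as smooth maps\<close>

lemma vec_manifold_simps [simp]:
  "mtop vec_manifold = euclidean" "chart_dom vec_manifold p = UNIV" "chart vec_manifold p = (\<lambda>x. x)"
  "points vec_manifold = UNIV" "chart_image vec_manifold p = UNIV" "chart_inv vec_manifold p =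
      (\<lambda>x. x)"
  by (auto simp: vec_manifold_def points_def chart_image_def chart_inv_def the_inv_into_def)

lemma smooth_manifold_vec:
  assumes "finite_dim TYPE('e::real_normed_vector)"
  shows "smooth_manifold (vec_manifold :: ('e, 'e) manifold)"
  using assms[unfolded finite_dim_def] unfolding smooth_manifold_def
  by (auto simp: finite_dim_second_countable[OF assms] o_def smooth_on_id
      Hausdorff_space_euclidean homeomorphic_map_id[unfolded id_def])

lemma tangent_map_vec: "tangent_map vec_manifold vec_manifold f x = fder f x"
  by (simp add: tangent_map_def o_def)

lemma smooth_near_vec:
  "open W \<Longrightarrow> x \<in> W \<Longrightarrow> smooth_on W f \<Longrightarrow> smooth_near vec_manifold vec_manifold f x"
  by (auto simp: smooth_near_def smooth_in_charts_def)

lemma smooth_near_chart: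
  assumes M: "smooth_manifold (M :: ('a, 'e::real_normed_vector) manifold)"
    and p: "p \<in> points M" and y: "y \<in> chart_dom M p"
  shows "smooth_near M vec_manifold (chart M p) y"
proof (rule smooth_nearI[OF M smooth_manifold_vec[OF smooth_manifold_finite_dim[OF M]] p, of 0])
  show "smooth_in_charts M vec_manifold (chart M p) p 0 y"
    unfolding smooth_in_charts_def
    using chart_dom_props(5)[OF M p] chart_in_image[OF M p y] smooth_transition[OF M p p]
        chart_inv_in[OF M p]
    by (intro exI[of _ "chart_image M p"]) (auto cong: conj_cong)
qed (use y in auto)

lemma smooth_near_chart_inv:
  assumes M: "smooth_manifold (M :: ('a, 'e::real_normed_vector) manifold)"
    and p: "p \<in> points M" and x: "x \<in> chart_image M p"
  shows "smooth_near vec_manifold M (chart_inv M p) x"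
proof (rule smooth_nearI[OF smooth_manifold_vec[OF smooth_manifold_finite_dim[OF M]] M _ p, of 0])
  show "smooth_in_charts vec_manifold M (chart_inv M p) 0 p x"
    unfolding smooth_in_charts_def
    using chart_dom_props(5)[OF M p] x smooth_transition[OF M p p] chart_inv_in[OF M p]
    by (intro exI[of _ "chart_image M p"]) (auto cong: conj_cong)
qed (use x chart_inv_in[OF M p] in auto)

section \<open>Products and transport of structure\<close>

lemma second_countable_prod_topology:
  assumes "second_countable X" "second_countable Y"
  shows "second_countable (prod_topology X Y)"
proof -
  obtain A where "countable A \<and> (\<forall>V\<in>A. openin X V) \<and>
      (\<forall>U x. openin X U \<and> x \<in> U \<longrightarrow> (\<exists>V\<in>A. x \<in> V \<and> V \<subseteq> U))"
    using assms(1) unfolding second_countable_def by (rule exE)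
  then have A: "countable A" "\<And>V. V \<in> A \<Longrightarrow> openin X V"
    "\<And>U x. openin X U \<Longrightarrow> x \<in> U \<Longrightarrow> \<exists>V\<in>A. x \<in> V \<and> V \<subseteq> U"
    by simp_all
  obtain B where "countable B \<and> (\<forall>V\<in>B. openin Y V) \<and>
      (\<forall>U x. openin Y U \<and> x \<in> U \<longrightarrow> (\<exists>V\<in>B. x \<in> V \<and> V \<subseteq> U))"
    using assms(2) unfolding second_countable_def by (rule exE)
  then have B: "countable B" "\<And>V. V \<in> B \<Longrightarrow> openin Y V"
    "\<And>U x. openin Y U \<Longrightarrow> x \<in> U \<Longrightarrow> \<exists>V\<in>B. x \<in> V \<and> V \<subseteq> U"
    by simp_all
  let ?C = "(\<lambda>(U, V). U \<times> V) ` (A \<times> B)"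
  show ?thesis
    unfolding second_countable_def
  proof (intro exI[of _ ?C] conjI allI impI ballI)
    show "countable ?C" by (intro countable_image countable_SIGMA A(1) B(1))
    show "openin (prod_topology X Y) V" if "V \<in> ?C" for V
      using that A(2) B(2) by (auto simp: openin_prod_Times_iff)
    fix U p assume *: "openin (prod_topology X Y) U \<and> p \<in> U"
    obtain x y where p: "p = (x, y)" by (cases p)
    obtain U1 U2 where U: "openin X U1" "openin Y U2" "x \<in> U1" "y \<in> U2" "U1 \<times> U2 \<subseteq> U"
      using * unfolding openin_prod_topology_alt p by blast
    obtain V1 V2 where "V1 \<in> A" "x \<in> V1" "V1 \<subseteq> U1" "V2 \<in> B" "y \<in> V2" "V2 \<subseteq> U2"
      using A(3)[OF U(1,3)] B(3)[OF U(2,4)] by blast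
    then show "\<exists>V\<in>?C. p \<in> V \<and> V \<subseteq> U"
      using U(5) p by (intro bexI[of _ "V1 \<times> V2"]) auto
  qed
qed

lemma prod_manifold_simps [simp]:
  "mtop (prod_manifold M N) = prod_topology (mtop M) (mtop N)"
  "chart_dom (prod_manifold M N) p = chart_dom M (fst p) \<times> chart_dom N (snd p)"
  "chart (prod_manifold M N) p x = (chart M (fst p) (fst x), chart N (snd p) (snd x))"
  "points (prod_manifold M N) = points M \<times> points N"
  "chart_image (prod_manifold M N) p = chart_image M (fst p) \<times> chart_image N (snd p)"
  by (force simp: prod_manifold_def points_def chart_image_def)+

text \<open>An equality of records, which merges the three vector factors of Tulczyjew's space into
  a single fibre.\<close>

lemma prod_vec_manifold: "prod_manifold vec_manifold vec_manifold = vec_manifold"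
  by (simp add: prod_manifold_def vec_manifold_def)

lemma chart_inv_prod:
  assumes "smooth_manifold M" "smooth_manifold N" "fst p \<in> points M" "snd p \<in> points N"
    "x \<in> chart_image M (fst p)" "y \<in> chart_image N (snd p)"
  shows "chart_inv (prod_manifold M N) p (x, y) = (chart_inv M (fst p) x, chart_inv N (snd p) y)"
  unfolding chart_inv_def[of "prod_manifold M N"]
proof (rule the_inv_into_f_eq)
  show "inj_on (chart (prod_manifold M N) p) (chart_dom (prod_manifold M N) p)"
    using inj_onD[OF chart_dom_props(4)[OF assms(1,3)]] inj_onD[OF chart_dom_props(4)[OF
        assms(2,4)]]
    by (auto intro!: inj_onI)
qed (use chart_chart_inv[OF assms(1,3,5)] chart_chart_inv[OF assms(2,4,6)]
    chart_inv_in[OF assms(1,3,5)] chart_inv_in[OF assms(2,4,6)] in auto)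

lemma smooth_manifold_prod:
  assumes M: "smooth_manifold (M :: ('a, 'e::real_normed_vector) manifold)"
    and N: "smooth_manifold (N :: ('b, 'f::real_normed_vector) manifold)"
  shows "smooth_manifold (prod_manifold M N)"
proof -
  note fM = smooth_manifold_finite_dim[OF M] and fN = smooth_manifold_finite_dim[OF N]
  have "homeomorphic_map (subtopology (prod_topology (mtop M) (mtop N)) (chart_dom M p \<times> chart_dom
      N q))
      (top_of_set (chart_image M p \<times> chart_image N q)) (\<lambda>x. (chart M p (fst x), chart N q (snd x)))"
    if pq: "p \<in> points M" "q \<in> points N" for p q
  proof -
    obtain g where g: "homeomorphic_maps (subtopology (mtop M) (chart_dom M p))
        (top_of_set (chart_image M p)) (chart M p) g"
      using homeomorphic_chart[OF M pq(1)] homeomorphic_map_maps by metis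
    obtain h where h: "homeomorphic_maps (subtopology (mtop N) (chart_dom N q))
        (top_of_set (chart_image N q)) (chart N q) h"
      using homeomorphic_chart[OF N pq(2)] homeomorphic_map_maps by metis
    have "homeomorphic_maps
       (prod_topology (subtopology (mtop M) (chart_dom M p)) (subtopology (mtop N) (chart_dom N q)))
       (prod_topology (top_of_set (chart_image M p)) (top_of_set (chart_image N q)))
       (\<lambda>(x, y). (chart M p x, chart N q y)) (\<lambda>(x, y). (g x, h y))"
      using g h homeomorphic_maps_prod by blast
    moreover have "(\<lambda>x. (chart M p (fst x), chart N q (snd x))) = (\<lambda>(x, y). (chart M p x, chart N
        q y))"
      by (auto simp: fun_eq_iff)
    ultimately show ?thesis
      unfolding homeomorphic_map_maps by (auto simp: subtopology_Times)
  qed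
  moreover have "smooth_on (chart (prod_manifold M N) p ` (chart_dom (prod_manifold M N) p \<inter>
      chart_dom (prod_manifold M N) q))
      (chart (prod_manifold M N) q \<circ> chart_inv (prod_manifold M N) p)"
    if p: "p \<in> points (prod_manifold M N)" and q: "q \<in> points (prod_manifold M N)" for p q
  proof -
    have pp: "fst p \<in> points M" "snd p \<in> points N" "fst q \<in> points M" "snd q \<in> points N"
      using p q by auto
    define S where "S = {x \<in> chart_image M (fst p). chart_inv M (fst p) x \<in> chart_dom M (fst q)}"
    define T where "T = {x \<in> chart_image N (snd p). chart_inv N (snd p) x \<in> chart_dom N (snd q)}"
    have S: "open S" "smooth_on S (\<lambda>x. chart M (fst q) (chart_inv M (fst p) x))"
      and T: "open T" "smooth_on T (\<lambda>x. chart N (snd q) (chart_inv N (snd p) x))"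
      unfolding S_def T_def using M N pp
      by (auto intro!: open_chart_preimage smooth_transition chart_dom_props)
    have ST: "open (S \<times> T)" using S T by (simp add: open_Times)
    have 1: "smooth_on (S \<times> T) (\<lambda>x. chart M (fst q) (chart_inv M (fst p) (fst x)))"
      by (rule smooth_on_compose[OF fM ST S smooth_on_bounded_linear[OF bounded_linear_fst ST
          smooth_on_id]])
        auto
    have 2: "smooth_on (S \<times> T) (\<lambda>x. chart N (snd q) (chart_inv N (snd p) (snd x)))"
      by (rule smooth_on_compose[OF fN ST T smooth_on_bounded_linear[OF bounded_linear_snd ST
          smooth_on_id]])
        auto
    have "smooth_on (S \<times> T) (chart (prod_manifold M N) q \<circ> chart_inv (prod_manifold M N) p)"
      by (rule smooth_on_cong[OF ST, THEN iffD1, rotated, OF smooth_on_Pair[OF ST 1 2]])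
        (auto simp: S_def T_def chart_inv_prod[OF M N pp(1,2)])
    moreover have "chart (prod_manifold M N) p ` (chart_dom (prod_manifold M N) p \<inter> chart_dom
        (prod_manifold M N) q)
        \<subseteq> S \<times> T"
      using chart_inv_chart[OF M pp(1)] chart_inv_chart[OF N pp(2)]
        chart_in_image[OF M pp(1)] chart_in_image[OF N pp(2)] by (auto simp: S_def T_def)
    ultimately show ?thesis by (rule smooth_on_subset)
  qed
  moreover have "Hausdorff_space (mtop M)" "second_countable (mtop M)"
    "Hausdorff_space (mtop N)" "second_countable (mtop N)"
    using M N by (auto simp: smooth_manifold_def)
  moreover have "\<exists>B::('e \<times> 'f) set. finite B \<and> span B = UNIV"
    using finite_dim_prod[OF fM fN] by (simp add: finite_dim_def)
  ultimately show ?thesis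
    unfolding smooth_manifold_def[of "prod_manifold M N"]
    by (intro conjI ballI) (auto simp: Hausdorff_space_prod_topology second_countable_prod_topology
        prod_manifold_simps(3)[abs_def] openin_prod_Times_iff open_Times chart_dom_props(1,2,5)[OF
            M] chart_dom_props(1,2,5)[OF N])
qed

context
  fixes M :: "('a, 'e::real_normed_vector) manifold" and N :: "('b, 'f::real_normed_vector)
      manifold"
  assumes M: "smooth_manifold M" and N: "smooth_manifold N"
begin

lemma
  assumes p: "p \<in> points (prod_manifold M N)"
  shows smooth_near_fst: "smooth_near (prod_manifold M N) M fst p"
    and tangent_map_fst: "tangent_map (prod_manifold M N) M fst p = fst"
    and smooth_near_snd: "smooth_near (prod_manifold M N) N snd p"
    and tangent_map_snd: "tangent_map (prod_manifold M N) N snd p = snd"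
proof -
  have pp: "fst p \<in> points M" "snd p \<in> points N" using p by auto
  let ?S = "chart_image M (fst p) \<times> chart_image N (snd p)"
  have S: "open ?S" using chart_dom_props[OF M pp(1)] chart_dom_props[OF N pp(2)] by (simp add:
      open_Times)
  have cp: "(chart M (fst p) (fst p), chart N (snd p) (snd p)) \<in> ?S"
    using chart_dom_props(1)[OF M pp(1)] chart_dom_props(1)[OF N pp(2)]
    by (simp add: chart_in_image M N pp)
  have inv: "chart_inv (prod_manifold M N) p x = (chart_inv M (fst p) (fst x), chart_inv N (snd p)
      (snd x))"
    if "x \<in> ?S" for x
    using chart_inv_prod[OF M N pp, of "fst x" "snd x"] that by auto
  have 1: "chart M (fst p) (fst (chart_inv (prod_manifold M N) p x)) = fst x" if "x \<in> ?S" for x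
    using that by (auto simp: inv chart_chart_inv[OF M pp(1)])
  have 2: "chart N (snd p) (snd (chart_inv (prod_manifold M N) p x)) = snd x" if "x \<in> ?S" for x
    using that by (auto simp: inv chart_chart_inv[OF N pp(2)])
  have "smooth_on ?S (\<lambda>x. chart M (fst p) (fst (chart_inv (prod_manifold M N) p x)))"
    by (rule smooth_on_cong[OF S, THEN iffD2, OF 1 smooth_on_bounded_linear[OF bounded_linear_fst
        S smooth_on_id]])
  then show "smooth_near (prod_manifold M N) M fst p"
    unfolding smooth_near_def smooth_in_charts_def using S cp pp chart_inv_in[OF M pp(1)]
    by (intro conjI exI[of _ ?S]) (auto simp: inv mem_Times_iff)
  have "smooth_on ?S (\<lambda>x. chart N (snd p) (snd (chart_inv (prod_manifold M N) p x)))"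
    by (rule smooth_on_cong[OF S, THEN iffD2, OF 2 smooth_on_bounded_linear[OF bounded_linear_snd
        S smooth_on_id]])
  then show "smooth_near (prod_manifold M N) N snd p"
    unfolding smooth_near_def smooth_in_charts_def using S cp pp chart_inv_in[OF N pp(2)]
    by (intro conjI exI[of _ ?S]) (auto simp: inv mem_Times_iff)
  show "tangent_map (prod_manifold M N) M fst p = fst"
    by (rule tangent_mapI, rule has_derivative_cong_open[OF S, THEN iffD2])
      (use cp 1 in \<open>auto intro: bounded_linear_imp_has_derivative bounded_linear_fst\<close>)
  show "tangent_map (prod_manifold M N) N snd p = snd"
    by (rule tangent_mapI, rule has_derivative_cong_open[OF S, THEN iffD2])
      (use cp 2 in \<open>auto intro: bounded_linear_imp_has_derivative bounded_linear_snd\<close>)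
qed

lemma
  assumes P: "smooth_manifold P" and f: "smooth_near P M f p" and g: "smooth_near P N g p"
  shows smooth_near_Pair: "smooth_near P (prod_manifold M N) (\<lambda>x. (f x, g x)) p"
    and tangent_map_Pair: "tangent_map P (prod_manifold M N) (\<lambda>x. (f x, g x)) p =
      (\<lambda>v. (tangent_map P M f p v, tangent_map P N g p v))"
proof -
  have p: "p \<in> points P" "f p \<in> points M" "g p \<in> points N"
    using f g by (auto simp: smooth_near_def)
  obtain W where W: "open W" "chart P p p \<in> W" "W \<subseteq> chart_image P p"
    "\<And>x. x \<in> W \<Longrightarrow> f (chart_inv P p x) \<in> chart_dom M (f p)"
    "smooth_on W (\<lambda>x. chart M (f p) (f (chart_inv P p x)))"
    using f unfolding smooth_in_charts_def smooth_near_def by blast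
  obtain V where V: "open V" "chart P p p \<in> V" "V \<subseteq> chart_image P p"
    "\<And>x. x \<in> V \<Longrightarrow> g (chart_inv P p x) \<in> chart_dom N (g p)"
    "smooth_on V (\<lambda>x. chart N (g p) (g (chart_inv P p x)))"
    using g unfolding smooth_in_charts_def smooth_near_def by blast
  have "smooth_on (W \<inter> V) (\<lambda>x. (chart M (f p) (f (chart_inv P p x)), chart N (g p) (g (chart_inv P
      p x))))"
    by (intro smooth_on_Pair open_Int W V smooth_on_subset[OF W(5)] smooth_on_subset[OF V(5)]) auto
  then show "smooth_near P (prod_manifold M N) (\<lambda>x. (f x, g x)) p"
    unfolding smooth_near_def smooth_in_charts_def using p W V
    by (intro conjI exI[of _ "W \<inter> V"]) auto
  show "tangent_map P (prod_manifold M N) (\<lambda>x. (f x, g x)) p =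
      (\<lambda>v. (tangent_map P M f p v, tangent_map P N g p v))"
    by (rule tangent_mapI) (simp add: has_derivative_Pair[OF smooth_near_has_derivative[OF f]
        smooth_near_has_derivative[OF g]])
qed

end

text \<open>The shift, the insertion of a constant \<mu> and the removal of a coordinate all have
  this form: they act on the vector factor and fix the group element.\<close>

lemma
  assumes M: "smooth_manifold (M :: ('a, 'e::real_normed_vector) manifold)"
    and fV: "finite_dim TYPE('v::real_normed_vector)" and fW: "finite_dim
        TYPE('w::real_normed_vector)"
    and S: "open S" "snd p \<in> S"
    and L: "smooth_on S (L :: 'v \<Rightarrow> 'w)" and p: "fst p \<in> points M"
  shows smooth_near_map_snd:
      "smooth_near (prod_manifold M vec_manifold) (prod_manifold M vec_manifold) (\<lambda>(g, w). (g, L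
          w)) p"
    and tangent_map_map_snd:
      "tangent_map (prod_manifold M vec_manifold) (prod_manifold M vec_manifold) (\<lambda>(g, w). (g, L
          w)) p =
        (\<lambda>(v, w). (v, fder L (snd p) w))"
proof -
  note V = smooth_manifold_vec[OF fV] and W = smooth_manifold_vec[OF fW]
  note P = smooth_manifold_prod[OF M V]
  have p': "p \<in> points (prod_manifold M (vec_manifold :: ('v, 'v) manifold))"
    using p by (cases p) auto
  note Ls = smooth_near_vec[OF S L]
  have eq: "(\<lambda>(g, w). (g, L w)) = (\<lambda>x. (fst x, L (snd x)))" by auto
  show "smooth_near (prod_manifold M vec_manifold) (prod_manifold M vec_manifold) (\<lambda>(g, w). (g, L
      w)) p"
    unfolding eq
    by (intro smooth_near_Pair[OF M W P] smooth_near_fst[OF M V p']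
        smooth_near_compose[OF P V W smooth_near_snd[OF M V p'] Ls])
  show "tangent_map (prod_manifold M vec_manifold) (prod_manifold M vec_manifold) (\<lambda>(g, w). (g, L
      w)) p =
        (\<lambda>(v, w). (v, fder L (snd p) w))"
    unfolding eq
    by (subst tangent_map_Pair[OF M W P smooth_near_fst[OF M V p']
          smooth_near_compose[OF P V W smooth_near_snd[OF M V p'] Ls]])
      (auto simp: tangent_map_fst[OF M V p'] tangent_map_snd[OF M V p'] tangent_map_vec
        tangent_map_compose[OF P V W smooth_near_snd[OF M V p'] Ls])
qed

text \<open>The charts are kept, so the tangent maps of \<open>h\<close> and its inverse \<open>k\<close> are identities.\<close>

definition transport_manifold ::
  "('a \<Rightarrow> 'b) \<Rightarrow> ('b \<Rightarrow> 'a) \<Rightarrow> ('a, 'e) manifold \<Rightarrow> ('b, 'e) manifold" where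
  "transport_manifold h k M =
     \<lparr>mtop = pullback_topology (h ` points M) k (mtop M),
      chart_dom = (\<lambda>n. h ` chart_dom M (k n)),
      chart = (\<lambda>n y. chart M (k n) (k y))\<rparr>"

context
  fixes M :: "('a, 'e::real_normed_vector) manifold" and h :: "'a \<Rightarrow> 'b" and k :: "'b \<Rightarrow> 'a"
  assumes M: "smooth_manifold M" and kh: "\<And>x. x \<in> points M \<Longrightarrow> k (h x) = x"
begin

lemma transport_simps:
  "mtop (transport_manifold h k M) = pullback_topology (h ` points M) k (mtop M)"
  "chart_dom (transport_manifold h k M) n = h ` chart_dom M (k n)"
  "chart (transport_manifold h k M) n y = chart M (k n) (k y)"
  "points (transport_manifold h k M) = h ` points M"
  using kh by (auto simp: transport_manifold_def points_def topspace_pullback_topology)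

lemma transport_chart_image:
  assumes "k n \<in> points M"
  shows "chart_image (transport_manifold h k M) n = chart_image M (k n)"
proof -
  have "k (h x) = x" if "x \<in> chart_dom M (k n)" for x
    using kh chart_dom_props(3)[OF M assms] that by blast
  then show ?thesis
    unfolding chart_image_def by (force simp: transport_simps image_iff)
qed

lemma transport_chart_inv:
  assumes n: "k n \<in> points M" and x: "x \<in> chart_image M (k n)"
  shows "chart_inv (transport_manifold h k M) n x = h (chart_inv M (k n) x)"
  unfolding chart_inv_def[of "transport_manifold h k M"]
proof (rule the_inv_into_f_eq)
  have *: "k (h x) = x" if "x \<in> chart_dom M (k n)" for x
    using kh chart_dom_props(3)[OF M n] that by blast
  show "inj_on (chart (transport_manifold h k M) n) (chart_dom (transport_manifold h k M) n)"
    by (intro inj_onI) (auto simp: transport_simps * dest: inj_onD[OF chart_dom_props(4)[OF M n]])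
  show "chart (transport_manifold h k M) n (h (chart_inv M (k n) x)) = x"
    using * chart_inv_in[OF M n x] chart_chart_inv[OF M n x] by (simp add: transport_simps)
  show "h (chart_inv M (k n) x) \<in> chart_dom (transport_manifold h k M) n"
    using chart_inv_in[OF M n x] by (simp add: transport_simps)
qed

lemma transport_homeomorphic_maps:
  "homeomorphic_maps (mtop M) (mtop (transport_manifold h k M)) h k"
proof -
  have "continuous_map (mtop M) (pullback_topology (h ` points M) k (mtop M)) h"
  proof (rule continuous_map_pullback')
    show "continuous_map (mtop M) (mtop M) (k \<circ> h)"
      using continuous_map_id by (rule continuous_map_eq) (use kh in \<open>auto simp: points_def\<close>)
  qed (auto simp: points_def)
  moreover have "continuous_map (pullback_topology (h ` points M) k (mtop M)) (mtop M) (id \<circ> k)"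
    by (rule continuous_map_pullback[OF continuous_map_id])
  ultimately show ?thesis
    unfolding homeomorphic_maps_def using kh
    by (auto simp: transport_simps topspace_pullback_topology points_def)
qed

text \<open>The charts of the new manifold are the old ones composed with the homeomorphism
  \<open>k\<close>, so the transition maps agree with those of \<open>M\<close>.\<close>

lemma smooth_manifold_transport: "smooth_manifold (transport_manifold h k M)"
proof -
  let ?T = "transport_manifold h k M"
  note hom = transport_homeomorphic_maps
  have hs: "mtop M homeomorphic_space mtop ?T"
    using hom by (auto simp: homeomorphic_space_def)
  have hmap: "homeomorphic_map (mtop M) (mtop ?T) h"
    using hom homeomorphic_map_maps by metis
  have kmap: "homeomorphic_map (mtop ?T) (mtop M) k"
    using hom homeomorphic_map_maps homeomorphic_maps_sym by metis
  have chart: "n \<in> chart_dom ?T n \<and> openin (mtop ?T) (chart_dom ?T n) \<and>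
      open (chart_image ?T n) \<and> homeomorphic_map (subtopology (mtop ?T) (chart_dom ?T n))
          (top_of_set (chart_image ?T n)) (chart ?T n)" if n': "n \<in> points ?T" for n
  proof -
    from n' obtain p where p: "p \<in> points M" "n = h p" by (auto simp: transport_simps)
    have kn: "k n = p" using p kh by simp
    have kD: "k ` h ` chart_dom M p = chart_dom M p"
      using chart_dom_props(3)[OF M p(1)] kh by (force simp: image_iff)
    have op: "openin (mtop ?T) (h ` chart_dom M p)"
      using homeomorphic_map_openness[OF hmap, of "chart_dom M p"] chart_dom_props[OF M p(1)]
      by (auto simp: points_def)
    have "homeomorphic_map (subtopology (mtop ?T) (h ` chart_dom M p)) (subtopology (mtop M)
        (chart_dom M p)) k"
      using homeomorphic_map_subtopologies[OF kmap, of "h ` chart_dom M p" "chart_dom M p"] kD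
        openin_subset[OF op] chart_dom_props(3)[OF M p(1)]
      by (simp add: Int_absorb1 points_def)
    from homeomorphic_map_compose[OF this homeomorphic_chart[OF M p(1)]]
    have "homeomorphic_map (subtopology (mtop ?T) (chart_dom ?T n)) (top_of_set (chart_image ?T
        n)) (chart ?T n)"
      unfolding transport_chart_image[of n, unfolded kn, OF p(1)]
      by (simp add: transport_simps(1,2) kn o_def transport_simps(3)[abs_def])
    then show ?thesis
      using op p chart_dom_props[OF M p(1)] transport_chart_image[of n, unfolded kn, OF p(1)]
      by (simp add: transport_simps kn kh[OF p(1)])
  qed
  have trans: "smooth_on (chart ?T p ` (chart_dom ?T p \<inter> chart_dom ?T q)) (chart ?T q \<circ> chart_inv
      ?T p)"
    if "p \<in> points ?T" "q \<in> points ?T" for p q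
  proof -
    have pq: "k p \<in> points M" "k q \<in> points M" using that kh by (auto simp: transport_simps)
    let ?S = "{x \<in> chart_image M (k p). chart_inv M (k p) x \<in> chart_dom M (k q)}"
    have S: "open ?S" by (intro open_chart_preimage M pq chart_dom_props)
    have 1: "k (h x) = x" if "x \<in> chart_dom M (k p)" for x
      using kh chart_dom_props(3)[OF M pq(1)] that by blast
    have 2: "k (h x) = x" if "x \<in> chart_dom M (k q)" for x
      using kh chart_dom_props(3)[OF M pq(2)] that by blast
    have "smooth_on ?S (chart ?T q \<circ> chart_inv ?T p)"
      by (rule smooth_on_cong[OF S, THEN iffD1, rotated, OF smooth_transition[OF M pq]])
        (simp add: transport_simps transport_chart_inv[OF pq(1)] 2)
    moreover have "chart ?T p ` (chart_dom ?T p \<inter> chart_dom ?T q) \<subseteq> ?S"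
    proof
      fix z assume "z \<in> chart ?T p ` (chart_dom ?T p \<inter> chart_dom ?T q)"
      then obtain a b where ab: "a \<in> chart_dom M (k p)" "b \<in> chart_dom M (k q)" "h a = h b"
        "z = chart M (k p) a" using 1 by (force simp: transport_simps)
      then have "a = b" using 1 2 by metis
      with ab show "z \<in> ?S" using chart_inv_chart[OF M pq(1)] chart_in_image[OF M pq(1)] by auto
    qed
    ultimately show ?thesis by (rule smooth_on_subset)
  qed
  have "\<exists>B::'e set. finite B \<and> span B = UNIV" "Hausdorff_space (mtop M)" "second_countable (mtop M)"
    using M by (auto simp: smooth_manifold_def)
  then show ?thesis
    unfolding smooth_manifold_def[of ?T]
    using chart trans homeomorphic_Hausdorff_space[OF hs]
        homeomorphic_space_second_countability[OF hs]
    by blast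
qed

lemma
  assumes p: "p \<in> points M"
  shows smooth_near_transport: "smooth_near M (transport_manifold h k M) h p"
    and tangent_map_transport: "tangent_map M (transport_manifold h k M) h p = (\<lambda>v. v)"
    and smooth_near_transport_inv: "smooth_near (transport_manifold h k M) M k (h p)"
    and tangent_map_transport_inv: "tangent_map (transport_manifold h k M) M k (h p) = (\<lambda>v. v)"
proof -
  let ?T = "transport_manifold h k M" and ?S = "chart_image M p"
  note S = chart_dom_props(5)[OF M p]
  have *: "k (h x) = x" if "x \<in> chart_dom M p" for x
    using kh chart_dom_props(3)[OF M p] that by blast
  have khp: "k (h p) = p" using kh p by simp
  have cp: "chart M p p \<in> ?S" using chart_dom_props(1)[OF M p] chart_in_image[OF M p] by blast
  have 1: "chart ?T (h p) (h (chart_inv M p x)) = x" if "x \<in> ?S" for x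
    using that by (simp add: transport_simps khp * chart_inv_in[OF M p] chart_chart_inv[OF M p])
  have 2: "chart M (k (h p)) (k (chart_inv ?T (h p) x)) = x" if "x \<in> ?S" for x
    using that transport_chart_inv[of "h p" x]
    by (simp add: khp p * chart_inv_in[OF M p] chart_chart_inv[OF M p])
  have "smooth_on ?S (\<lambda>x. chart ?T (h p) (h (chart_inv M p x)))"
    by (rule smooth_on_cong[OF S, THEN iffD2, OF 1 smooth_on_id])
  then show "smooth_near M ?T h p"
    unfolding smooth_near_def smooth_in_charts_def using S cp p chart_inv_in[OF M p]
    by (intro conjI exI[of _ ?S]) (auto simp: transport_simps khp)
  show "tangent_map M ?T h p = (\<lambda>v. v)"
    by (rule tangent_mapI, rule has_derivative_cong_open[OF S, THEN iffD2, OF cp 1]) auto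
  have "smooth_on ?S (\<lambda>x. chart M (k (h p)) (k (chart_inv ?T (h p) x)))"
    by (rule smooth_on_cong[OF S, THEN iffD2, OF 2 smooth_on_id])
  then show "smooth_near ?T M k (h p)"
    unfolding smooth_near_def smooth_in_charts_def using S cp p chart_inv_in[OF M p]
      transport_chart_image[of "h p"] transport_chart_inv[of "h p"]
    by (intro conjI exI[of _ ?S]) (auto simp: transport_simps khp *)
  have "((\<lambda>x. chart M (k (h p)) (k (chart_inv ?T (h p) x))) has_derivative (\<lambda>v. v)) (at (chart M p
      p))"
    by (rule has_derivative_cong_open[OF S, THEN iffD2, OF cp 2]) auto
  then show "tangent_map ?T M k (h p) = (\<lambda>v. v)"
    by (intro tangent_mapI) (simp add: transport_simps khp)
qed

end

lemma diffeomorphismI: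
  assumes M: "smooth_manifold M" and N: "smooth_manifold N"
    and f: "\<And>p. p \<in> points M \<Longrightarrow> smooth_near M N f p"
    and g: "\<And>q. q \<in> points N \<Longrightarrow> smooth_near N M g q"
    and gf: "\<And>p. p \<in> points M \<Longrightarrow> g (f p) = p" and fg: "\<And>q. q \<in> points N \<Longrightarrow> f (g q) = q"
  shows "diffeomorphism M N f"
proof -
  have bij: "bij_betw f (points M) (points N)"
    using f g gf fg by (intro bij_betw_byWitness[of _ g]) (auto simp: smooth_near_def)
  have inv: "the_inv_into (points M) f q = g q" if "q \<in> points N" for q
    using bij fg that g by (intro the_inv_into_f_eq) (auto simp: bij_betw_def smooth_near_def)
  have op: "openin (mtop N) (points N)" by (simp add: points_def)
  have "smooth_near N M (the_inv_into (points M) f) q" if "q \<in> points N" for q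
    by (rule smooth_near_cong[OF N op that _ g[OF that]]) (simp add: inv)
  then show ?thesis
    unfolding diffeomorphism_def using bij f smooth_map_iff[OF M N] smooth_map_iff[OF N M] by blast
qed

section \<open>Right-invariant fields and the Maurer--Cartan form\<close>

definition vbracket :: "('a::real_normed_vector \<Rightarrow> 'a) \<Rightarrow> ('a \<Rightarrow> 'a) \<Rightarrow> 'a \<Rightarrow> 'a" where
  "vbracket X Y x = fder Y x (X x) - fder X x (Y x)"

lemma fder_fder_apply:
  fixes \<phi> :: "'a::real_normed_vector \<Rightarrow> 'b::real_normed_vector"
  assumes fin: "finite_dim TYPE('a)" and W: "open W" "x \<in> W" and \<phi>: "smooth_on W \<phi>"
    and Y: "Y differentiable (at x)"
  shows "((\<lambda>z. fder \<phi> z (Y z)) has_derivative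
    (\<lambda>u. fder (\<lambda>z. fder \<phi> z (Y x)) x u + fder \<phi> x (fder Y x u))) (at x)"
  by (rule has_derivative_linear_family[OF fin W smooth_on_linear[OF \<phi>]
        smooth_on_differentiable[OF smooth_on_fder[OF \<phi>] W(2)] Y])

text \<open>Differentiating the relation produces a second derivative of \<phi> in each of the two
  bracket terms; these agree by symmetry and cancel in the difference.\<close>

lemma vbracket_related:
  fixes \<phi> :: "'a::real_normed_vector \<Rightarrow> 'a"
  assumes fin: "finite_dim TYPE('a)" and W: "open W" "x \<in> W" and \<phi>: "smooth_on W \<phi>"
    and diff: "X differentiable (at x)" "Y differentiable (at x)"
      "X' differentiable (at (\<phi> x))" "Y' differentiable (at (\<phi> x))"
    and rel: "\<And>z. z \<in> W \<Longrightarrow> fder \<phi> z (X z) = X' (\<phi> z)" "\<And>z. z \<in> W \<Longrightarrow> fder \<phi> z (Y z) = Y' (\<phi> z)"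
  shows "fder \<phi> x (vbracket X Y x) = vbracket X' Y' (\<phi> x)"
proof -
  have *: "fder Y' (\<phi> x) (fder \<phi> x u) = fder (\<lambda>z. fder \<phi> z (Y x)) x u + fder \<phi> x (fder Y x u)"
    if Y: "Y differentiable (at x)" and Y': "Y' differentiable (at (\<phi> x))"
      and e: "\<And>z. z \<in> W \<Longrightarrow> fder \<phi> z (Y z) = Y' (\<phi> z)" for Y Y' u
  proof -
    have 1: "((\<lambda>z. Y' (\<phi> z)) has_derivative
        (\<lambda>u. fder (\<lambda>z. fder \<phi> z (Y x)) x u + fder \<phi> x (fder Y x u))) (at x)"
      using fder_fder_apply[OF fin W \<phi> Y]
      by (rule has_derivative_cong_open[OF W, THEN iffD1, rotated]) (rule e)
    have 2: "((\<lambda>z. Y' (\<phi> z)) has_derivative (\<lambda>u. fder Y' (\<phi> x) (fder \<phi> x u))) (at x)"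
      by (rule has_derivative_compose[OF smooth_on_has_derivative[OF \<phi> W(2)] fder_works[OF Y']])
    show ?thesis using has_derivative_unique[OF 1 2] by (simp add: fun_eq_iff)
  qed
  have "vbracket X' Y' (\<phi> x) = fder \<phi> x (fder Y x (X x)) - fder \<phi> x (fder X x (Y x))"
    unfolding vbracket_def
    using *[OF diff(2,4) rel(2), of "X x"] *[OF diff(1,3) rel(1), of "Y x"]
      rel[OF W(2)] fder_fder_commute[OF fin \<phi> W, of "Y x" "X x"] by simp
  then show ?thesis
    by (simp add: vbracket_def linear_diff[OF smooth_on_linear[OF \<phi> W(2)]])
qed

lemma has_derivative_vbracket:
  fixes X Y :: "'a::real_normed_vector \<Rightarrow> 'a"
  assumes fin: "finite_dim TYPE('a)" and W: "open W" "x \<in> W" and X: "smooth_on W X" and Y: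
      "smooth_on W Y"
  shows "((\<lambda>y. vbracket X Y y) has_derivative
    (\<lambda>u. (fder (\<lambda>z. fder Y z (X x)) x u + fder Y x (fder X x u)) -
         (fder (\<lambda>z. fder X z (Y x)) x u + fder X x (fder Y x u)))) (at x)"
  unfolding vbracket_def
  by (intro has_derivative_diff fder_fder_apply[OF fin W] X Y smooth_on_differentiable[OF _ W(2)])

text \<open>The double brackets expand into first and second derivatives of the fields: the
  second-order terms cancel by symmetry, the others in pairs by linearity.\<close>

lemma vbracket_jacobi:
  fixes X Y Z :: "'a::real_normed_vector \<Rightarrow> 'a"
  assumes fin: "finite_dim TYPE('a)" and W: "open W" "x \<in> W"
    and sm: "smooth_on W X" "smooth_on W Y" "smooth_on W Z"
  shows "vbracket X (vbracket Y Z) x + vbracket Y (vbracket Z X) x + vbracket Z (vbracket X Y) x =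
      0"
proof -
  note D = has_derivative_vbracket[OF fin W, THEN fder_eqI]
  note C = fder_fder_commute[OF fin _ W]
  have lin: "linear (fder X x)" "linear (fder Y x)" "linear (fder Z x)"
    using smooth_on_linear[OF _ W(2)] sm by auto
  show ?thesis
    using C[OF sm(1), of "Y x" "Z x"] C[OF sm(2), of "X x" "Z x"] C[OF sm(3), of "X x" "Y x"]
    unfolding vbracket_def[of _ "vbracket _ _"] D[OF sm(2,3)] D[OF sm(3,1)] D[OF sm(1,2)]
    unfolding vbracket_def by (simp add: linear_diff lin algebra_simps)
qed

text \<open>Turns joint smoothness of \<open>F\<close> into smoothness of a partial derivative in
  the parameter, since the partial derivative is the derivative of \<open>F\<close> along
  \<open>(v, 0)\<close>. The point of differentiation may itself depend on the parameter, through
  \<alpha>.\<close>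

lemma
  fixes F :: "'a::real_normed_vector \<times> 'b::real_normed_vector \<Rightarrow> 'c::real_normed_vector"
  assumes fin: "finite_dim TYPE('a)" "finite_dim TYPE('b)" and W: "open W" and F: "smooth_on W F"
  shows fder_partial: "(a, x) \<in> W \<Longrightarrow> fder (\<lambda>z. F (z, x)) a v = fder F (a, x) (v, 0)"
    and smooth_on_partial: "open S \<Longrightarrow> smooth_on S \<alpha> \<Longrightarrow> (\<And>x. x \<in> S \<Longrightarrow> (\<alpha> x, x) \<in> W) \<Longrightarrow>
      smooth_on S (\<lambda>x. fder (\<lambda>z. F (z, x)) (\<alpha> x) v)"
proof -
  show 1: "fder (\<lambda>z. F (z, x)) a v = fder F (a, x) (v, 0)" if "(a, x) \<in> W" for a x v
  proof -
    have "((\<lambda>z. F (z, x)) has_derivative (\<lambda>v. fder F (a, x) (v, 0))) (at a)"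
      by (rule has_derivative_compose[of "\<lambda>z. (z, x)" "\<lambda>v. (v, 0)" a UNIV F, OF _
          smooth_on_has_derivative[OF F that]])
        (auto intro!: derivative_eq_intros)
    from fder_eqI[OF this] show ?thesis by simp
  qed
  assume S: "open S" and \<alpha>: "smooth_on S \<alpha>" and in_W: "\<And>x. x \<in> S \<Longrightarrow> (\<alpha> x, x) \<in> W"
  have "smooth_on S (\<lambda>x. fder F (\<alpha> x, x) (v, 0))"
    by (rule smooth_on_compose[OF finite_dim_prod[OF fin] S W smooth_on_fder[OF F]
          smooth_on_Pair[OF S \<alpha> smooth_on_id]]) (rule in_W)
  then show "smooth_on S (\<lambda>x. fder (\<lambda>z. F (z, x)) (\<alpha> x) v)"
    by (rule smooth_on_cong[OF S, THEN iffD1, rotated]) (simp add: 1 in_W)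
qed

lemma linear_fder_family:
  assumes S: "open S" "x \<in> S" and lin: "\<And>y. y \<in> S \<Longrightarrow> linear (L y)"
    and L: "\<And>b. (\<lambda>y. L y b) differentiable (at x)"
  shows "linear (\<lambda>b. fder (\<lambda>y. L y b) x u)"
proof (rule linearI)
  fix a b
  have "((\<lambda>y. L y (a + b)) has_derivative (\<lambda>u. fder (\<lambda>y. L y a) x u + fder (\<lambda>y. L y b) x u)) (at x)"
    by (rule has_derivative_cong_open[OF S, THEN iffD1, rotated,
          OF has_derivative_add[OF fder_works[OF L] fder_works[OF L]]]) (simp add: linear_add[OF
              lin])
  from fder_eqI[OF this]
  show "fder (\<lambda>y. L y (a + b)) x u = fder (\<lambda>y. L y a) x u + fder (\<lambda>y. L y b) x u" by simp
next
  fix c b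
  have "((\<lambda>y. L y (c *\<^sub>R b)) has_derivative (\<lambda>u. c *\<^sub>R fder (\<lambda>y. L y b) x u)) (at x)"
    by (rule has_derivative_cong_open[OF S, THEN iffD1, rotated,
          OF has_derivative_scaleR_right[OF fder_works[OF L]]]) (simp add: linear_scale[OF lin])
  from fder_eqI[OF this]
  show "fder (\<lambda>y. L y (c *\<^sub>R b)) x u = c *\<^sub>R fder (\<lambda>y. L y b) x u" by simp
qed

lemma tangent_chart_inv_chart:
  assumes M: "smooth_manifold (M :: ('a, 'e::real_normed_vector) manifold)" and p: "p \<in> points M"
    and x: "x \<in> chart_image M p"
  shows "tangent_map vec_manifold M (chart_inv M p) x
      (tangent_map M vec_manifold (chart M p) (chart_inv M p x) v) = v"
    and "tangent_map M vec_manifold (chart M p) (chart_inv M p x)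
      (tangent_map vec_manifold M (chart_inv M p) x v) = v"
proof -
  note V = smooth_manifold_vec[OF smooth_manifold_finite_dim[OF M]]
  note y = chart_inv_in[OF M p x] and cx = chart_chart_inv[OF M p x]
  note y' = subsetD[OF chart_dom_props(3)[OF M p] y]
  note c = smooth_near_chart[OF M p y] and i = smooth_near_chart_inv[OF M p x]
  have "tangent_map M M (\<lambda>z. chart_inv M p (chart M p z)) (chart_inv M p x) =
      tangent_map M M (\<lambda>z. z) (chart_inv M p x)"
    by (rule tangent_map_cong[OF M chart_dom_props(2)[OF M p] y chart_inv_chart[OF M p]])
  then show "tangent_map vec_manifold M (chart_inv M p) x
      (tangent_map M vec_manifold (chart M p) (chart_inv M p x) v) = v"
    using tangent_map_compose[OF M V M c, unfolded cx, OF i] smooth_near_id(2)[OF M y']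
    by (simp add: fun_eq_iff)
  have "tangent_map vec_manifold vec_manifold (\<lambda>z. chart M p (chart_inv M p z)) x =
      tangent_map vec_manifold vec_manifold (\<lambda>z. z) x"
    by (rule tangent_map_cong[OF V _ x chart_chart_inv[OF M p]]) (simp add: chart_dom_props(5)[OF
        M p])
  then show "tangent_map M vec_manifold (chart M p) (chart_inv M p x)
      (tangent_map vec_manifold M (chart_inv M p) x v) = v"
    using tangent_map_compose[OF V M V i c] smooth_near_id(2)[OF V, of x]
    by (simp add: fun_eq_iff)
qed

section \<open>Right translations, right-invariant fields and the Maurer--Cartan form in
  charts\<close>

locale lie =
  fixes G :: "('g, 'e::real_normed_vector) lie_structure"
  assumes lie_group: "lie_group G"
begin

abbreviation "M \<equiv> man G"
abbreviation "R \<equiv> right_inv_field G"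

text \<open>
  \<open>mc\<close> is the right-invariant Maurer--Cartan form; below, \<open>X p \<xi>\<close> and \<open>\<theta> p\<close> are the right-invariant
  fields and \<open>mc\<close> in the coordinates of the chart at \<open>p\<close>.
\<close>

definition mc :: "'g \<Rightarrow> 'e \<Rightarrow> 'e" where
  "mc g = tangent_map M M (\<lambda>h. h \<otimes>\<^bsub>G\<^esub> inv\<^bsub>G\<^esub> g) g"

lemma grp: "group G" and M: "smooth_manifold M" and carrier: "carrier G = points M"
  using lie_group by (auto simp: lie_group_def)

lemma fin: "finite_dim TYPE('e)"
  by (rule smooth_manifold_finite_dim[OF M])

lemmas V = smooth_manifold_vec[OF fin]

lemma group_points [simp]:
  "\<one>\<^bsub>G\<^esub> \<in> points M" "g \<in> points M \<Longrightarrow> inv\<^bsub>G\<^esub> g \<in> points M"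
  "g \<in> points M \<Longrightarrow> h \<in> points M \<Longrightarrow> g \<otimes>\<^bsub>G\<^esub> h \<in> points M"
  "g \<in> points M \<Longrightarrow> \<one>\<^bsub>G\<^esub> \<otimes>\<^bsub>G\<^esub> g = g" "g \<in> points M \<Longrightarrow> g \<otimes>\<^bsub>G\<^esub> \<one>\<^bsub>G\<^esub> = g"
  "g \<in> points M \<Longrightarrow> g \<otimes>\<^bsub>G\<^esub> inv\<^bsub>G\<^esub> g = \<one>\<^bsub>G\<^esub>" "g \<in> points M \<Longrightarrow> inv\<^bsub>G\<^esub> g \<otimes>\<^bsub>G\<^esub> g = \<one>\<^bsub>G\<^esub>"
  and group_assoc:
  "g \<in> points M \<Longrightarrow> h \<in> points M \<Longrightarrow> k \<in> points M \<Longrightarrow> g \<otimes>\<^bsub>G\<^esub> h \<otimes>\<^bsub>G\<^esub> k = g \<otimes>\<^bsub>G\<^esub> (h \<otimes>\<^bsub>G\<^esub> k)"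
proof -
  interpret group G by (rule grp)
  show "\<one>\<^bsub>G\<^esub> \<in> points M" "g \<in> points M \<Longrightarrow> inv\<^bsub>G\<^esub> g \<in> points M"
    "g \<in> points M \<Longrightarrow> h \<in> points M \<Longrightarrow> g \<otimes>\<^bsub>G\<^esub> h \<in> points M"
    "g \<in> points M \<Longrightarrow> \<one>\<^bsub>G\<^esub> \<otimes>\<^bsub>G\<^esub> g = g" "g \<in> points M \<Longrightarrow> g \<otimes>\<^bsub>G\<^esub> \<one>\<^bsub>G\<^esub> = g"
    "g \<in> points M \<Longrightarrow> g \<otimes>\<^bsub>G\<^esub> inv\<^bsub>G\<^esub> g = \<one>\<^bsub>G\<^esub>" "g \<in> points M \<Longrightarrow> inv\<^bsub>G\<^esub> g \<otimes>\<^bsub>G\<^esub> g = \<one>\<^bsub>G\<^esub>"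
    "g \<in> points M \<Longrightarrow> h \<in> points M \<Longrightarrow> k \<in> points M \<Longrightarrow> g \<otimes>\<^bsub>G\<^esub> h \<otimes>\<^bsub>G\<^esub> k = g \<otimes>\<^bsub>G\<^esub> (h \<otimes>\<^bsub>G\<^esub> k)"
    unfolding carrier[symmetric] by (auto simp: m_assoc)
qed

lemma smooth_near_mult:
  assumes P: "smooth_manifold P" and f: "smooth_near P M f p" and g: "smooth_near P M g p"
  shows "smooth_near P M (\<lambda>x. f x \<otimes>\<^bsub>G\<^esub> g x) p"
proof -
  have "smooth_map (prod_manifold M M) M (\<lambda>(g, h). g \<otimes>\<^bsub>G\<^esub> h)"
    using lie_group by (simp add: lie_group_def)
  moreover have "(f p, g p) \<in> points (prod_manifold M M)"
    using f g by (simp add: smooth_near_def)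
  ultimately have "smooth_near (prod_manifold M M) M (\<lambda>(g, h). g \<otimes>\<^bsub>G\<^esub> h) (f p, g p)"
    using smooth_map_iff[OF smooth_manifold_prod[OF M M] M] by blast
  from smooth_near_compose[OF P smooth_manifold_prod[OF M M] M smooth_near_Pair[OF M M P f g] this]
  show ?thesis by simp
qed

lemma smooth_near_inv:
  assumes P: "smooth_manifold P" and f: "smooth_near P M f p"
  shows "smooth_near P M (\<lambda>x. inv\<^bsub>G\<^esub> f x) p"
proof -
  have "smooth_map M M (\<lambda>g. inv\<^bsub>G\<^esub> g)"
    using lie_group by (simp add: lie_group_def)
  then have "smooth_near M M (\<lambda>g. inv\<^bsub>G\<^esub> g) (f p)"
    using f smooth_map_iff[OF M M] by (auto simp: smooth_near_def)
  from smooth_near_compose[OF P M M f this] show ?thesis .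
qed

lemma smooth_near_right_mult:
  "p \<in> points M \<Longrightarrow> g \<in> points M \<Longrightarrow> smooth_near M M (\<lambda>h. h \<otimes>\<^bsub>G\<^esub> g) p"
  by (intro smooth_near_mult M smooth_near_id smooth_near_const)

lemma openin_points: "openin (mtop M) (points M)"
  by (simp add: points_def)

text \<open>The chain rule applied to associativity. Mutually inverse translations give
  \<open>mc_R\<close> and \<open>R_mc\<close>; translations starting at the identity give the
  invariance of \<open>R\<close> (\<open>R_translate\<close>).\<close>

lemma tangent_right_mult_comp:
  assumes "p \<in> points M" "g \<in> points M" "h \<in> points M"
  shows "tangent_map M M (\<lambda>k. k \<otimes>\<^bsub>G\<^esub> h) (p \<otimes>\<^bsub>G\<^esub> g) (tangent_map M M (\<lambda>k. k \<otimes>\<^bsub>G\<^esub> g) p v) =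
    tangent_map M M (\<lambda>k. k \<otimes>\<^bsub>G\<^esub> (g \<otimes>\<^bsub>G\<^esub> h)) p v"
proof -
  have "tangent_map M M (\<lambda>k. k \<otimes>\<^bsub>G\<^esub> g \<otimes>\<^bsub>G\<^esub> h) p = tangent_map M M (\<lambda>k. k \<otimes>\<^bsub>G\<^esub> (g \<otimes>\<^bsub>G\<^esub> h)) p"
    by (rule tangent_map_cong[OF M openin_points assms(1)]) (use assms in \<open>simp add: group_assoc\<close>)
  then show ?thesis
    using tangent_map_compose[OF M M M smooth_near_right_mult[OF assms(1,2)]
        smooth_near_right_mult[of "p \<otimes>\<^bsub>G\<^esub> g" h]]
      assms by (simp add: fun_eq_iff)
qed

lemma tangent_right_mult_one: "p \<in> points M \<Longrightarrow> tangent_map M M (\<lambda>k. k \<otimes>\<^bsub>G\<^esub> \<one>\<^bsub>G\<^esub>) p = (\<lambda>v. v)"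
  using tangent_map_cong[OF M openin_points, where N = M, of p "\<lambda>k. k \<otimes>\<^bsub>G\<^esub> \<one>\<^bsub>G\<^esub>" "\<lambda>k. k"]
      smooth_near_id(2)[OF M] by simp

lemma mc_R [simp]: "g \<in> points M \<Longrightarrow> mc g (R \<xi> g) = \<xi>"
  unfolding mc_def right_inv_field_def
  using tangent_right_mult_comp[of "\<one>\<^bsub>G\<^esub>" g "inv\<^bsub>G\<^esub> g" \<xi>] by (simp add: tangent_right_mult_one)

lemma R_mc [simp]: "g \<in> points M \<Longrightarrow> R (mc g v) g = v"
  unfolding mc_def right_inv_field_def
  using tangent_right_mult_comp[of g "inv\<^bsub>G\<^esub> g" g v] by (simp add: tangent_right_mult_one)

lemma linear_R: "g \<in> points M \<Longrightarrow> linear (\<lambda>\<xi>. R \<xi> g)"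
  unfolding right_inv_field_def by (intro tangent_map_linear[OF smooth_near_right_mult]) auto

lemma linear_mc: "g \<in> points M \<Longrightarrow> linear (mc g)"
  unfolding mc_def by (intro tangent_map_linear[OF smooth_near_right_mult]) auto

lemma R_translate:
  "g \<in> points M \<Longrightarrow> h \<in> points M \<Longrightarrow> tangent_map M M (\<lambda>k. k \<otimes>\<^bsub>G\<^esub> g) h (R \<xi> h) = R \<xi> (h \<otimes>\<^bsub>G\<^esub> g)"
  unfolding right_inv_field_def using tangent_right_mult_comp[of "\<one>\<^bsub>G\<^esub>" h g \<xi>] by simp

definition X :: "'g \<Rightarrow> 'e \<Rightarrow> 'e \<Rightarrow> 'e" where
  "X p \<xi> = field_rep M p (R \<xi>)"

definition \<theta> :: "'g \<Rightarrow> 'e \<Rightarrow> 'e \<Rightarrow> 'e" where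
  "\<theta> p x v = mc (chart_inv M p x) (tangent_map vec_manifold M (chart_inv M p) x v)"

context
  fixes p assumes p: "p \<in> points M"
begin

lemma chart_inv_points: "x \<in> chart_image M p \<Longrightarrow> chart_inv M p x \<in> points M"
  using chart_inv_in[OF M p] chart_dom_props(3)[OF M p] by blast

lemma X_eq: "X p \<xi> x = tangent_map M vec_manifold (chart M p) (chart_inv M p x) (R \<xi> (chart_inv M
    p x))"
  by (simp add: X_def field_rep_def Let_def)

lemma \<theta>_X [simp]: "x \<in> chart_image M p \<Longrightarrow> \<theta> p x (X p \<xi> x) = \<xi>"
  unfolding \<theta>_def X_eq by (simp add: tangent_chart_inv_chart[OF M p] chart_inv_points)

lemma X_\<theta> [simp]: "x \<in> chart_image M p \<Longrightarrow> X p (\<theta> p x v) x = v"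
  unfolding \<theta>_def X_eq by (simp add: tangent_chart_inv_chart[OF M p] chart_inv_points)

lemma linear_X: "x \<in> chart_image M p \<Longrightarrow> linear (\<lambda>\<xi>. X p \<xi> x)"
  unfolding X_eq
  using linear_compose[OF linear_R[OF chart_inv_points]
      tangent_map_linear[OF smooth_near_chart[OF M p chart_inv_in[OF M p]]]]
  by (simp add: o_def)

lemma linear_\<theta>: "x \<in> chart_image M p \<Longrightarrow> linear (\<theta> p x)"
  unfolding \<theta>_def[abs_def]
  using linear_compose[OF tangent_map_linear[OF smooth_near_chart_inv[OF M p]] linear_mc[OF
      chart_inv_points]]
  by (simp add: o_def)

text \<open>Presents the field as a partial derivative, at the identity, of the multiplication read
  in charts; its smoothness in \<open>x\<close> then follows from joint smoothness of the
  multiplication.\<close>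

lemma X_alt:
  assumes x: "x \<in> chart_image M p"
  shows "X p \<xi> x = fder (\<lambda>z. chart M p (chart_inv M \<one>\<^bsub>G\<^esub> z \<otimes>\<^bsub>G\<^esub> chart_inv M p x)) (chart M \<one>\<^bsub>G\<^esub>
      \<one>\<^bsub>G\<^esub>) \<xi>"
proof -
  let ?y = "chart_inv M p x"
  have y: "?y \<in> points M" "?y \<in> chart_dom M p" using x chart_inv_points chart_inv_in[OF M p] by auto
  have "smooth_near M vec_manifold (chart M p) (\<one>\<^bsub>G\<^esub> \<otimes>\<^bsub>G\<^esub> ?y)"
    using smooth_near_chart[OF M p y(2)] y by simp
  from tangent_map_compose[OF M M V smooth_near_right_mult[OF group_points(1) y(1)] this]
  have "X p \<xi> x = tangent_map M vec_manifold (\<lambda>h. chart M p (h \<otimes>\<^bsub>G\<^esub> ?y)) \<one>\<^bsub>G\<^esub> \<xi>"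
    by (simp add: X_eq right_inv_field_def y)
  then show ?thesis by (simp add: tangent_map_def o_def)
qed

text \<open>Here the base point occurs twice, as the point of differentiation and inside the
  inverse, which is why \<open>smooth_\<theta>\<close> uses \<open>smooth_on_partial\<close> with
  the identity for \<alpha>.\<close>

lemma \<theta>_alt:
  assumes x: "x \<in> chart_image M p"
  shows "\<theta> p x v = fder (\<lambda>z. chart M \<one>\<^bsub>G\<^esub> (chart_inv M p z \<otimes>\<^bsub>G\<^esub> inv\<^bsub>G\<^esub> chart_inv M p x)) x v"
proof -
  let ?y = "chart_inv M p x"
  have y: "?y \<in> points M" using x chart_inv_points by auto
  from tangent_map_compose[OF V M M smooth_near_chart_inv[OF M p x] smooth_near_right_mult[OF y]]
  have "\<theta> p x v = tangent_map vec_manifold M (\<lambda>z. chart_inv M p z \<otimes>\<^bsub>G\<^esub> inv\<^bsub>G\<^esub> ?y) x v"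
    by (simp add: \<theta>_def mc_def y)
  then show ?thesis by (simp add: tangent_map_def o_def y)
qed

lemma smooth_near_vecD:
  assumes "smooth_near vec_manifold vec_manifold f x"
  obtains W where "open W" "x \<in> W" "smooth_on W f"
  using assms by (auto simp: smooth_near_def smooth_in_charts_def)

lemma smooth_X: "smooth_on (chart_image M p) (X p \<xi>)"
proof (rule smooth_on_local)
  fix x assume x: "x \<in> chart_image M p"
  let ?e = "chart M \<one>\<^bsub>G\<^esub> \<one>\<^bsub>G\<^esub>"
  let ?F = "\<lambda>u. chart M p (chart_inv M \<one>\<^bsub>G\<^esub> (fst u) \<otimes>\<^bsub>G\<^esub> chart_inv M p (snd u))"
  note one = chart_dom_props(1)[OF M group_points(1)]
  note V2 = smooth_manifold_vec[OF finite_dim_prod[OF fin fin]]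
  have e: "?e \<in> chart_image M \<one>\<^bsub>G\<^esub>" "chart_inv M \<one>\<^bsub>G\<^esub> ?e = \<one>\<^bsub>G\<^esub>"
    using chart_in_image[OF M group_points(1) one] chart_inv_chart[OF M group_points(1) one] by auto
  have y: "chart_inv M p x \<in> points M" "chart_inv M p x \<in> chart_dom M p"
    using x chart_inv_points chart_inv_in[OF M p] by auto
  have fs: "smooth_near vec_manifold vec_manifold (fst :: 'e \<times> 'e \<Rightarrow> 'e) (?e, x)"
    "smooth_near vec_manifold vec_manifold (snd :: 'e \<times> 'e \<Rightarrow> 'e) (?e, x)"
    using smooth_near_fst[OF V V, of "(?e, x)"] smooth_near_snd[OF V V, of "(?e, x)"]
    by (simp_all add: prod_vec_manifold)
  have "smooth_near vec_manifold M (\<lambda>u. chart_inv M \<one>\<^bsub>G\<^esub> (fst u) \<otimes>\<^bsub>G\<^esub> chart_inv M p (snd u)) (?e,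
      x)"
    by (intro smooth_near_mult V2 smooth_near_compose[OF V2 V M fs(1)]
        smooth_near_compose[OF V2 V M fs(2)] smooth_near_chart_inv[OF M]) (use p e x in auto)
  then have "smooth_near vec_manifold vec_manifold ?F (?e, x)"
    by (rule smooth_near_compose[OF V2 M V]) (use smooth_near_chart[OF M p y(2)] e y in simp)
  then obtain W where W: "open W" "(?e, x) \<in> W" "smooth_on W ?F" by (rule smooth_near_vecD)
  define S where "S = chart_image M p \<inter> (\<lambda>z. (?e, z)) -` W"
  have S: "open S" unfolding S_def
    by (intro continuous_open_preimage chart_dom_props(5)[OF M p] W continuous_intros)
  have "smooth_on S (\<lambda>x. fder (\<lambda>z. ?F (z, x)) ?e \<xi>)"
    by (rule smooth_on_partial[OF fin fin W(1,3) S smooth_on_const]) (simp add: S_def)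
  then have "smooth_on S (X p \<xi>)"
    by (rule smooth_on_cong[OF S, THEN iffD1, rotated]) (simp add: X_alt S_def)
  then show "\<exists>T. open T \<and> x \<in> T \<and> smooth_on T (X p \<xi>)"
    using S x W(2) by (intro exI[of _ S]) (auto simp: S_def)
qed

lemma smooth_\<theta>: "smooth_on (chart_image M p) (\<lambda>x. \<theta> p x v)"
proof (rule smooth_on_local)
  fix x assume x: "x \<in> chart_image M p"
  let ?F = "\<lambda>u. chart M \<one>\<^bsub>G\<^esub> (chart_inv M p (fst u) \<otimes>\<^bsub>G\<^esub> inv\<^bsub>G\<^esub> chart_inv M p (snd u))"
  note V2 = smooth_manifold_vec[OF finite_dim_prod[OF fin fin]]
  have y: "chart_inv M p x \<in> points M" using x chart_inv_points by auto
  have fs: "smooth_near vec_manifold vec_manifold (fst :: 'e \<times> 'e \<Rightarrow> 'e) (x, x)"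
    "smooth_near vec_manifold vec_manifold (snd :: 'e \<times> 'e \<Rightarrow> 'e) (x, x)"
    using smooth_near_fst[OF V V, of "(x, x)"] smooth_near_snd[OF V V, of "(x, x)"]
    by (simp_all add: prod_vec_manifold)
  have "smooth_near vec_manifold M (\<lambda>u. chart_inv M p (fst u) \<otimes>\<^bsub>G\<^esub> inv\<^bsub>G\<^esub> chart_inv M p (snd u))
      (x, x)"
    by (intro smooth_near_mult smooth_near_inv V2 smooth_near_compose[OF V2 V M fs(1)]
        smooth_near_compose[OF V2 V M fs(2)] smooth_near_chart_inv[OF M]) (use p x in auto)
  then have "smooth_near vec_manifold vec_manifold ?F (x, x)"
    by (rule smooth_near_compose[OF V2 M V])
      (use smooth_near_chart[OF M _ chart_dom_props(1)[OF M group_points(1)]] y in simp)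
  then obtain W where W: "open W" "(x, x) \<in> W" "smooth_on W ?F" by (rule smooth_near_vecD)
  define S where "S = chart_image M p \<inter> (\<lambda>z. (z, z)) -` W"
  have S: "open S" unfolding S_def
    by (intro continuous_open_preimage chart_dom_props(5)[OF M p] W continuous_intros)
  have "smooth_on S (\<lambda>x. fder (\<lambda>z. ?F (z, x)) x v)"
    by (rule smooth_on_partial[OF fin fin W(1,3) S smooth_on_id]) (simp add: S_def)
  then have "smooth_on S (\<lambda>x. \<theta> p x v)"
    by (rule smooth_on_cong[OF S, THEN iffD1, rotated]) (simp add: \<theta>_alt S_def)
  then show "\<exists>T. open T \<and> x \<in> T \<and> smooth_on T (\<lambda>x. \<theta> p x v)"
    using S x W(2) by (intro exI[of _ S]) (auto simp: S_def)
qed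

end

section \<open>The Lie bracket and the structure equation\<close>

lemma one_chart:
  "chart M \<one>\<^bsub>G\<^esub> \<one>\<^bsub>G\<^esub> \<in> chart_image M \<one>\<^bsub>G\<^esub>" "chart_inv M \<one>\<^bsub>G\<^esub> (chart M \<one>\<^bsub>G\<^esub> \<one>\<^bsub>G\<^esub>) = \<one>\<^bsub>G\<^esub>"
  using chart_in_image[OF M group_points(1)] chart_inv_chart[OF M group_points(1)]
    chart_dom_props(1)[OF M group_points(1)] by auto

lemma X_one: "X \<one>\<^bsub>G\<^esub> \<xi> (chart M \<one>\<^bsub>G\<^esub> \<one>\<^bsub>G\<^esub>) = \<xi>"
proof -
  let ?e = "chart M \<one>\<^bsub>G\<^esub> \<one>\<^bsub>G\<^esub>"
  have "fder (\<lambda>z. chart M \<one>\<^bsub>G\<^esub> (chart_inv M \<one>\<^bsub>G\<^esub> z \<otimes>\<^bsub>G\<^esub> chart_inv M \<one>\<^bsub>G\<^esub> ?e)) ?e = fder (\<lambda>z. z) ?e"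
    by (rule fder_cong[OF chart_dom_props(5)[OF M group_points(1)] one_chart(1)])
      (simp add: one_chart chart_inv_points chart_chart_inv[OF M])
  then show ?thesis using X_alt[OF _ one_chart(1)] by simp
qed

lemma lie_bracket_eq: "lie_bracket G \<xi> \<eta> = vbracket (X \<one>\<^bsub>G\<^esub> \<xi>) (X \<one>\<^bsub>G\<^esub> \<eta>) (chart M \<one>\<^bsub>G\<^esub> \<one>\<^bsub>G\<^esub>)"
  by (simp add: lie_bracket_def field_bracket_def vbracket_def X_def Let_def)

text \<open>Right translation by the point \<open>?g\<close>, read in charts, relates the fields
  around the identity to those around \<open>x\<close>; naturality of the bracket carries the
  defining value at the identity to \<open>x\<close>.\<close>

lemma vbracket_X:
  assumes p: "p \<in> points M" and x: "x \<in> chart_image M p"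
  shows "vbracket (X p \<xi>) (X p \<eta>) x = X p (lie_bracket G \<xi> \<eta>) x"
proof -
  let ?e = "chart M \<one>\<^bsub>G\<^esub> \<one>\<^bsub>G\<^esub>" and ?g = "chart_inv M p x"
  have g: "?g \<in> points M" "?g \<in> chart_dom M p" using x chart_inv_points[OF p] chart_inv_in[OF M p]
      by auto
  let ?\<phi> = "\<lambda>z. chart M p (chart_inv M \<one>\<^bsub>G\<^esub> z \<otimes>\<^bsub>G\<^esub> ?g)"
  have phi_e: "?\<phi> ?e = x" using g chart_chart_inv[OF M p x] by (simp add: one_chart)
  have near: "smooth_near vec_manifold M (\<lambda>z. chart_inv M \<one>\<^bsub>G\<^esub> z \<otimes>\<^bsub>G\<^esub> ?g) z"
    if "z \<in> chart_image M \<one>\<^bsub>G\<^esub>" for z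
    by (intro smooth_near_mult V smooth_near_const[OF V M] smooth_near_chart_inv[OF M]) (use that
        g in auto)
  have "smooth_near vec_manifold vec_manifold ?\<phi> ?e"
    by (rule smooth_near_compose[OF V M V near[OF one_chart(1)]])
      (use smooth_near_chart[OF M p g(2)] g in \<open>simp add: one_chart\<close>)
  then obtain W0 where W0: "open W0" "?e \<in> W0" "smooth_on W0 ?\<phi>" by (rule smooth_near_vecD[OF p])
  \<comment> \<open>A region whose translate stays in the chart at \<open>p\<close>, so that the
    right-invariant field at translated points is given by \<open>X p\<close>.\<close>
  obtain W1 where W1: "open W1" "?e \<in> W1" "W1 \<subseteq> chart_image M \<one>\<^bsub>G\<^esub>"
    "\<And>z. z \<in> W1 \<Longrightarrow> chart_inv M \<one>\<^bsub>G\<^esub> z \<otimes>\<^bsub>G\<^esub> ?g \<in> chart_dom M p"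
  proof -
    have "smooth_in_charts M M (\<lambda>h. h \<otimes>\<^bsub>G\<^esub> ?g) \<one>\<^bsub>G\<^esub> p \<one>\<^bsub>G\<^esub>"
      by (rule smooth_near_in_charts[OF M M _ p]) (use g chart_dom_props(1)[OF M] in \<open>auto intro:
          smooth_near_right_mult\<close>)
    then show ?thesis using that unfolding smooth_in_charts_def by blast
  qed
  define W where "W = W0 \<inter> W1"
  have W: "open W" "?e \<in> W" "smooth_on W ?\<phi>"
    using W0 W1 by (auto simp: W_def intro: smooth_on_subset)
  have rel: "fder ?\<phi> z (X \<one>\<^bsub>G\<^esub> \<zeta> z) = X p \<zeta> (?\<phi> z)" if "z \<in> W" for z \<zeta>
  proof -
    let ?h = "chart_inv M \<one>\<^bsub>G\<^esub> z"
    have z: "z \<in> chart_image M \<one>\<^bsub>G\<^esub>" "?h \<otimes>\<^bsub>G\<^esub> ?g \<in> chart_dom M p" using that W1 by (auto simp: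
        W_def)
    have h: "?h \<in> points M" using z(1) chart_inv_points by auto
    have "fder ?\<phi> z (X \<one>\<^bsub>G\<^esub> \<zeta> z) = tangent_map M vec_manifold (chart M p) (?h \<otimes>\<^bsub>G\<^esub> ?g)
        (tangent_map vec_manifold M (\<lambda>z. chart_inv M \<one>\<^bsub>G\<^esub> z \<otimes>\<^bsub>G\<^esub> ?g) z (X \<one>\<^bsub>G\<^esub> \<zeta> z))"
      using tangent_map_compose[OF V M V near[OF z(1)] smooth_near_chart[OF M p z(2)]]
      by (simp add: tangent_map_vec)
    also have "tangent_map vec_manifold M (\<lambda>z. chart_inv M \<one>\<^bsub>G\<^esub> z \<otimes>\<^bsub>G\<^esub> ?g) z (X \<one>\<^bsub>G\<^esub> \<zeta> z) =
        tangent_map M M (\<lambda>k. k \<otimes>\<^bsub>G\<^esub> ?g) ?h (R \<zeta> ?h)"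
      using tangent_map_compose[OF V M M smooth_near_chart_inv[OF M group_points(1) z(1)]
          smooth_near_right_mult[OF h g(1)]]
      by (simp add: X_eq tangent_chart_inv_chart[OF M group_points(1) z(1)])
    also have "\<dots> = R \<zeta> (?h \<otimes>\<^bsub>G\<^esub> ?g)" by (rule R_translate[OF g(1) h])
    finally show ?thesis
      using chart_inv_chart[OF M p z(2)] by (simp add: X_eq[OF p])
  qed
  have dX: "X q \<zeta> differentiable (at z)" if "q \<in> points M" "z \<in> chart_image M q" for q z \<zeta>
    by (rule smooth_on_differentiable[OF smooth_X[OF that(1)] that(2)])
  have "fder ?\<phi> ?e (vbracket (X \<one>\<^bsub>G\<^esub> \<xi>) (X \<one>\<^bsub>G\<^esub> \<eta>) ?e) = vbracket (X p \<xi>) (X p \<eta>) (?\<phi> ?e)"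
    by (rule vbracket_related[OF fin W]) (use rel dX one_chart x p in \<open>auto simp: phi_e[unfolded
        one_chart(2)]\<close>)
  then show ?thesis
    unfolding phi_e lie_bracket_eq[symmetric] by (simp add: X_alt[OF p x])
qed

lemma lie_bracket_linear:
  "linear (\<lambda>\<xi>. lie_bracket G \<xi> \<eta>)" "linear (lie_bracket G \<xi>)"
proof -
  let ?e = "chart M \<one>\<^bsub>G\<^esub> \<one>\<^bsub>G\<^esub>"
  have 1: "linear (fder (X \<one>\<^bsub>G\<^esub> \<eta>) ?e)" for \<eta>
    by (rule smooth_on_linear[OF smooth_X[OF group_points(1)] one_chart(1)])
  have 2: "linear (\<lambda>\<xi>. fder (X \<one>\<^bsub>G\<^esub> \<xi>) ?e \<eta>)" for \<eta>
    using linear_fder_family[OF chart_dom_props(5)[OF M group_points(1)] one_chart(1)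
        linear_X[OF group_points(1)] smooth_on_differentiable[OF smooth_X[OF group_points(1)]
            one_chart(1)]]
    by simp
  show "linear (\<lambda>\<xi>. lie_bracket G \<xi> \<eta>)" "linear (lie_bracket G \<xi>)"
    unfolding lie_bracket_eq[abs_def] vbracket_def X_one
    using linear_compose_sub[OF 1 2] linear_compose_sub[OF 2 1] by auto
qed

lemma lie_bracket_anti: "lie_bracket G \<xi> \<eta> = - lie_bracket G \<eta> \<xi>"
  by (simp add: lie_bracket_eq vbracket_def)

text \<open>By \<open>vbracket_X\<close> the right-invariant field of the inner bracket agrees near
  the identity with the bracket of the fields, so its derivative agrees too, and the Jacobi identity
  for vector fields applies.\<close>

lemma lie_bracket_jacobi:
  "lie_bracket G \<xi> (lie_bracket G \<eta> \<zeta>) + lie_bracket G \<eta> (lie_bracket G \<zeta> \<xi>) +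
   lie_bracket G \<zeta> (lie_bracket G \<xi> \<eta>) = 0"
proof -
  let ?e = "chart M \<one>\<^bsub>G\<^esub> \<one>\<^bsub>G\<^esub>" and ?X = "X \<one>\<^bsub>G\<^esub>"
  have *: "lie_bracket G \<xi> (lie_bracket G \<eta> \<zeta>) = vbracket (?X \<xi>) (vbracket (?X \<eta>) (?X \<zeta>)) ?e" for
      \<xi> \<eta> \<zeta>
  proof -
    have "fder (?X (lie_bracket G \<eta> \<zeta>)) ?e = fder (vbracket (?X \<eta>) (?X \<zeta>)) ?e"
      by (rule fder_cong[OF chart_dom_props(5)[OF M group_points(1)] one_chart(1)])
        (simp add: vbracket_X)
    then show ?thesis
      by (simp add: lie_bracket_eq[of \<xi> "lie_bracket G \<eta> \<zeta>"] vbracket_def[of _ "?X (lie_bracket G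
          \<eta> \<zeta>)"]
          vbracket_def[of "?X \<xi>" "vbracket (?X \<eta>) (?X \<zeta>)"] vbracket_X one_chart)
  qed
  show ?thesis
    unfolding * by (rule vbracket_jacobi[OF fin chart_dom_props(5)[OF M group_points(1)]
        one_chart(1)
        smooth_X smooth_X smooth_X]) auto
qed

text \<open>\<theta> takes the constant value \<xi> on the right-invariant field of \<xi>.
  Differentiating this trades derivatives of \<theta> for derivatives of the field, and
  antisymmetrising produces the bracket of fields.\<close>

lemma maurer_cartan:
  assumes p: "p \<in> points M" and x: "x \<in> chart_image M p"
  shows "fder (\<lambda>y. \<theta> p y w) x v - fder (\<lambda>y. \<theta> p y v) x w = - lie_bracket G (\<theta> p x v) (\<theta> p x w)"
proof -
  note U = chart_dom_props(5)[OF M p]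
  have *: "fder (\<lambda>y. \<theta> p y (X p \<xi> x)) x u = - \<theta> p x (fder (X p \<xi>) x u)" for \<xi> u
  proof -
    have 1: "((\<lambda>y. \<theta> p y (X p \<xi> y)) has_derivative
        (\<lambda>u. fder (\<lambda>y. \<theta> p y (X p \<xi> x)) x u + \<theta> p x (fder (X p \<xi>) x u))) (at x)"
      by (rule has_derivative_linear_family[OF fin U x linear_\<theta>[OF p]
            smooth_on_differentiable[OF smooth_\<theta>[OF p] x] smooth_on_differentiable[OF smooth_X[OF
                p] x]])
    have 2: "((\<lambda>y. \<theta> p y (X p \<xi> y)) has_derivative (\<lambda>u. 0)) (at x)"
      by (rule has_derivative_cong_open[OF U x, THEN iffD1, rotated, OF has_derivative_const[of \<xi>]])
        (simp add: p)
    show ?thesis using has_derivative_unique[OF 1 2] by (metis add_eq_0_iff2)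
  qed
  have "fder (\<lambda>y. \<theta> p y (X p \<eta> x)) x (X p \<xi> x) - fder (\<lambda>y. \<theta> p y (X p \<xi> x)) x (X p \<eta> x) =
      - lie_bracket G \<xi> \<eta>" for \<xi> \<eta>
  proof -
    have "\<theta> p x (vbracket (X p \<xi>) (X p \<eta>) x) = lie_bracket G \<xi> \<eta>"
      by (simp add: vbracket_X p x)
    then show ?thesis
      unfolding * vbracket_def
      by (simp add: linear_diff[OF linear_\<theta>[OF p x]]) (metis minus_diff_eq)
  qed
  \<comment> \<open>Every tangent vector at \<open>x\<close> is the value there of the
    right-invariant field of its image under \<theta>, so these fields exhaust all pairs
    \<open>v\<close>, \<open>w\<close>.\<close>
  from this[of "\<theta> p x w" "\<theta> p x v"] show ?thesis by (simp add: p x)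
qed

end

section \<open>The symplectic forms\<close>

lemma
  assumes M: "smooth_manifold (M :: ('a, 'e::real_normed_vector) manifold)"
    and fV: "finite_dim TYPE('v::real_normed_vector)" and fW: "finite_dim
        TYPE('w::real_normed_vector)"
    and L: "smooth_on UNIV (L :: 'v \<Rightarrow> 'w)" and p: "fst p \<in> points M"
  shows smooth_near_snd_comp:
      "smooth_near (prod_manifold M vec_manifold) vec_manifold (\<lambda>q. L (snd q)) p"
    and tangent_map_snd_comp:
      "tangent_map (prod_manifold M vec_manifold) vec_manifold (\<lambda>q. L (snd q)) p =
        (\<lambda>v. fder L (snd p) (snd v))"
proof -
  note V = smooth_manifold_vec[OF fV] and W = smooth_manifold_vec[OF fW]
  note P = smooth_manifold_prod[OF M V]
  have p': "p \<in> points (prod_manifold M (vec_manifold :: ('v, 'v) manifold))"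
    using p by (cases p) auto
  note Ls = smooth_near_vec[OF open_UNIV UNIV_I L]
  show "smooth_near (prod_manifold M vec_manifold) vec_manifold (\<lambda>q. L (snd q)) p"
    by (rule smooth_near_compose[OF P V W smooth_near_snd[OF M V p'] Ls])
  show "tangent_map (prod_manifold M vec_manifold) vec_manifold (\<lambda>q. L (snd q)) p =
        (\<lambda>v. fder L (snd p) (snd v))"
    using tangent_map_compose[OF P V W smooth_near_snd[OF M V p'] Ls]
    by (simp add: tangent_map_snd[OF M V p'] tangent_map_vec)
qed

lemma smooth_on_bounded_linear_UNIV: "bounded_linear L \<Longrightarrow> smooth_on UNIV L"
  by (rule smooth_on_bounded_linear[OF _ open_UNIV smooth_on_id])

lemma fder_bounded_linear_self: "bounded_linear L \<Longrightarrow> fder L x = L"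
  by (intro fder_eqI bounded_linear_imp_has_derivative)

text \<open>The transported form acts on the same vectors as \<omega>, because the tangent map of
  \<open>h\<close> is the identity; the local representatives coincide, and with them smoothness and
  closedness.\<close>

lemma symplectic_form_transport:
  assumes M: "smooth_manifold (M :: ('a, 'e::real_normed_vector) manifold)"
    and kh: "\<And>x. x \<in> points M \<Longrightarrow> k (h x) = x" and \<omega>: "symplectic_form M \<omega>"
  shows "symplectic_form (transport_manifold h k M) (\<lambda>n. \<omega> (k n))"
proof -
  let ?T = "transport_manifold h k M"
  note V = smooth_manifold_vec[OF smooth_manifold_finite_dim[OF M]]
  note T = smooth_manifold_transport[where h = h and k = k, OF M kh]
  have pts: "k n \<in> points M" if "n \<in> points ?T" for n
    using that kh by (auto simp: transport_simps[where h = h and k = k, OF M kh])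
  have ci: "chart_image ?T n = chart_image M (k n)" if "n \<in> points ?T" for n
    by (rule transport_chart_image[where h = h and k = k, OF M kh pts[OF that]])
  have rep: "form_rep ?T n (\<lambda>n. \<omega> (k n)) x v w = form_rep M (k n) \<omega> x v w"
    if n: "n \<in> points ?T" and x: "x \<in> chart_image M (k n)" for n x v w
  proof -
    note kn = pts[OF n]
    let ?y = "chart_inv M (k n) x"
    have y: "?y \<in> points M" using chart_inv_in[OF M kn x] chart_dom_props(3)[OF M kn] by blast
    have inv: "chart_inv ?T n z = h (chart_inv M (k n) z)" if "z \<in> chart_image M (k n)" for z
      by (rule transport_chart_inv[where h = h and k = k, OF M kh kn that])
    have "tangent_map vec_manifold ?T (chart_inv ?T n) x =
        tangent_map vec_manifold ?T (\<lambda>z. h (chart_inv M (k n) z)) x"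
      by (rule tangent_map_cong[OF V _ x inv]) (simp_all add: chart_dom_props(5)[OF M kn])
    also have "\<dots> = tangent_map vec_manifold M (chart_inv M (k n)) x"
      using tangent_map_compose[OF V M T smooth_near_chart_inv[OF M kn x]
          smooth_near_transport[where h = h and k = k, OF M kh y]]
      by (simp add: tangent_map_transport[where h = h and k = k, OF M kh y])
    finally show ?thesis
      unfolding form_rep_def pullback_def inv[OF x] using kh[OF y] by simp
  qed
  have fder_rep: "fder (\<lambda>x. form_rep ?T n (\<lambda>n. \<omega> (k n)) x v w) x = fder (\<lambda>x. form_rep M (k n) \<omega> x
      v w) x"
    if n: "n \<in> points ?T" and x: "x \<in> chart_image M (k n)" for n x v w
    by (rule fder_cong[OF chart_dom_props(5)[OF M pts[OF n]] x rep[OF n]])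
  have smooth: "smooth_on (chart_image M (k n)) (\<lambda>x. form_rep ?T n (\<lambda>n. \<omega> (k n)) x v w)"
    if n: "n \<in> points ?T" for n v w
    using \<omega> pts[OF n] unfolding symplectic_form_def
    by (subst smooth_on_cong[OF chart_dom_props(5)[OF M pts[OF n]] rep[OF n]]) auto
  have closed: "fder (\<lambda>x. form_rep ?T n (\<lambda>n. \<omega> (k n)) x v w) x u +
      fder (\<lambda>x. form_rep ?T n (\<lambda>n. \<omega> (k n)) x w u) x v +
      fder (\<lambda>x. form_rep ?T n (\<lambda>n. \<omega> (k n)) x u v) x w = 0"
    if n: "n \<in> points ?T" and x: "x \<in> chart_image M (k n)" for n x u v w
    unfolding fder_rep[OF n x] using \<omega> pts[OF n] x unfolding symplectic_form_def by simp
  have pointwise: "bilinear (\<omega> (k n)) \<and> (\<forall>v w. \<omega> (k n) v w = - \<omega> (k n) w v) \<and>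
      (\<forall>v. (\<forall>w. \<omega> (k n) v w = 0) \<longrightarrow> v = 0)" if n: "n \<in> points ?T" for n
    using conjunct1[OF \<omega>[unfolded symplectic_form_def]] pts[OF n] by (rule bspec)
  show ?thesis
    unfolding symplectic_form_def
  proof (intro conjI ballI allI)
    fix n assume n: "n \<in> points ?T"
    from pointwise[OF n] show "bilinear (\<omega> (k n))" and "\<omega> (k n) v w = - \<omega> (k n) w v"
      and "(\<forall>w. \<omega> (k n) v w = 0) \<longrightarrow> v = 0" for v w by blast+
    show "smooth_on (chart_image ?T n) (\<lambda>x. form_rep ?T n (\<lambda>n. \<omega> (k n)) x v w)" for v w
      unfolding ci[OF n] by (rule smooth[OF n])
    show "fder (\<lambda>x. form_rep ?T n (\<lambda>n. \<omega> (k n)) x v w) x u +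
        fder (\<lambda>x. form_rep ?T n (\<lambda>n. \<omega> (k n)) x w u) x v +
        fder (\<lambda>x. form_rep ?T n (\<lambda>n. \<omega> (k n)) x u v) x w = 0"
      if "x \<in> chart_image ?T n" for x u v w
      by (rule closed[OF n that[unfolded ci[OF n]]])
  qed
qed

context lie
begin

lemma bounded_lie_bracket: "bounded_linear (lie_bracket G \<xi>)"
  by (rule finite_dim_linear_bounded[OF fin lie_bracket_linear(2)])

text \<open>\<open>Blinfun\<close> represents its argument faithfully here because the bracket,
  linear on a finite-dimensional space, is bounded.\<close>

lemma ad_star_apply [simp]: "blinfun_apply (ad_star G \<xi> \<mu>) \<eta> = blinfun_apply \<mu> (lie_bracket G \<xi> \<eta>)"
  unfolding ad_star_def
  by (subst bounded_linear_Blinfun_apply)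
    (auto intro: bounded_linear_compose[OF blinfun.bounded_linear_right bounded_lie_bracket])

lemmas bracket_simps =
  linear_add[OF lie_bracket_linear(1)] linear_add[OF lie_bracket_linear(2)]
  linear_diff[OF lie_bracket_linear(1)] linear_diff[OF lie_bracket_linear(2)]
  linear_0[OF lie_bracket_linear(1)] linear_0[OF lie_bracket_linear(2)]

lemma fin_dual: "finite_dim TYPE('e dual)"
  by (rule finite_dim_dual[OF fin])

lemma cotangent_frame_inv:
  assumes g: "g \<in> points M"
  shows "the_inv_into UNIV (cotangent_frame G (g, \<mu>)) (v, a) = (mc g v, a - ad_star G (mc g v) \<mu>)"
proof (rule the_inv_into_f_eq)
  show "inj (cotangent_frame G (g, \<mu>))"
    by (rule inj_on_inverseI[where g = "\<lambda>(v, a). (mc g v, a - ad_star G (mc g v) \<mu>)"])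
      (auto simp: cotangent_frame_def g)
qed (auto simp: cotangent_frame_def g)

text \<open>Each of the two \<open>ad_star\<close> corrections of the inverse frame subtracts one
  bracket term, so the coefficient +1 prescribed in the frame becomes -1, the sign in the structure
  equation.\<close>

lemma cotangent_form_eq:
  assumes g: "g \<in> points M"
  shows "cotangent_form G (g, \<nu>) (v, c) (w, c') = blinfun_apply c (mc g w) - blinfun_apply c' (mc
      g v)
    - blinfun_apply \<nu> (lie_bracket G (mc g v) (mc g w))"
  using arg_cong[OF lie_bracket_anti, of "blinfun_apply \<nu>" "mc g w" "mc g v"]
  by (simp add: cotangent_form_def cotangent_frame_inv[OF g] blinfun.diff_left blinfun.minus_right)

text \<open>The frame is triangular: the group component is solved through \<open>mc\<close>, and
  the others follow by substitution, the last one using the solved second one.\<close>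

lemma tulczyjew_frame_inv:
  assumes g: "g \<in> points M"
  shows "the_inv_into UNIV (tulczyjew_frame G (g, \<mu>, \<xi>, \<nu>)) (v, a, b, c) =
    (mc g v, a - ad_star G (mc g v) \<mu>, b - lie_bracket G \<xi> (mc g v),
     c - ad_star G (mc g v) \<nu> + ad_star G \<xi> (a - ad_star G (mc g v) \<mu>))"
proof (rule the_inv_into_f_eq)
  show "inj (tulczyjew_frame G (g, \<mu>, \<xi>, \<nu>))"
    by (rule inj_on_inverseI[where g = "\<lambda>(v, a, b, c). (mc g v, a - ad_star G (mc g v) \<mu>,
        b - lie_bracket G \<xi> (mc g v),
        c - ad_star G (mc g v) \<nu> + ad_star G \<xi> (a - ad_star G (mc g v) \<mu>))"])
      (auto simp: tulczyjew_frame_def g)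
qed (auto simp: tulczyjew_frame_def g)

text \<open>
  In the coordinates of the tangent vectors themselves, Tulczyjew's form is the sum of the canonical
  forms of the factors with coordinates \<open>(g, \<nu>)\<close> and \<open>(\<mu>, \<xi>)\<close>; the terms involving \<open>\<mu>\<close> and two
  brackets cancel by the Jacobi identity.
\<close>

lemma tulczyjew_form_eq:
  assumes g: "g \<in> points M"
  shows "tulczyjew_form G (g, \<mu>, \<xi>, \<nu>) (v, a, b, c) (w, a', b', c') =
    cotangent_form G (g, \<nu>) (v, c) (w, c') + (blinfun_apply a b' - blinfun_apply a' b)"
proof -
  define x y where "x = mc g v" and "y = mc g w"
  let ?B = "lie_bracket G"
  have "?B \<xi> (?B x y) + ?B x (?B y \<xi>) + ?B y (?B \<xi> x) = 0"
    by (rule lie_bracket_jacobi)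
  moreover have "?B x (?B y \<xi>) = - ?B x (?B \<xi> y)"
    using lie_bracket_anti[of y \<xi>] linear_neg[OF lie_bracket_linear(2)] by metis
  moreover have "?B y (?B \<xi> x) = - ?B (?B \<xi> x) y" by (rule lie_bracket_anti)
  ultimately have "?B \<xi> (?B x y) = ?B x (?B \<xi> y) + ?B (?B \<xi> x) y"
    by (simp add: algebra_simps add_eq_0_iff2)
  then have j: "blinfun_apply \<mu> (?B \<xi> (?B x y)) =
      blinfun_apply \<mu> (?B x (?B \<xi> y)) + blinfun_apply \<mu> (?B (?B \<xi> x) y)"
    by (simp add: blinfun.add_right)
  have anti: "blinfun_apply l (?B y z) = - blinfun_apply l (?B z y)" for l :: "'e dual" and y z
    using lie_bracket_anti[of y z] by (simp add: blinfun.minus_right)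
  show ?thesis
    unfolding cotangent_form_eq[OF g] tulczyjew_form_def
    using j anti[of \<mu> y "?B \<xi> x"] anti[of \<mu> y b] anti[of \<nu> y x]
    by (simp add: tulczyjew_frame_inv[OF g] x_def[symmetric] y_def[symmetric] blinfun.diff_left
        blinfun.add_left blinfun.add_right blinfun.diff_right bracket_simps)
qed

text \<open>The common pattern of both forms: the exterior derivative of
  \<open>N(w)(\<theta>) + B(w, dw)\<close> on the product of the group with a vector space.
  \<open>N\<close> selects the covector paired with the group direction, \<open>B\<close> pairs
  fibre coordinates among themselves. Nondegeneracy depends on the instance and stays a
  hypothesis.\<close>

lemma symplectic_form_prodI:
  fixes N :: "'v::real_normed_vector \<Rightarrow> 'e dual" and B :: "'v \<Rightarrow> 'v \<Rightarrow> real"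
  assumes fV: "finite_dim TYPE('v)" and N: "bounded_linear N" and B: "bounded_bilinear B"
    and \<omega>: "\<And>g w v u v' u'. g \<in> points M \<Longrightarrow> \<omega> (g, w) (v, u) (v', u') =
      blinfun_apply (N u) (mc g v') - blinfun_apply (N u') (mc g v)
      - blinfun_apply (N w) (lie_bracket G (mc g v) (mc g v')) + (B u u' - B u' u)"
    and nondeg: "\<And>g w v u. g \<in> points M \<Longrightarrow> (\<And>v' u'. \<omega> (g, w) (v, u) (v', u') = 0) \<Longrightarrow> v = 0 \<and> u = 0"
  shows "symplectic_form (prod_manifold M vec_manifold) \<omega>"
proof -
  let ?P = "prod_manifold M (vec_manifold :: ('v, 'v) manifold)"
  note VV = smooth_manifold_vec[OF fV]
  note V2 = smooth_manifold_vec[OF finite_dim_prod[OF fin fV]]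
  note P = smooth_manifold_prod[OF M VV]
  note Nl = bounded_linear.linear[OF N]
  have lin: "linear (\<omega> (g, w) x)" if g: "g \<in> points M" for g w x
  proof -
    obtain v u where x: "x = (v, u)" by (cases x)
    show ?thesis
      unfolding x
      by (rule linearI; clarsimp simp: \<omega>[OF g] linear_add[OF linear_mc[OF g]] linear_scale[OF
          linear_mc[OF g]]
          linear_add[OF Nl] linear_scale[OF Nl] bracket_simps linear_scale[OF lie_bracket_linear(2)]
          blinfun.add_right blinfun.add_left blinfun.scaleR_left blinfun.scaleR_right
          bounded_bilinear.add_left[OF B] bounded_bilinear.add_right[OF B]
          bounded_bilinear.scaleR_left[OF B] bounded_bilinear.scaleR_right[OF B] algebra_simps)
  qed
  have anti: "\<omega> (g, w) x y = - \<omega> (g, w) y x" if g: "g \<in> points M" for g w x y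
  proof -
    obtain v u v' u' where "x = (v, u)" "y = (v', u')" by (cases x, cases y)
    then show ?thesis
      using arg_cong[OF lie_bracket_anti, of "blinfun_apply (N w)" "mc g v" "mc g v'"]
      by (simp add: \<omega>[OF g] blinfun.minus_right)
  qed
  have bil: "bilinear (\<omega> (g, w))" if g: "g \<in> points M" for g w
  proof -
    have "linear (\<lambda>x. - \<omega> (g, w) y x)" for y
      using linear_compose_neg[OF lin[OF g]] .
    moreover have "(\<lambda>x. - \<omega> (g, w) y x) = (\<lambda>x. \<omega> (g, w) x y)" for y
      by (rule ext) (rule anti[OF g, symmetric])
    ultimately have "linear (\<lambda>x. \<omega> (g, w) x y)" for y by metis
    then show ?thesis using lin[OF g] by (simp add: bilinear_def)
  qed
  \<comment> \<open>By the Maurer--Cartan equation, the form is the exterior derivative of \<open>A\<close>.\<close>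
  define A where "A g x v = blinfun_apply (N (snd x)) (\<theta> g (fst x) (fst v)) + B (snd x) (snd v)"
      for g x v
  let ?S = "\<lambda>g. chart_image M g \<times> (UNIV :: 'v set)"
  have S: "open (?S g)" if "g \<in> points M" for g
    using chart_dom_props(5)[OF M that] by (simp add: open_Times)
  have A_smooth: "smooth_on (?S g) (\<lambda>x. A g x v)" if g: "g \<in> points M" for g v
  proof -
    have \<theta>: "smooth_on (?S g) (\<lambda>x. \<theta> g (fst x) (fst v))"
      by (rule smooth_on_compose[OF fin S[OF g] chart_dom_props(5)[OF M g] smooth_\<theta>[OF g]
          smooth_on_bounded_linear[OF bounded_linear_fst S[OF g] smooth_on_id]]) auto
    have snd: "smooth_on (?S g) snd"
      using smooth_on_bounded_linear[OF bounded_linear_snd S[OF g] smooth_on_id] by simp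
    show ?thesis
      unfolding A_def
      by (intro smooth_on_add S g smooth_on_bounded_bilinear[OF bounded_bilinear_blinfun_apply]
          smooth_on_bounded_bilinear[OF B] smooth_on_bounded_linear[OF N] \<theta> snd smooth_on_const)
  qed
  \<comment> \<open>The base variable enters only through \<theta> and the fibre variable linearly,
    so the product rule gives one term for each occurrence.\<close>
  have dA: "fder (\<lambda>x. A g x (v', u')) (z, w) (v, u) = blinfun_apply (N u) (\<theta> g z v')
      + blinfun_apply (N w) (fder (\<lambda>y. \<theta> g y v') z v) + B u u'"
    if g: "g \<in> points M" and z: "z \<in> chart_image M g" for g z w v u v' u'
  proof -
    have 1: "((\<lambda>x. \<theta> g (fst x) v') has_derivative (\<lambda>h. fder (\<lambda>y. \<theta> g y v') z (fst h))) (at (z, w))"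
      by (rule has_derivative_compose[of fst fst "(z, w)" UNIV "\<lambda>y. \<theta> g y v'" "fder (\<lambda>y. \<theta> g y v')
          z"])
        (use smooth_on_has_derivative[OF smooth_\<theta>[OF g] z] in
          \<open>auto intro: bounded_linear_imp_has_derivative bounded_linear_fst\<close>)
    have 2: "((\<lambda>x. N (snd x)) has_derivative (\<lambda>h. N (snd h))) (at (z, w))"
      by (intro bounded_linear_imp_has_derivative bounded_linear_compose[OF N] bounded_linear_snd)
    have 3: "((\<lambda>x. B (snd x) u') has_derivative (\<lambda>h. B (snd h) u')) (at (z, w))"
      by (intro bounded_linear_imp_has_derivative
          bounded_linear_compose[OF bounded_bilinear.bounded_linear_left[OF B]] bounded_linear_snd)
    have "((\<lambda>x. A g x (v', u')) has_derivative (\<lambda>h. blinfun_apply (N w) (fder (\<lambda>y. \<theta> g y v') z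
        (fst h))
        + blinfun_apply (N (snd h)) (\<theta> g z v') + B (snd h) u')) (at (z, w))"
      unfolding A_def
      using has_derivative_add[OF bounded_bilinear.FDERIV[OF bounded_bilinear_blinfun_apply 2 1]
          3] by simp
    from fder_eqI[OF this] show ?thesis by simp
  qed
  \<comment> \<open>The inverse chart moves only the group component, which turns \<open>mc\<close>
    into \<theta>; the structure equation then replaces the bracket by derivatives of
    \<theta>.\<close>
  have rep: "form_rep ?P (g, w0) \<omega> x v v' = fder (\<lambda>x. A g x v') x v - fder (\<lambda>x. A g x v) x v'"
    if g: "g \<in> points M" and x': "x \<in> ?S g" for g w0 x v v'
  proof -
    obtain z w where x: "x = (z, w)" by (cases x)
    have z: "z \<in> chart_image M g" using x' x by simp
    have inv: "chart_inv ?P (g, w0) y = (chart_inv M g (fst y), snd y)" if "y \<in> ?S g" for y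
      using that chart_inv_prod[OF M VV, of "(g, w0)" "fst y" "snd y"] g by auto
    have px: "x \<in> points (prod_manifold (vec_manifold :: ('e, 'e) manifold) (vec_manifold :: ('v,
        'v) manifold))"
      by auto
    note fs = smooth_near_fst[OF V VV px, unfolded prod_vec_manifold]
    note sn = smooth_near_snd[OF V VV px, unfolded prod_vec_manifold]
    have zi: "smooth_near vec_manifold M (chart_inv M g) (fst x)"
      using smooth_near_chart_inv[OF M g z] by (simp add: x)
    have "tangent_map vec_manifold ?P (chart_inv ?P (g, w0)) x =
        tangent_map vec_manifold ?P (\<lambda>y. (chart_inv M g (fst y), snd y)) x"
      by (rule tangent_map_cong[OF V2 _ x' inv]) (simp_all add: S[OF g])
    also have "\<dots> = (\<lambda>v. (tangent_map vec_manifold M (chart_inv M g) z (fst v), snd v))"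
      using tangent_map_Pair[OF M VV V2 smooth_near_compose[OF V2 V M fs zi] sn]
        tangent_map_compose[OF V2 V M fs zi] tangent_map_fst[OF V VV px, unfolded prod_vec_manifold]
        tangent_map_snd[OF V VV px, unfolded prod_vec_manifold] by (simp add: x)
    finally have t: "tangent_map vec_manifold ?P (chart_inv ?P (g, w0)) x =
        (\<lambda>v. (tangent_map vec_manifold M (chart_inv M g) z (fst v), snd v))" .
    obtain v1 u v1' u' where v: "v = (v1, u)" "v' = (v1', u')" by (cases v, cases v')
    have gz: "chart_inv M g z \<in> points M" by (rule chart_inv_points[OF g z])
    have "form_rep ?P (g, w0) \<omega> x v v' = blinfun_apply (N u) (\<theta> g z v1') - blinfun_apply (N u') (\<theta>
        g z v1)
      - blinfun_apply (N w) (lie_bracket G (\<theta> g z v1) (\<theta> g z v1')) + (B u u' - B u' u)"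
      unfolding form_rep_def pullback_def t inv[OF x']
      by (simp add: v x \<omega>[OF gz] \<theta>_def)
    also have "\<dots> = blinfun_apply (N u) (\<theta> g z v1') - blinfun_apply (N u') (\<theta> g z v1)
      + blinfun_apply (N w) (fder (\<lambda>y. \<theta> g y v1') z v1 - fder (\<lambda>y. \<theta> g y v1) z v1') + (B u u' - B
          u' u)"
      by (simp add: maurer_cartan[OF g z] blinfun.minus_right)
    finally show ?thesis
      by (simp add: v x dA[OF g z] blinfun.diff_right)
  qed
  have smooth: "smooth_on (?S g) (\<lambda>x. form_rep ?P (g, w0) \<omega> x v v')" if g: "g \<in> points M" for g w0
      v v'
  proof -
    have "smooth_on (?S g) (\<lambda>x. fder (\<lambda>x. A g x v') x v + (- 1) *\<^sub>R fder (\<lambda>x. A g x v) x v')"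
      by (intro smooth_on_add S g smooth_on_fder A_smooth
          smooth_on_bounded_linear[OF bounded_linear_scaleR_right])
    then show ?thesis
      by (subst smooth_on_cong[OF S[OF g] rep[OF g]]) auto
  qed
  have closed: "fder (\<lambda>x. form_rep ?P (g, w0) \<omega> x v w) x u + fder (\<lambda>x. form_rep ?P (g, w0) \<omega> x w
      u) x v
      + fder (\<lambda>x. form_rep ?P (g, w0) \<omega> x u v) x w = 0"
    if g: "g \<in> points M" and x: "x \<in> ?S g" for g w0 x u v w
  proof -
    have "fder (\<lambda>x. form_rep ?P (g, w0) \<omega> x v v') x =
        fder (\<lambda>x. fder (\<lambda>x. A g x v') x v - fder (\<lambda>x. A g x v) x v') x" for v v'
      by (rule fder_cong[OF S[OF g] x rep[OF g]])
    then show ?thesis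
      using exact_imp_closed[OF A_smooth[OF g] S[OF g] x] by simp
  qed
  have nd: "x = 0" if g: "g \<in> points M" and "\<forall>y. \<omega> (g, w) x y = 0" for g w x
    using nondeg[OF g, of w "fst x" "snd x"] that(2) by (simp add: prod_eq_iff)
  show ?thesis
    unfolding symplectic_form_def
  proof (intro conjI ballI allI)
    fix p assume "p \<in> points ?P"
    then obtain g w where p: "p = (g, w)" and g: "g \<in> points M" by auto
    show "bilinear (\<omega> p)" using bil[OF g] by (simp add: p)
    show "\<omega> p v w = - \<omega> p w v" for v w unfolding p by (rule anti[OF g])
    show "(\<forall>w. \<omega> p v w = 0) \<longrightarrow> v = 0" for v using nd[OF g] by (simp add: p)
    show "smooth_on (chart_image ?P p) (\<lambda>x. form_rep ?P p \<omega> x v w)" for v w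
      using smooth[OF g] by (simp add: p)
    show "fder (\<lambda>x. form_rep ?P p \<omega> x v w) x u + fder (\<lambda>x. form_rep ?P p \<omega> x w u) x v
      + fder (\<lambda>x. form_rep ?P p \<omega> x u v) x w = 0" if "x \<in> chart_image ?P p" for x u v w
      using closed[OF g, of x] that by (simp add: p)
  qed
qed

text \<open>Vertical test vectors \<open>(0, c')\<close> detect the group component; once it
  vanishes, the vectors \<open>(R \<eta> g, 0)\<close> detect the covector.\<close>

lemma cotangent_form_nondegenerate:
  assumes g: "g \<in> points M" and 0: "\<And>w c'. cotangent_form G (g, \<nu>) (v, c) (w, c') = 0"
  shows "v = 0 \<and> c = 0"
proof -
  have mc0: "mc g 0 = 0" by (rule linear_0[OF linear_mc[OF g]])
  have "blinfun_apply c' (mc g v) = 0" for c' :: "'e dual"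
    using 0[of 0 c'] by (simp add: cotangent_form_eq[OF g] mc0 bracket_simps)
  then have "mc g v = 0" by (rule finite_dim_functional_separates[OF fin])
  then have v: "v = 0" using R_mc[OF g, of v] linear_0[OF linear_R[OF g]] by simp
  have "blinfun_apply c \<eta> = 0" for \<eta>
    using 0[of "R \<eta> g" 0] by (simp add: v cotangent_form_eq[OF g] mc0 bracket_simps g)
  then have "c = 0" by (intro blinfun_eqI) simp
  with v show ?thesis by simp
qed

lemma symplectic_cotangent: "symplectic_form (cotangent_manifold G) (cotangent_form G)"
  unfolding cotangent_manifold_def
proof (rule symplectic_form_prodI[where N = "\<lambda>x. x" and B = "\<lambda>_ _. 0"])
  show "bounded_bilinear (\<lambda>_ _. 0 :: real)"
    by (rule bounded_bilinear.intro) (auto intro: exI[of _ 0])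
  show "v = 0 \<and> u = 0"
    if "g \<in> points M" "\<And>v' u'. cotangent_form G (g, w) (v, u) (v', u') = 0" for g w v u
    using that by (rule cotangent_form_nondegenerate)
qed (auto simp: fin_dual cotangent_form_eq)

lemma tulczyjew_manifold_eq: "tulczyjew_manifold G = prod_manifold M vec_manifold"
  by (simp add: tulczyjew_manifold_def prod_vec_manifold)

lemmas fin_fibre = finite_dim_prod[OF fin_dual finite_dim_prod[OF fin fin_dual]]

lemma symplectic_tulczyjew: "symplectic_form (tulczyjew_manifold G) (tulczyjew_form G)"
  unfolding tulczyjew_manifold_eq
\<comment> \<open>On the fibre with coordinates (\<mu>, \<xi>, \<nu>), \<open>N\<close> reads off
  \<nu> and \<open>B\<close> evaluates the \<mu>-part of its first argument on the \<xi>-part of its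
  second.\<close>
proof (rule symplectic_form_prodI[where N = "\<lambda>x. snd (snd x)"
      and B = "\<lambda>x y. blinfun_apply (fst x) (fst (snd y))", OF fin_fibre])
  show "bounded_linear (\<lambda>x :: 'e dual \<times> 'e \<times> 'e dual. snd (snd x))"
    by (intro bounded_linear_compose[OF bounded_linear_snd] bounded_linear_snd)
  have "bounded_linear (\<lambda>x :: 'e dual \<times> 'e \<times> 'e dual. fst (snd x))"
    by (intro bounded_linear_compose[OF bounded_linear_fst] bounded_linear_snd)
  from bounded_bilinear.comp[OF bounded_bilinear_blinfun_apply bounded_linear_fst this]
  show "bounded_bilinear (\<lambda>(x :: 'e dual \<times> 'e \<times> 'e dual) (y :: 'e dual \<times> 'e \<times> 'e dual).
      blinfun_apply (fst x) (fst (snd y)))" .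
next
  fix g :: 'g and w u u' :: "'e dual \<times> 'e \<times> 'e dual" and v v' :: 'e
  assume g: "g \<in> points M"
  obtain \<mu> \<xi> \<nu> a b c a' b' c' where e: "w = (\<mu>, \<xi>, \<nu>)" "u = (a, b, c)" "u' = (a', b', c')"
    by (cases w, cases u, cases u')
  show "tulczyjew_form G (g, w) (v, u) (v', u') =
      blinfun_apply (snd (snd u)) (mc g v') - blinfun_apply (snd (snd u')) (mc g v)
      - blinfun_apply (snd (snd w)) (lie_bracket G (mc g v) (mc g v'))
      + (blinfun_apply (fst u) (fst (snd u')) - blinfun_apply (fst u') (fst (snd u)))"
    by (simp add: e tulczyjew_form_eq[OF g] cotangent_form_eq[OF g])
next
  fix g :: 'g and w u :: "'e dual \<times> 'e \<times> 'e dual" and v :: 'e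
  assume g: "g \<in> points M" and 0: "\<And>v' u'. tulczyjew_form G (g, w) (v, u) (v', u') = 0"
  obtain \<mu> \<xi> \<nu> a b c where e: "w = (\<mu>, \<xi>, \<nu>)" "u = (a, b, c)" by (cases w, cases u)
  \<comment> \<open>The two summands can be tested separately: the zero vector in the cotangent part
    isolates \<open>a\<close> and \<open>b\<close>, and \<open>a' = 0\<close>, \<open>b' = 0\<close>
    isolates \<open>v\<close> and \<open>c\<close>.\<close>
  have 1: "cotangent_form G (g, \<nu>) (v, c) (v', c') + (blinfun_apply a b' - blinfun_apply a' b) =
      0" for v' a' b' c'
    using 0[of v' "(a', b', c')"] by (simp add: e tulczyjew_form_eq[OF g])
  have z: "cotangent_form G (g, \<nu>) (v, c) (0, 0) = 0"
    by (simp add: cotangent_form_eq[OF g] linear_0[OF linear_mc[OF g]] bracket_simps)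
  have "blinfun_apply a b' = 0" for b' using 1[of 0 0 b' 0] by (simp add: z)
  then have a: "a = 0" by (intro blinfun_eqI) simp
  have "blinfun_apply a' b = 0" for a' :: "'e dual" using 1[of 0 0 0 a'] by (simp add: z)
  then have b: "b = 0" by (rule finite_dim_functional_separates[OF fin])
  have "v = 0 \<and> c = 0"
    by (rule cotangent_form_nondegenerate[OF g]) (use 1[of _ _ 0 0] in simp)
  with a b show "v = 0 \<and> u = 0" by (simp add: e zero_prod_def)
qed

end

section \<open>The reduction\<close>

lemma vec_group_simps [simp]:
  "carrier vec_group = UNIV" "(\<otimes>\<^bsub>vec_group\<^esub>) = (+)" "\<one>\<^bsub>vec_group\<^esub> = 0"
  "man vec_group = vec_manifold"
  by (simp_all add: vec_group_def)

lemma group_vec_group: "group (vec_group :: ('e::real_normed_vector, 'e) lie_structure)"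
proof (rule groupI)
  fix x :: 'e
  show "\<exists>y\<in>carrier vec_group. y \<otimes>\<^bsub>vec_group\<^esub> x = \<one>\<^bsub>vec_group\<^esub>"
    by (intro bexI[of _ "- x"]) auto
qed auto

lemma comm_group_vec_group: "comm_group (vec_group :: ('e::real_normed_vector, 'e) lie_structure)"
  by (rule group.group_comm_groupI[OF group_vec_group]) (simp add: add.commute)

lemma lie_group_vec_group:
  assumes "finite_dim TYPE('e::real_normed_vector)"
  shows "lie_group (vec_group :: ('e, 'e) lie_structure)"
proof -
  note V = smooth_manifold_vec[OF assms] and V2 = smooth_manifold_vec[OF finite_dim_prod[OF assms
      assms]]
  have inv: "m_inv vec_group = (uminus :: 'e \<Rightarrow> 'e)"
    by (rule ext, rule group.inv_equality[OF group_vec_group]) auto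
  have "bounded_linear (\<lambda>p :: 'e \<times> 'e. fst p + snd p)"
    by (intro bounded_linear_add bounded_linear_fst bounded_linear_snd)
  then have "smooth_map (vec_manifold :: ('e \<times> 'e, _) manifold) (vec_manifold :: ('e, _) manifold)
      (\<lambda>(x, y). x + y)"
    unfolding smooth_map_iff[OF V2 V] case_prod_beta
    using smooth_near_vec[OF open_UNIV UNIV_I smooth_on_bounded_linear_UNIV] by blast
  moreover have "smooth_map (vec_manifold :: ('e, _) manifold) (vec_manifold :: ('e, _) manifold)
      (\<lambda>x. - x)"
    unfolding smooth_map_iff[OF V V]
    using smooth_near_vec[OF open_UNIV UNIV_I smooth_on_bounded_linear_UNIV[OF
        bounded_linear_minus[OF bounded_linear_ident]]]
    by blast
  ultimately show ?thesis
    unfolding lie_group_def using V by (simp add: group_vec_group inv prod_vec_manifold)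
qed

section \<open>Parametrisation of the momentum level and of its orbits\<close>

definition pin_momentum :: "'e dual \<Rightarrow> 'g \<times> 'e \<times> 'e dual \<Rightarrow> ('g, 'e::real_normed_vector) tulczyjew"
    where
  "pin_momentum \<mu> = (\<lambda>(g, \<xi>, \<nu>). (g, \<mu>, \<xi>, \<nu>))"

definition forget_momentum :: "('g, 'e::real_normed_vector) tulczyjew \<Rightarrow> 'g \<times> 'e \<times> 'e dual" where
  "forget_momentum = (\<lambda>(g, \<mu>, \<xi>, \<nu>). (g, \<xi>, \<nu>))"

text \<open>The orbit through any point with components \<open>g\<close>, \<mu>, \<nu>, written
  without reference to the action; \<open>orbit_eq\<close> identifies the two.\<close>

definition fibre :: "'e dual \<Rightarrow> 'g \<times> 'e dual \<Rightarrow> ('g, 'e::real_normed_vector) tulczyjew set" where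
  "fibre \<mu> = (\<lambda>(g, \<nu>). {(g, \<mu>, \<xi>, \<nu>) | \<xi>. True})"

text \<open>All points of an orbit share \<open>g\<close> and \<nu>, so the choice is harmless. As
  the value is read off the set alone, the same function inverts \<open>fibre \<mu>\<close> for
  every \<mu>.\<close>

definition fibre_base :: "('g, 'e::real_normed_vector) tulczyjew set \<Rightarrow> 'g \<times> 'e dual" where
  "fibre_base n = (case SOME q. q \<in> n of (g, \<mu>, \<xi>, \<nu>) \<Rightarrow> (g, \<nu>))"

lemma forget_pin [simp]: "forget_momentum (pin_momentum \<mu> z) = z"
  by (cases z) (simp add: forget_momentum_def pin_momentum_def)

lemma fibre_base_fibre [simp]: "fibre_base (fibre \<mu> x) = x"
proof -
  obtain g \<nu> where x: "x = (g, \<nu>)" by (cases x)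
  have "(SOME q. q \<in> fibre \<mu> x) \<in> fibre \<mu> x"
    by (rule someI[of _ "(g, \<mu>, 0, \<nu>)"]) (simp add: fibre_def x)
  then show ?thesis by (auto simp: fibre_base_def fibre_def x)
qed

context lie
begin

abbreviation "T \<equiv> tulczyjew_manifold G"
abbreviation "C \<equiv> cotangent_manifold G"
abbreviation "Z0 \<equiv> prod_manifold M (vec_manifold :: ('e \<times> 'e dual, _) manifold)"
text \<open>Level and orbit space receive the structure of explicit product models. That the level
  carries the subspace topology and that the orbit map is a submersion is verified in
  \<open>embedded_Z\<close> and \<open>submersion_projection\<close>.\<close>

abbreviation "Z \<mu> \<equiv> transport_manifold (pin_momentum \<mu>) forget_momentum Z0"
abbreviation "N \<mu> \<equiv> transport_manifold (fibre \<mu>) fibre_base C"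

lemmas fin_Z = finite_dim_prod[OF fin fin_dual]

lemma C_eq: "C = prod_manifold M vec_manifold" by (simp add: cotangent_manifold_def)

lemma points_T [simp]: "(g, w) \<in> points T \<longleftrightarrow> g \<in> points M"
  by (simp add: tulczyjew_manifold_eq)

lemma smooth_T: "smooth_manifold T" and smooth_C: "smooth_manifold C" and smooth_Z0:
    "smooth_manifold Z0"
  unfolding tulczyjew_manifold_eq C_eq
  by (intro smooth_manifold_prod M smooth_manifold_vec fin_fibre fin_dual fin_Z)+

lemma smooth_Z: "smooth_manifold (Z \<mu>)" and smooth_N: "smooth_manifold (N \<mu>)"
  using smooth_manifold_transport[OF smooth_Z0, of forget_momentum "pin_momentum \<mu>"]
    smooth_manifold_transport[OF smooth_C, of fibre_base "fibre \<mu>"] by auto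

lemmas smooth_near_forget =
  smooth_near_transport_inv[where h = "pin_momentum \<mu>" and k = forget_momentum, OF smooth_Z0
      forget_pin] for \<mu>
lemmas tangent_map_forget =
  tangent_map_transport_inv[where h = "pin_momentum \<mu>" and k = forget_momentum, OF smooth_Z0
      forget_pin] for \<mu>
lemmas smooth_near_fibre =
  smooth_near_transport[where h = "fibre \<mu>" and k = fibre_base, OF smooth_C fibre_base_fibre] for \<mu>
lemmas tangent_map_fibre =
  tangent_map_transport[where h = "fibre \<mu>" and k = fibre_base, OF smooth_C fibre_base_fibre] for \<mu>
lemmas smooth_near_fibre_base =
  smooth_near_transport_inv[where h = "fibre \<mu>" and k = fibre_base, OF smooth_C fibre_base_fibre]
      for \<mu>
lemmas tangent_map_fibre_base =
  tangent_map_transport_inv[where h = "fibre \<mu>" and k = fibre_base, OF smooth_C fibre_base_fibre]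
      for \<mu>

lemma points_Z: "points (Z \<mu>) = level_set T tulczyjew_momentum \<mu>"
proof -
  have "points (Z \<mu>) = pin_momentum \<mu> ` points Z0"
    by (rule transport_simps(4)[OF smooth_Z0]) simp
  then show ?thesis
    by (auto simp: level_set_def pin_momentum_def tulczyjew_momentum_def image_iff)
qed

section \<open>The shift action and its momentum map\<close>

lemma shift_apply:
  "g \<in> points M \<Longrightarrow> shift_action G \<eta> (g, \<mu>, \<xi>, \<nu>) = (g, \<mu>, \<xi> + \<eta>, \<nu>)"
  by (simp add: shift_action_def)

lemma shift_in [simp]: "p \<in> points T \<Longrightarrow> shift_action G \<eta> p \<in> points T"
  by (cases p) (simp add: shift_apply)

lemma shift_shift: "p \<in> points T \<Longrightarrow> shift_action G \<eta> (shift_action G \<zeta> p) = shift_action G (\<eta> + \<zeta>) p"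
  by (cases p) (simp add: shift_apply add.assoc add.commute)

lemma shift_zero: "p \<in> points T \<Longrightarrow> shift_action G 0 p = p"
  by (cases p) (simp add: shift_apply)

lemma openin_T: "openin (mtop T) (points T)" by (simp add: points_def)

text \<open>Because of the restriction in \<open>shift_action\<close>, it is a translation of the
  fibre only on the points of the manifold, hence the congruence arguments. The charts at a point
  and at its shift coincide, so the tangent map is the derivative of a translation.\<close>

lemma shift_smooth:
  assumes p: "p \<in> points T"
  shows "smooth_near T T (shift_action G \<eta>) p" "tangent_map T T (shift_action G \<eta>) p = (\<lambda>v. v)"
proof -
  let ?L = "\<lambda>w :: 'e dual \<times> 'e \<times> 'e dual. w + (0, \<eta>, 0)"
  have sm: "smooth_on UNIV ?L"
    by (intro smooth_on_add smooth_on_id smooth_on_const open_UNIV)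
  have D: "fder ?L x = (\<lambda>v. v)" for x
    by (intro fder_eqI) (auto intro!: derivative_eq_intros)
  have p': "fst p \<in> points M" using p by (cases p) simp
  have eq: "(case q of (g, w) \<Rightarrow> (g, ?L w)) = shift_action G \<eta> q" if "q \<in> points T" for q
    using that by (cases q) (simp add: shift_apply)
  have near: "smooth_near T T (\<lambda>(g, w). (g, ?L w)) p"
    "tangent_map T T (\<lambda>(g, w). (g, ?L w)) p = (\<lambda>v. v)"
    using smooth_near_map_snd[OF M fin_fibre fin_fibre open_UNIV UNIV_I sm p']
      tangent_map_map_snd[OF M fin_fibre fin_fibre open_UNIV UNIV_I sm p']
    by (simp_all add: tulczyjew_manifold_eq D id_def)
  show "smooth_near T T (shift_action G \<eta>) p"
    by (rule smooth_near_cong[OF smooth_T openin_T p eq near(1)])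
  show "tangent_map T T (shift_action G \<eta>) p = (\<lambda>v. v)"
    using tangent_map_cong[OF smooth_T openin_T p eq, where N = T] near(2) by simp
qed

text \<open>Expressed in tangent components the form is independent of \<xi>
  (\<open>tulczyjew_form_eq\<close>), and the tangent map of the shift is the identity.\<close>

lemma shift_symplectomorphism:
  "symplectomorphism T (tulczyjew_form G) T (tulczyjew_form G) (shift_action G \<eta>)"
  unfolding symplectomorphism_def
proof (intro conjI ballI allI)
  show "diffeomorphism T T (shift_action G \<eta>)"
    by (rule diffeomorphismI[OF smooth_T smooth_T, where g = "shift_action G (- \<eta>)"])
      (auto simp: shift_smooth shift_shift shift_zero)
  fix p and v w :: "'e \<times> 'e dual \<times> 'e \<times> 'e dual" assume p: "p \<in> points T"
  obtain g \<mu> \<xi> \<nu> where pe: "p = (g, \<mu>, \<xi>, \<nu>)" by (cases p)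
  obtain v1 a b c where v: "v = (v1, a, b, c)" by (cases v)
  obtain w1 a' b' c' where w: "w = (w1, a', b', c')" by (cases w)
  have g: "g \<in> points M" using p pe by simp
  show "pullback T T (shift_action G \<eta>) (tulczyjew_form G) p v w = tulczyjew_form G p v w"
    by (simp add: pullback_def shift_smooth[OF p]) (simp add: pe v w shift_apply g
        tulczyjew_form_eq)
qed

lemma shift_group_action: "group_action vec_group (points T) (shift_action G)"
proof -
  interpret vg: group "vec_group :: ('e, 'e) lie_structure" by (rule group_vec_group)
  have Bij: "shift_action G \<eta> \<in> Bij (points T)" for \<eta>
  proof -
    have "bij_betw (shift_action G \<eta>) (points T) (points T)"
      by (rule bij_betw_byWitness[of _ "shift_action G (- \<eta>)"]) (auto simp: shift_shift shift_zero)
    then show ?thesis by (simp add: Bij_def shift_action_def)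
  qed
  have "shift_action G (x + y) = compose (points T) (shift_action G x) (shift_action G y)" for x y
  proof
    fix p
    show "shift_action G (x + y) p = compose (points T) (shift_action G x) (shift_action G y) p"
      \<comment> \<open>Off the manifold both sides are \<open>undefined\<close>, by extensionality
        of \<open>shift_action\<close> and \<open>compose\<close>.\<close>
      by (cases "p \<in> points T") (simp_all add: compose_def shift_shift, simp add: shift_action_def)
  qed
  then have "shift_action G \<in> hom vec_group (BijGroup (points T))"
    using Bij by (intro homI) (auto simp: BijGroup_def vec_group_def)
  then show ?thesis
    by (intro group_action.intro group_hom.intro group_hom_axioms.intro group_vec_group
        group_BijGroup)
qed

text \<open>The action sends \<open>(a, (g, w))\<close> to \<open>g\<close> together with a bounded
  linear function of \<open>(a, w)\<close>, so it is assembled from projections and one linear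
  map.\<close>

lemma shift_smooth_action: "smooth_action vec_group T (shift_action G)"
proof -
  let ?A = "prod_manifold (vec_manifold :: ('e, 'e) manifold) T"
  note A = smooth_manifold_prod[OF V smooth_T]
  note VF = smooth_manifold_vec[OF fin_fibre]
  note V2 = smooth_manifold_vec[OF finite_dim_prod[OF fin fin_fibre]]
  let ?L = "\<lambda>q :: 'e \<times> 'e dual \<times> 'e \<times> 'e dual. snd q + (0, fst q, 0)"
  have "bounded_linear ?L"
    by (intro bounded_linear_add bounded_linear_snd bounded_linear_Pair bounded_linear_zero
        bounded_linear_fst)
  then have L: "smooth_near vec_manifold vec_manifold ?L q" for q
    using smooth_near_vec[OF open_UNIV UNIV_I smooth_on_bounded_linear_UNIV] by blast
  have opA: "openin (mtop ?A) (points ?A)" unfolding points_def by (rule openin_topspace)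
  have near: "smooth_near ?A T (\<lambda>(a, p). shift_action G a p) x" if x: "x \<in> points ?A" for x
  proof -
    have sx: "snd x \<in> points T" using x by auto
    note s = smooth_near_snd[OF V smooth_T x]
    have f: "smooth_near ?A M (\<lambda>x. fst (snd x)) x"
      by (rule smooth_near_compose[OF A smooth_T M s])
        (use smooth_near_fst[OF M VF] sx in \<open>simp add: tulczyjew_manifold_eq\<close>)
    have w: "smooth_near ?A vec_manifold (\<lambda>x. snd (snd x)) x"
      by (rule smooth_near_compose[OF A smooth_T VF s])
        (use smooth_near_snd[OF M VF] sx in \<open>simp add: tulczyjew_manifold_eq\<close>)
    have "smooth_near ?A vec_manifold (\<lambda>x. (fst x, snd (snd x))) x"
      using smooth_near_Pair[OF V VF A smooth_near_fst[OF V smooth_T x] w] by (simp add: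
          prod_vec_manifold)
    from smooth_near_compose[OF A V2 VF this L]
    have "smooth_near ?A T (\<lambda>x. (fst (snd x), ?L (fst x, snd (snd x)))) x"
      using smooth_near_Pair[OF M VF A f] by (simp add: tulczyjew_manifold_eq)
    then show ?thesis
      by (rule smooth_near_cong[OF A opA x, rotated]) (auto simp: shift_apply)
  qed
  show ?thesis
    unfolding smooth_action_def using shift_group_action near smooth_map_iff[OF A smooth_T]
    by (simp add: vec_group_def)
qed

lemma momentum_eq: "tulczyjew_momentum = (\<lambda>q. fst (snd q))"
  by (auto simp: tulczyjew_momentum_def)

lemma momentum_smooth:
  assumes p: "p \<in> points T"
  shows "smooth_near T vec_manifold tulczyjew_momentum p"
    "tangent_map T vec_manifold tulczyjew_momentum p = (\<lambda>v. fst (snd v))"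
    "tangent_map T vec_manifold (\<lambda>q. blinfun_apply (tulczyjew_momentum q) \<eta>) p = (\<lambda>v.
        blinfun_apply (fst (snd v)) \<eta>)"
proof -
  have p': "fst p \<in> points M" using p by (cases p) simp
  have L: "bounded_linear (fst :: 'e dual \<times> 'e \<times> 'e dual \<Rightarrow> 'e dual)" by (rule bounded_linear_fst)
  have L': "bounded_linear (\<lambda>w :: 'e dual \<times> 'e \<times> 'e dual. blinfun_apply (fst w) \<eta>)"
    by (intro bounded_linear_compose[OF blinfun.bounded_linear_left] bounded_linear_fst)
  have fr: "finite_dim TYPE(real)"
    unfolding finite_dim_def by (intro exI[of _ "{1}"]) (auto simp: span_singleton)
  note 1 = smooth_on_bounded_linear_UNIV[OF L] and 2 = smooth_on_bounded_linear_UNIV[OF L']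
  show "smooth_near T vec_manifold tulczyjew_momentum p"
    "tangent_map T vec_manifold tulczyjew_momentum p = (\<lambda>v. fst (snd v))"
    "tangent_map T vec_manifold (\<lambda>q. blinfun_apply (tulczyjew_momentum q) \<eta>) p = (\<lambda>v.
        blinfun_apply (fst (snd v)) \<eta>)"
    using smooth_near_snd_comp[OF M fin_fibre fin_dual 1 p'] tangent_map_snd_comp[OF M fin_fibre
        fin_dual 1 p']
      tangent_map_snd_comp[OF M fin_fibre fr 2 p']
    by (simp_all add: tulczyjew_manifold_eq momentum_eq fder_bounded_linear_self[OF L]
        fder_bounded_linear_self[OF L'])
qed

lemma generator_eq:
  assumes p: "p \<in> points T"
  shows "generator vec_group T (shift_action G) \<eta> p = (0, 0, \<eta>, 0)"
proof -
  obtain g \<mu> \<xi> \<nu> where pe: "p = (g, \<mu>, \<xi>, \<nu>)" by (cases p)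
  have g: "g \<in> points M" using p pe by simp
  have "tangent_map vec_manifold T (\<lambda>a. shift_action G a p) 0 = (\<lambda>\<eta>. (0, 0, \<eta>, 0))"
    by (rule tangent_mapI)
      (auto simp: pe shift_apply g tulczyjew_manifold_def intro!: derivative_eq_intros)
  then show ?thesis by (simp add: generator_def vec_group_def)
qed

text \<open>Contracting the form with the generator \<open>(0, 0, \<eta>, 0)\<close> leaves only the
  pairing of the \<mu>-component of \<open>v\<close> with \<eta>, with the minus sign of the
  Hamiltonian convention.\<close>

lemma shift_momentum_map:
  "momentum_map vec_group T (tulczyjew_form G) (shift_action G) tulczyjew_momentum"
  unfolding momentum_map_def
proof (intro conjI ballI allI)
  show "smooth_map T vec_manifold tulczyjew_momentum"
    unfolding smooth_map_iff[OF smooth_T smooth_manifold_vec[OF fin_dual]] using momentum_smooth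
        by blast
  fix p \<eta> and v :: "'e \<times> 'e dual \<times> 'e \<times> 'e dual" assume p: "p \<in> points T"
  obtain g \<mu> \<xi> \<nu> where pe: "p = (g, \<mu>, \<xi>, \<nu>)" by (cases p)
  obtain v1 a b c where v: "v = (v1, a, b, c)" by (cases v)
  have g: "g \<in> points M" using p pe by simp
  show "tulczyjew_form G p (generator vec_group T (shift_action G) \<eta> p) v =
      - tangent_map T vec_manifold (\<lambda>q. blinfun_apply (tulczyjew_momentum q) \<eta>) p v"
    unfolding generator_eq[OF p] momentum_smooth(3)[OF p]
    by (simp add: pe v tulczyjew_form_eq g cotangent_form_eq linear_0[OF linear_mc[OF g]]
        bracket_simps)
qed

lemma orbit_eq:
  assumes g: "g \<in> points M"
  shows "orbit vec_group (shift_action G) (g, \<mu>, \<xi>, \<nu>) = fibre \<mu> (g, \<nu>)"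
proof -
  have "\<exists>a. \<zeta> = \<xi> + a" for \<zeta> by (rule exI[of _ "\<zeta> - \<xi>"]) simp
  then show ?thesis
    by (auto simp: orbit_def fibre_def vec_group_def shift_apply g)
qed

lemma points_N: "points (N \<mu>) = orbits vec_group (level_set T tulczyjew_momentum \<mu>) (shift_action
    G)"
proof -
  have "points (N \<mu>) = fibre \<mu> ` points C"
    by (rule transport_simps(4)[OF smooth_C]) simp
  also have "\<dots> = orbits vec_group (level_set T tulczyjew_momentum \<mu>) (shift_action G)"
  proof (intro equalityI subsetI)
    fix n assume "n \<in> fibre \<mu> ` points C"
    then obtain g \<nu> where "g \<in> points M" "n = fibre \<mu> (g, \<nu>)" by (auto simp: C_eq)
    then show "n \<in> orbits vec_group (level_set T tulczyjew_momentum \<mu>) (shift_action G)"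
      unfolding orbits_def
      by (auto simp: orbit_eq level_set_def tulczyjew_momentum_def intro!: exI[of _ g] exI[of _ \<mu>]
          exI[of _ \<nu>])
  next
    fix n assume "n \<in> orbits vec_group (level_set T tulczyjew_momentum \<mu>) (shift_action G)"
    then show "n \<in> fibre \<mu> ` points C"
      by (auto simp: orbits_def level_set_def tulczyjew_momentum_def orbit_eq C_eq)
  qed
  finally show ?thesis .
qed

section \<open>Inclusion and orbit projection of the level set\<close>

lemma Z_point:
  assumes "p \<in> points (Z \<mu>)"
  obtains g \<xi> \<nu> where "p = (g, \<mu>, \<xi>, \<nu>)" "p = pin_momentum \<mu> (g, \<xi>, \<nu>)" "g \<in> points M"
    "(g, \<xi>, \<nu>) \<in> points Z0"
  using assms unfolding points_Z
  by (cases p) (auto simp: level_set_def tulczyjew_momentum_def pin_momentum_def)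

lemma openin_Z: "openin (mtop (Z \<mu>)) (points (Z \<mu>))" by (simp add: points_def)

text \<open>On the level the inclusion equals forgetting \<mu> and reinserting its constant value;
  this factors it through the model \<open>Z0\<close>, where derivatives are explicit.\<close>

lemma inclusion_smooth:
  assumes p: "p \<in> points (Z \<mu>)"
  shows "smooth_near (Z \<mu>) T (\<lambda>p. p) p" "tangent_map (Z \<mu>) T (\<lambda>p. p) p = (\<lambda>(v, w). (v, 0, w))"
proof -
  obtain g \<xi> \<nu> where pe: "p = pin_momentum \<mu> (g, \<xi>, \<nu>)" "g \<in> points M" "(g, \<xi>, \<nu>) \<in> points Z0"
    using Z_point[OF p] .
  let ?L = "\<lambda>w :: 'e \<times> 'e dual. (\<mu>, w)"
  have L: "smooth_on UNIV ?L" by (intro smooth_on_Pair smooth_on_const smooth_on_id open_UNIV)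
  have D: "fder ?L w = (\<lambda>w. (0, w))" for w by (intro fder_eqI) (auto intro!: derivative_eq_intros)
  note k = smooth_near_forget[where \<mu> = \<mu>, OF pe(3), folded pe(1)]
    tangent_map_forget[where \<mu> = \<mu>, OF pe(3), folded pe(1)]
  have g': "fst (forget_momentum p) \<in> points M" using pe by simp
  have n: "smooth_near Z0 T (\<lambda>(g, w). (g, ?L w)) (forget_momentum p)"
    "tangent_map Z0 T (\<lambda>(g, w). (g, ?L w)) (forget_momentum p) = (\<lambda>(v, w). (v, 0, w))"
    using smooth_near_map_snd[OF M fin_Z fin_fibre open_UNIV UNIV_I L g']
      tangent_map_map_snd[OF M fin_Z fin_fibre open_UNIV UNIV_I L g']
    by (simp_all add: tulczyjew_manifold_eq D)
  have eq: "(case forget_momentum q of (g, w) \<Rightarrow> (g, ?L w)) = q" if "q \<in> points (Z \<mu>)" for q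
    using that by (rule Z_point) (simp add: forget_momentum_def)
  show "smooth_near (Z \<mu>) T (\<lambda>p. p) p"
    by (rule smooth_near_cong[OF smooth_Z openin_Z p eq smooth_near_compose[OF smooth_Z smooth_Z0
        smooth_T k(1) n(1)]])
  show "tangent_map (Z \<mu>) T (\<lambda>p. p) p = (\<lambda>(v, w). (v, 0, w))"
    using tangent_map_cong[OF smooth_Z openin_Z p eq, where N = T]
      tangent_map_compose[OF smooth_Z smooth_Z0 smooth_T k(1) n(1)] by (simp add: k(2) n(2))
qed

text \<open>The orbit map drops \<mu>, then \<xi>, and then applies \<open>fibre \<mu>\<close>; the
  first and last of these have identity tangent maps, so only the middle one is visible.\<close>

lemma projection_smooth:
  assumes p: "p \<in> points (Z \<mu>)"
  shows "smooth_near (Z \<mu>) (N \<mu>) (orbit vec_group (shift_action G)) p"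
    "tangent_map (Z \<mu>) (N \<mu>) (orbit vec_group (shift_action G)) p = (\<lambda>(v, b, c). (v, c))"
proof -
  obtain g \<xi> \<nu> where pe: "p = pin_momentum \<mu> (g, \<xi>, \<nu>)" "g \<in> points M" "(g, \<xi>, \<nu>) \<in> points Z0"
    using Z_point[OF p] .
  let ?L = "snd :: 'e \<times> 'e dual \<Rightarrow> 'e dual"
  have L: "smooth_on UNIV ?L" by (intro smooth_on_bounded_linear_UNIV bounded_linear_snd)
  have D: "fder ?L w = snd" for w by (intro fder_bounded_linear_self bounded_linear_snd)
  note k = smooth_near_forget[where \<mu> = \<mu>, OF pe(3), folded pe(1)]
    tangent_map_forget[where \<mu> = \<mu>, OF pe(3), folded pe(1)]
  have g': "fst (forget_momentum p) \<in> points M" using pe by simp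
  let ?pr = "\<lambda>(g, w). (g, ?L w)"
  have n: "smooth_near Z0 C ?pr (forget_momentum p)"
    "tangent_map Z0 C ?pr (forget_momentum p) = (\<lambda>(v, w). (v, snd w))"
    using smooth_near_map_snd[OF M fin_Z fin_dual open_UNIV UNIV_I L g']
      tangent_map_map_snd[OF M fin_Z fin_dual open_UNIV UNIV_I L g']
    by (simp_all add: C_eq D)
  note kn = smooth_near_compose[OF smooth_Z smooth_Z0 smooth_C k(1) n(1)]
    tangent_map_compose[OF smooth_Z smooth_Z0 smooth_C k(1) n(1)]
  have pC: "?pr (forget_momentum p) \<in> points C" using pe by (simp add: C_eq)
  note h = smooth_near_fibre[where \<mu> = \<mu>, OF pC] tangent_map_fibre[where \<mu> = \<mu>, OF pC]
  have eq: "fibre \<mu> (?pr (forget_momentum q)) = orbit vec_group (shift_action G) q" if "q \<in> points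
      (Z \<mu>)" for q
    using that by (rule Z_point) (simp add: forget_momentum_def orbit_eq)
  show "smooth_near (Z \<mu>) (N \<mu>) (orbit vec_group (shift_action G)) p"
    by (rule smooth_near_cong[OF smooth_Z openin_Z p eq smooth_near_compose[OF smooth_Z smooth_C
        smooth_N kn(1) h(1)]])
  show "tangent_map (Z \<mu>) (N \<mu>) (orbit vec_group (shift_action G)) p = (\<lambda>(v, b, c). (v, c))"
  proof -
    have "tangent_map (Z \<mu>) (N \<mu>) (orbit vec_group (shift_action G)) p =
        tangent_map (Z \<mu>) (N \<mu>) (\<lambda>q. fibre \<mu> (?pr (forget_momentum q))) p"
      by (rule tangent_map_cong[OF smooth_Z openin_Z p]) (rule eq[symmetric])
    also have "\<dots> = (\<lambda>(v, b, c). (v, c))"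
      unfolding tangent_map_compose[OF smooth_Z smooth_C smooth_N kn(1) h(1)] h(2) kn(2) n(2) k(2)
      by (simp add: fun_eq_iff)
    finally show ?thesis .
  qed
qed

text \<open>\<open>pin_momentum \<mu> \<circ> forget_momentum\<close> is a continuous retraction of
  the whole space onto the level, so open sets of the transported topology are traces of open sets;
  the converse is continuity of the inclusion.\<close>

lemma embedded_Z: "embedded_submanifold (Z \<mu>) T"
proof -
  have sub: "points (Z \<mu>) \<subseteq> points T" unfolding points_Z level_set_def by auto
  have "mtop (Z \<mu>) = subtopology (mtop T) (points (Z \<mu>))"
  proof (rule topology_eq[THEN iffD2, rule_format])
    fix U
    have homs: "homeomorphic_maps (mtop Z0) (mtop (Z \<mu>)) (pin_momentum \<mu>) forget_momentum"
      by (rule transport_homeomorphic_maps[OF smooth_Z0]) simp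
    have incl: "continuous_map (mtop (Z \<mu>)) (mtop T) (\<lambda>p. p)"
      using smooth_map_iff[OF smooth_Z smooth_T] inclusion_smooth(1) unfolding smooth_map_def by
          blast
    have forget: "continuous_map (mtop T) (mtop Z0) forget_momentum"
    proof -
      have e: "forget_momentum = (\<lambda>(g, w). (g, snd w))"
        by (auto simp: forget_momentum_def fun_eq_iff)
      have "smooth_map T Z0 forget_momentum"
        unfolding smooth_map_iff[OF smooth_T smooth_Z0] e unfolding tulczyjew_manifold_eq
        by (intro ballI smooth_near_map_snd[OF M fin_fibre fin_Z open_UNIV UNIV_I
              smooth_on_bounded_linear_UNIV[OF bounded_linear_snd]]) auto
      then show ?thesis by (simp add: smooth_map_def)
    qed
    show "openin (mtop (Z \<mu>)) U \<longleftrightarrow> openin (subtopology (mtop T) (points (Z \<mu>))) U"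
    proof
      assume U: "openin (mtop (Z \<mu>)) U"
      have pin: "continuous_map (mtop Z0) (mtop (Z \<mu>)) (pin_momentum \<mu>)"
        using homs by (simp add: homeomorphic_maps_def)
      have "continuous_map (mtop T) (mtop (Z \<mu>)) (pin_momentum \<mu> \<circ> forget_momentum)"
        using continuous_map_compose[OF forget pin] .
      from openin_continuous_map_preimage[OF this U]
      have "openin (mtop T) {p \<in> points T. pin_momentum \<mu> (forget_momentum p) \<in> U}"
        by (simp add: points_def)
      moreover have "U = {p \<in> points T. pin_momentum \<mu> (forget_momentum p) \<in> U} \<inter> points (Z \<mu>)"
      proof -
        have "U \<subseteq> points (Z \<mu>)" using openin_subset[OF U] by (simp add: points_def)
        moreover have "pin_momentum \<mu> (forget_momentum p) = p" if "p \<in> points (Z \<mu>)" for p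
          using that by (rule Z_point) (simp add: pin_momentum_def forget_momentum_def)
        ultimately show ?thesis using sub by auto
      qed
      ultimately show "openin (subtopology (mtop T) (points (Z \<mu>))) U"
        unfolding openin_subtopology by blast
    next
      assume "openin (subtopology (mtop T) (points (Z \<mu>))) U"
      then obtain W where W: "openin (mtop T) W" "U = W \<inter> points (Z \<mu>)"
        unfolding openin_subtopology by blast
      from openin_continuous_map_preimage[OF incl W(1)] W(2)
      show "openin (mtop (Z \<mu>)) U" by (simp add: points_def Int_def conj_commute)
    qed
  qed
  moreover have "inj (tangent_map (Z \<mu>) T (\<lambda>p. p) p)" if "p \<in> points (Z \<mu>)" for p
    unfolding inclusion_smooth(2)[OF that] by (auto intro!: injI)
  ultimately show ?thesis
    unfolding embedded_submanifold_def
    using smooth_Z smooth_T sub smooth_map_iff[OF smooth_Z smooth_T] inclusion_smooth(1) by blast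
qed

lemma submersion_projection: "submersion (Z \<mu>) (N \<mu>) (orbit vec_group (shift_action G))"
proof -
  have "surj (tangent_map (Z \<mu>) (N \<mu>) (orbit vec_group (shift_action G)) p)" if "p \<in> points (Z \<mu>)"
      for p
  proof -
    have "(v, c) = (\<lambda>(v, b, c). (v, c)) (v, 0 :: 'e, c)" for v :: 'e and c :: "'e dual" by simp
    then show ?thesis unfolding projection_smooth(2)[OF that] surj_def by (metis surj_pair)
  qed
  then show ?thesis
    unfolding submersion_def smooth_map_iff[OF smooth_Z smooth_N] using projection_smooth(1) by
        blast
qed

text \<open>Vectors tangent to the level have zero \<mu>-component, which removes the summand in
  (\<mu>, \<xi>) from \<open>tulczyjew_form_eq\<close> and leaves the canonical form at
  \<open>(g, \<nu>)\<close>.\<close>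

lemma reduced_form_eq:
  assumes p: "p \<in> points (Z \<mu>)"
  shows "pullback (Z \<mu>) (N \<mu>) (orbit vec_group (shift_action G)) (\<lambda>n. cotangent_form G (fibre_base
      n)) p v w =
    pullback (Z \<mu>) T (\<lambda>p. p) (tulczyjew_form G) p v w"
proof -
  obtain g \<xi> \<nu> where pe: "p = (g, \<mu>, \<xi>, \<nu>)" "g \<in> points M" using Z_point[OF p] .
  obtain v1 b c w1 b' c' where "v = (v1, b, c)" "w = (w1, b', c')" by (cases v, cases w)
  then show ?thesis
    unfolding pullback_def projection_smooth(2)[OF p] inclusion_smooth(2)[OF p]
    using pe by (simp add: orbit_eq tulczyjew_form_eq)
qed

text \<open>The form on the orbit space is read off through \<open>fibre_base\<close>, whose tangent
  map is the identity, so pulling back changes nothing.\<close>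

lemma reduced_symplectomorphism:
  "symplectomorphism (N \<mu>) (\<lambda>n. cotangent_form G (fibre_base n)) C (cotangent_form G) fibre_base"
proof -
  have pN: "points (N \<mu>) = fibre \<mu> ` points C" by (rule transport_simps(4)[where h = "fibre \<mu>" and
      k = fibre_base, OF smooth_C fibre_base_fibre])
  have "diffeomorphism (N \<mu>) C fibre_base"
    by (rule diffeomorphismI[OF smooth_N smooth_C, where g = "fibre \<mu>"])
      (auto simp: pN intro: smooth_near_fibre_base smooth_near_fibre)
  then show ?thesis
    unfolding symplectomorphism_def pN
    by (auto simp: pullback_def tangent_map_fibre_base)
qed

lemma symplectic_reduced: "symplectic_form (N \<mu>) (\<lambda>n. cotangent_form G (fibre_base n))"
  by (rule symplectic_form_transport[OF smooth_C _ symplectic_cotangent]) simp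

lemma reduction:
  "abelian_symplectic_reduction vec_group T (tulczyjew_form G) (shift_action G) tulczyjew_momentum \<mu>
    (Z \<mu>) (N \<mu>) (\<lambda>n. cotangent_form G (fibre_base n))"
  unfolding abelian_symplectic_reduction_def
proof (intro conjI ballI allI)
  show "surj (tangent_map T vec_manifold tulczyjew_momentum p)"
    if "p \<in> level_set T tulczyjew_momentum \<mu>" for p
  proof -
    have "p \<in> points T" using that by (simp add: level_set_def)
    moreover have "a = fst (snd (0 :: 'e, a, 0 :: 'e, 0 :: 'e dual))" for a :: "'e dual" by simp
    ultimately show ?thesis unfolding surj_def by (metis momentum_smooth(2))
  qed
  show "tulczyjew_momentum (shift_action G a p) = tulczyjew_momentum p" if "p \<in> points T" for a p
    using that by (cases p) (simp add: shift_apply tulczyjew_momentum_def)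
qed (assumption | rule fin lie_group_vec_group comm_group_vec_group smooth_T symplectic_tulczyjew
    shift_smooth_action shift_symplectomorphism shift_momentum_map embedded_Z points_Z smooth_N
    points_N submersion_projection symplectic_reduced reduced_form_eq)+

end

theorem mainTheorem17:
  fixes G :: "('g, 'e::real_normed_vector) lie_structure" and \<mu> :: "'e dual"
  assumes "lie_group G"
  shows "\<exists>(Z :: (('g, 'e) tulczyjew, 'e \<times> 'e \<times> 'e dual) manifold)
           (N :: (('g, 'e) tulczyjew set, 'e \<times> 'e dual) manifold) \<sigma> F.
           abelian_symplectic_reduction vec_group (tulczyjew_manifold G) (tulczyjew_form G)
             (shift_action G) tulczyjew_momentum \<mu> Z N \<sigma> \<and>
           symplectomorphism N \<sigma> (cotangent_manifold G) (cotangent_form G) F"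
proof -
  interpret lie G by (rule lie.intro[OF assms])
  show ?thesis using reduction reduced_symplectomorphism by blast
qed


end
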